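(* Let $S$ be a finite set, $\lambda$ the uniform probability measure on $\{0,1\}^S$, and $\gamma^{\mathbb{N}}$ the standard Gaussian product measure on $\mathbb{R}^{\mathbb{N}}$. For every function $f$ in $H_1^2(\lambda\otimes\gamma^{\mathbb{N}})$, $$\mathrm{Var}(f)\le \sum_{q\in S}\|\nabla_q f\|_2^2+\sum_{i\in\mathbb{N}}\left\|\frac{\partial f}{\partial y_i}\right\|_2^2\,\phi\left(\frac{\left\|\frac{\partial f}{\partial y_i}\right\|_1}{\left\|\frac{\partial f}{\partial y_i}\right\|_2}\right),$$ where $\phi:[0,1]\to[0,1]$ is defined by $\phi(u)=2\int_0^1\frac{u^{2t}}{(1+t)^2}\,dt$, and where the variance and the norms are taken with respect to $\lambda\otimes\gamma^{\mathbb{N}}$.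
   Context: $\gamma(dy)=\frac{1}{\sqrt{2\pi}}e^{-y^2/2}dy$ on $\mathbb{R}$ and $\gamma^{\mathbb{N}}$ is the countable product of copies of $\gamma$. Points of $\{0,1\}^S\times\mathbb{R}^{\mathbb{N}}$ are written $(x,y)$. $\|\cdot\|_p$ is the $L^p$ norm. For $q\in S$, $\nabla_q f(x,y)=f(x,y)-\int_{\{0,1\}}f(x,y)\,d\beta(x_q)$, i.e. $f$ minus its average over the two values of the coordinate $x_q$ ($\beta=\frac12(\delta_0+\delta_1)$), the other coordinates being fixed. $H_1^2(\lambda\otimes\gamma^{\mathbb{N}})$ is the space of functions $f\in L^2(\lambda\otimes\gamma^{\mathbb{N}})$ such that: (a) for all $i\in\mathbb{N}$ there exists $h_i\in L^2(\lambda\otimes\gamma^{\mathbb{N}})$ such that $-\int_{\mathbb{R}}g'(y_i)f(x,y)\,dy_i=\int_{\mathbb{R}}g(y_i)h_i(x,y)\,dy_i$, $\lambda\otimes\gamma^{\mathbb{N}}$-a.s., for every smooth compactly supported $g:\mathbb{R}\to\mathbb{R}$; $h_i$ is called the partial derivative of $f$ with respect to $y_i$ and denoted $\frac{\partial f}{\partial y_i}$; (b) $\sum_{i\in\mathbb{N}}\left\|\frac{\partial f}{\partial y_i}\right\|_2^2<\infty$. Convention: a term of the sum over $i$ for which $\left\|\frac{\partial f}{\partial y_i}\right\|_2=0$ is equal to $0$. *)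

theory Defs
  imports "HOL-Probability.Probability"
begin

definition coin :: "nat measure" where
  "coin = uniform_count_measure {0, 1}"

text \<open>The points of \<open>{0,1}\<^sup>S\<close> are the extensional functions on \<open>S\<close>; \<open>S\<close> may be empty.\<close>

definition cube :: "'s set \<Rightarrow> ('s \<Rightarrow> nat) measure" where
  "cube S = uniform_count_measure (PiE S (\<lambda>_. {0, 1}))"

definition gauss :: "real measure" where
  "gauss = density lborel std_normal_density"

definition gauss_seq :: "(nat \<Rightarrow> real) measure" where
  "gauss_seq = PiM UNIV (\<lambda>_. gauss)"

definition cube_gauss :: "'s set \<Rightarrow> (('s \<Rightarrow> nat) \<times> (nat \<Rightarrow> real)) measure" where
  "cube_gauss S = cube S \<Otimes>\<^sub>M gauss_seq"

definition L2 :: "'a measure \<Rightarrow> ('a \<Rightarrow> real) set" where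
  "L2 M = {f \<in> borel_measurable M. integrable M (\<lambda>z. (f z)\<^sup>2)}"

definition Lp_norm :: "'a measure \<Rightarrow> real \<Rightarrow> ('a \<Rightarrow> real) \<Rightarrow> real" where
  "Lp_norm M p f = (\<integral>z. \<bar>f z\<bar> powr p \<partial>M) powr (1 / p)"

definition nabla :: "'s \<Rightarrow> (('s \<Rightarrow> nat) \<times> (nat \<Rightarrow> real) \<Rightarrow> real)
    \<Rightarrow> ('s \<Rightarrow> nat) \<times> (nat \<Rightarrow> real) \<Rightarrow> real" where
  "nabla q f = (\<lambda>(x, y). f (x, y) - (\<integral>b. f (x(q := b), y) \<partial>coin))"

definition smooth_compact_support :: "(real \<Rightarrow> real) \<Rightarrow> bool" where
  "smooth_compact_support g \<longleftrightarrow>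
     (\<forall>n t. (deriv ^^ n) g differentiable (at t)) \<and> compact (closure {t. g t \<noteq> 0})"

text \<open>The integrals are over the \<open>i\<close>-th Gaussian coordinate with respect to Lebesgue measure, the
  other coordinates of \<open>y\<close> being fixed. For \<open>f\<close> and \<open>h\<close> in \<open>L2\<close> the integrands are
  integrable for almost every \<open>(x, y)\<close>.\<close>

definition is_partial_deriv :: "'s set \<Rightarrow> nat \<Rightarrow> (('s \<Rightarrow> nat) \<times> (nat \<Rightarrow> real) \<Rightarrow> real)
    \<Rightarrow> (('s \<Rightarrow> nat) \<times> (nat \<Rightarrow> real) \<Rightarrow> real) \<Rightarrow> bool" where
  "is_partial_deriv S i f h \<longleftrightarrow> h \<in> L2 (cube_gauss S) \<and>
     (\<forall>g. smooth_compact_support g \<longrightarrow>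
        (AE (x, y) in cube_gauss S.
           - (\<integral>t. deriv g t * f (x, y(i := t)) \<partial>lborel) = (\<integral>t. g t * h (x, y(i := t)) \<partial>lborel)))"

text \<open>The partial derivative is unique only up to null sets; an arbitrary representative is chosen,
  and only its norms are used.\<close>

definition partial_deriv :: "'s set \<Rightarrow> nat \<Rightarrow> (('s \<Rightarrow> nat) \<times> (nat \<Rightarrow> real) \<Rightarrow> real)
    \<Rightarrow> ('s \<Rightarrow> nat) \<times> (nat \<Rightarrow> real) \<Rightarrow> real" where
  "partial_deriv S i f = (SOME h. is_partial_deriv S i f h)"

definition H12 :: "'s set \<Rightarrow> (('s \<Rightarrow> nat) \<times> (nat \<Rightarrow> real) \<Rightarrow> real) set" where
  "H12 S = {f \<in> L2 (cube_gauss S).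
     (\<forall>i. \<exists>h. is_partial_deriv S i f h) \<and>
     summable (\<lambda>i. (Lp_norm (cube_gauss S) 2 (partial_deriv S i f))\<^sup>2)}"

definition phi :: "real \<Rightarrow> real" where
  "phi u = 2 * (LBINT t:{0..1}. u powr (2 * t) / (1 + t)\<^sup>2)"

end

theory Submission
  imports Defs "HOL-Real_Asymp.Real_Asymp"
begin

text \<open>
  Let \<open>(X, Y)\<close> be a pair of copies of the random point in which every coordinate of \<open>Y\<close> has
  correlation \<open>s\<close> with the same coordinate of \<open>X\<close>, and put \<open>Q s = E (f X * f Y)\<close>. For \<open>s = 1\<close>
  the two points coincide and \<open>Q 1 = E (f\<^sup>2)\<close>; for \<open>s = 0\<close> they are independent and
  \<open>Q 0 = (E f)\<^sup>2\<close>. The variance is therefore the increment of \<open>Q\<close> over \<open>[0, 1]\<close>, and the theorem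
  is an estimate of its derivative, one coordinate at a time.

  Raising the correlation of a coin \<open>q\<close> changes \<open>Q\<close> at the rate \<open>E (D X * D Y)\<close> where
  \<open>D\<close> is \<open>nabla q f\<close> (\<open>coin_increment\<close>), which Cauchy-Schwarz bounds by its squared \<open>L\<^sup>2\<close> norm. Raising
  the correlation of the Gaussian coordinate \<open>i\<close> changes \<open>Q\<close> at the rate \<open>E (h X * h Y)\<close> where
  \<open>h\<close> is the partial derivative (\<open>mehler_increment\<close>). Here hypercontractivity is used: pairs of
  correlation at most \<open>s\<close> satisfy \<open>E (h X * h Y) \<le> \<parallel>h\<parallel>\<^sup>2\<close> with the norm of \<open>L\<^sup>p\<close>, \<open>p = 1 + s\<close>
  (\<open>coupled_form_le_Lp\<close>). Interpolation between \<open>L\<^sup>1\<close> and \<open>L\<^sup>2\<close> bounds the \<open>L\<^sup>p\<close> norm, and the integral over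
  \<open>s\<close> of the bound becomes \<open>phi\<close> after the substitution \<open>s = (1 - t) / (1 + t)\<close>.

  Four points need work. Hypercontractivity is a statement about two functions of two correlated
  points, and in this form it passes to products by applying it to one coordinate after the other. For
  a coin it is Bonami's two-point inequality; for a Gaussian it follows by applying the two-point
  inequality to the steps of a random walk and passing to the limit, which is explicit for
  trigonometric polynomials. The increment formula for a Gaussian coordinate is an explicit
  differentiation for trigonometric polynomials and extends by density. For a general \<open>f\<close> it
  requires that almost every section of \<open>f\<close> is a primitive of the same section of the partial
  derivative (\<open>weak_derivative_has_gauss_deriv\<close>); a countable family of test functions must suffice, since
  the exceptional null set in the definition depends on the test function. Finally,
  only finitely many coordinates are correlated at a time, the others being independent, so \<open>Q 1\<close> is
  first a conditional second moment, and it tends to \<open>E (f\<^sup>2)\<close> when the number of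
  correlated coordinates grows (\<open>coupled_form_diagonal_limit\<close>).\<close>

section \<open>The two-point inequality\<close>

lemma powr_le_one_plus:
  fixes r x :: real assumes "0 \<le> r" "r \<le> 1" "0 \<le> x" shows "(1 + x) powr r \<le> 1 + r * x"
  using Youngs_inequality_0[of r "1 - r" "1 + x" 1] assms by (simp add: algebra_simps)

text \<open>In the variable \<open>t\<close> both sides agree to first order at \<open>0\<close>. The second derivatives compare
  because \<open>u * v = (1 - t\<^sup>2) powr (p - 2) \<ge> 1\<close> for the two powers \<open>u\<close> and \<open>v\<close> that occur, so that their
  mean is at least \<open>1\<close>; this is where \<open>p \<le> 2\<close> enters.\<close>

lemma two_point_taylor:
  fixes p t :: real
  assumes p: "1 \<le> p" "p \<le> 2" and t: "0 \<le> t" "t \<le> 1"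
  shows "1 + p * (p - 1) / 2 * t\<^sup>2 \<le> ((1 + t) powr p + (1 - t) powr p) / 2"
proof -
  define G where "G t = ((1 + t) powr p + (1 - t) powr p) / 2 - 1 - p * (p - 1) / 2 * t\<^sup>2" for t
  define G' where "G' t = p * ((1 + t) powr (p - 1) - (1 - t) powr (p - 1)) / 2 - p * (p - 1) * t" for t
  define G'' where "G'' t = p * (p - 1) * (((1 + t) powr (p - 2) + (1 - t) powr (p - 2)) / 2 - 1)" for t
  have plus: "((\<lambda>t. (1 + t) powr r) has_real_derivative r * (1 + x) powr (r - 1)) (at x)"
    if "\<bar>x\<bar> < 1" for x r :: real
    using DERIV_fun_powr[of "\<lambda>t. 1 + t" 1 x r] that by (auto intro!: derivative_eq_intros)
  have minus: "((\<lambda>t. (1 - t) powr r) has_real_derivative - r * (1 - x) powr (r - 1)) (at x)"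
    if "\<bar>x\<bar> < 1" for x r :: real
    using DERIV_fun_powr[of "\<lambda>t. 1 - t" "- 1" x r] that by (auto intro!: derivative_eq_intros)
  have d1: "(G has_real_derivative G' x) (at x)" if "\<bar>x\<bar> < 1" for x
    unfolding G_def G'_def using that
    by (auto intro!: derivative_eq_intros plus minus simp: field_simps)
  have d2: "(G' has_real_derivative G'' x) (at x)" if "\<bar>x\<bar> < 1" for x
    unfolding G'_def G''_def using that
    by (auto intro!: derivative_eq_intros plus minus simp: field_simps)
  have G''_nonneg: "0 \<le> G'' x" if x: "0 \<le> x" "x < 1" for x
  proof -
    have "1 = 1 powr (p - 2)" by simp
    also have "\<dots> \<le> (1 - x\<^sup>2) powr (p - 2)"
      using x p by (intro powr_mono2') (auto simp: power_le_one_iff abs_square_less_1)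
    also have "\<dots> = (1 + x) powr (p - 2) * (1 - x) powr (p - 2)"
      using x by (subst powr_mult[symmetric]) (auto simp: power2_eq_square algebra_simps)
    finally have *: "1 \<le> (1 + x) powr (p - 2) * (1 - x) powr (p - 2)" .
    have "2 \<le> u + v" if "1 \<le> u * v" "0 \<le> u" "0 \<le> v" for u v :: real
    proof (rule power2_le_imp_le)
      have "0 \<le> (u - v)\<^sup>2" by simp
      then show "2\<^sup>2 \<le> (u + v)\<^sup>2" using that unfolding power2_eq_square by (simp add: algebra_simps)
    qed (use that in auto)
    from this[OF *] have "2 \<le> (1 + x) powr (p - 2) + (1 - x) powr (p - 2)" by simp
    then show ?thesis unfolding G''_def using p by (intro mult_nonneg_nonneg) auto
  qed
  have G'_nonneg: "0 \<le> G' x" if x: "0 \<le> x" "x < 1" for x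
  proof -
    have "G' 0 \<le> G' x"
      by (rule DERIV_nonneg_imp_nondecreasing[OF x(1)]) (use x d2 G''_nonneg in fastforce)
    then show ?thesis by (simp add: G'_def)
  qed
  have "G 0 \<le> G t"
  proof (rule DERIV_nonneg_imp_increasing_open[OF t(1)])
    show "continuous_on {0..t} G" unfolding G_def using t p
      by (intro continuous_intros continuous_on_powr') auto
  qed (use t d1 G'_nonneg in fastforce)
  moreover have "G 0 = 0" by (simp add: G_def)
  ultimately show ?thesis unfolding G_def by linarith
qed

text \<open>Bonami's inequality: on the two-point space the noise operator with parameter \<open>sqrt (p - 1)\<close>
  maps \<open>L\<^sup>p\<close> to \<open>L\<^sup>2\<close> with norm one. After normalizing the mean to \<open>1\<close>, the concave power
  on the left is at most its tangent, and the convex mean on the right is at least its quadratic Taylor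
  polynomial. The two quadratics are the same.\<close>

lemma two_point_hypercontractive:
  fixes p a b :: real
  assumes p: "1 \<le> p" "p \<le> 2" and ab: "0 \<le> a" "0 \<le> b"
  shows "((a + b) / 2)\<^sup>2 + (p - 1) * ((a - b) / 2)\<^sup>2 \<le> ((a powr p + b powr p) / 2) powr (2 / p)"
proof -
  define m where "m = (a + b) / 2"
  show ?thesis
  proof (cases "m = 0")
    case True
    then have "a = 0" "b = 0" using ab by (auto simp: m_def)
    then show ?thesis by simp
  next
    case False
    then have m: "m > 0" using ab by (auto simp: m_def)
    define t where "t = \<bar>a - b\<bar> / (2 * m)"
    have "\<bar>a - b\<bar> \<le> 2 * m" using ab by (simp add: m_def abs_if)
    then have t: "0 \<le> t" "t \<le> 1" using m by (auto simp: t_def)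
    have e: "(m * (1 + t)) powr p = m powr p * (1 + t) powr p" "(m * (1 - t)) powr p = m powr p * (1 - t) powr p"
      using m t by (simp_all add: powr_mult)
    have ab': "a powr p + b powr p = m powr p * ((1 + t) powr p + (1 - t) powr p)"
    proof (cases "a \<ge> b")
      case True
      then have "a = m * (1 + t)" "b = m * (1 - t)" using m by (auto simp: t_def m_def field_simps)
      then show ?thesis by (simp only: e distrib_left[of "m powr p"])
    next
      case False
      then have "b = m * (1 + t)" "a = m * (1 - t)" using m by (auto simp: t_def m_def field_simps)
      then show ?thesis by (simp only: e distrib_left[of "m powr p"] add.commute)
    qed
    have d: "((a - b) / 2)\<^sup>2 = m\<^sup>2 * t\<^sup>2" using m by (simp add: t_def power_divide power_mult_distrib)
    have "(1 + (p - 1) * t\<^sup>2) powr (p / 2) \<le> 1 + p / 2 * ((p - 1) * t\<^sup>2)"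
      using p by (intro powr_le_one_plus) auto
    also have "\<dots> = 1 + p * (p - 1) / 2 * t\<^sup>2" by simp
    also have "\<dots> \<le> ((1 + t) powr p + (1 - t) powr p) / 2" by (rule two_point_taylor[OF p t])
    finally have e: "(1 + (p - 1) * t\<^sup>2) powr (p / 2) \<le> ((1 + t) powr p + (1 - t) powr p) / 2" .
    have "1 + (p - 1) * t\<^sup>2 = ((1 + (p - 1) * t\<^sup>2) powr (p / 2)) powr (2 / p)"
      using p by (simp add: powr_powr add_nonneg_nonneg)
    also have "\<dots> \<le> (((1 + t) powr p + (1 - t) powr p) / 2) powr (2 / p)"
      using e p by (intro powr_mono2) auto
    finally have f: "1 + (p - 1) * t\<^sup>2 \<le> (((1 + t) powr p + (1 - t) powr p) / 2) powr (2 / p)" .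
    have "((a powr p + b powr p) / 2) powr (2 / p) = m\<^sup>2 * (((1 + t) powr p + (1 - t) powr p) / 2) powr (2 / p)"
      unfolding ab' using m p
      by (simp add: powr_mult powr_powr powr_divide powr_numeral)
    with f m have "m\<^sup>2 * (1 + (p - 1) * t\<^sup>2) \<le> ((a powr p + b powr p) / 2) powr (2 / p)"
      by (simp add: mult_left_mono)
    then show ?thesis unfolding d m_def[symmetric] by (simp add: algebra_simps)
  qed
qed

text \<open>The bilinear form of the inequality, with the law of two correlated coins written out. It
  follows from the quadratic form by Cauchy-Schwarz for the form \<open>m1 * m2 + s * d1 * d2\<close> in means and half
  differences, and it is the form that tensorizes.\<close>

lemma two_point_bilinear:
  fixes p s a b c d :: real
  assumes p: "1 \<le> p" "p \<le> 2" and s: "0 \<le> s" "s \<le> p - 1" and pos: "0 \<le> a" "0 \<le> b" "0 \<le> c" "0 \<le> d"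
  shows "(1 + s) / 4 * (a * c + b * d) + (1 - s) / 4 * (a * d + b * c)
    \<le> ((a powr p + b powr p) / 2) powr (1 / p) * ((c powr p + d powr p) / 2) powr (1 / p)"
proof -
  define m1 m2 d1 d2 where "m1 = (a + b) / 2" and "m2 = (c + d) / 2" and "d1 = (a - b) / 2" and "d2 = (c - d) / 2"
  have sq: "(x powr (1 / p))\<^sup>2 = x powr (2 / p)" for x :: real
    by (simp add: power2_eq_square powr_add[symmetric])
  have 1: "m1\<^sup>2 + s * d1\<^sup>2 \<le> ((a powr p + b powr p) / 2) powr (2 / p)"
    using two_point_hypercontractive[OF p pos(1,2)] mult_right_mono[OF s(2), of "d1\<^sup>2"]
    by (simp add: m1_def d1_def)
  have 2: "m2\<^sup>2 + s * d2\<^sup>2 \<le> ((c powr p + d powr p) / 2) powr (2 / p)"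
    using two_point_hypercontractive[OF p pos(3,4)] mult_right_mono[OF s(2), of "d2\<^sup>2"]
    by (simp add: m2_def d2_def)
  have "(m1 * m2 + s * d1 * d2)\<^sup>2 \<le> (m1\<^sup>2 + s * d1\<^sup>2) * (m2\<^sup>2 + s * d2\<^sup>2)"
  proof -
    have "(m1\<^sup>2 + s * d1\<^sup>2) * (m2\<^sup>2 + s * d2\<^sup>2) - (m1 * m2 + s * d1 * d2)\<^sup>2 = s * (m1 * d2 - m2 * d1)\<^sup>2"
      by (simp add: power2_eq_square algebra_simps)
    then show ?thesis using s(1) by (metis diff_ge_0_iff_ge mult_nonneg_nonneg zero_le_power2)
  qed
  also have "\<dots> \<le> ((a powr p + b powr p) / 2) powr (2 / p) * ((c powr p + d powr p) / 2) powr (2 / p)"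
    using 1 2 s by (intro mult_mono) auto
  finally have "(m1 * m2 + s * d1 * d2)\<^sup>2 \<le> (((a powr p + b powr p) / 2) powr (1 / p) * ((c powr p + d powr p) / 2) powr (1 / p))\<^sup>2"
    by (simp add: power_mult_distrib sq)
  then have "m1 * m2 + s * d1 * d2 \<le> ((a powr p + b powr p) / 2) powr (1 / p) * ((c powr p + d powr p) / 2) powr (1 / p)"
    by (rule power2_le_imp_le) auto
  moreover have "m1 * m2 + s * d1 * d2 = (1 + s) / 4 * (a * c + b * d) + (1 - s) / 4 * (a * d + b * c)"
    by (simp add: m1_def m2_def d1_def d2_def field_simps)
  ultimately show ?thesis by simp
qed

section \<open>Infinite products: resampling one coordinate\<close>

text \<open>Replacing one coordinate by an independent sample. Allowing another measure \<open>M' i\<close> at the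
  discarded coordinate is what makes it possible to change the law of one coordinate of a product
  while the point \<open>w\<close> that carries all others stays the same.\<close>

lemma distr_resample:
  fixes M M' :: "'i \<Rightarrow> 'a measure"
  assumes M: "\<And>j. prob_space (M j)" and M': "\<And>j. prob_space (M' j)"
    and eq: "\<And>j. j \<noteq> i \<Longrightarrow> M' j = M j" and sets_i: "sets (M' i) = sets (M i)"
  shows "distr (PiM UNIV M' \<Otimes>\<^sub>M M i) (PiM UNIV M) (\<lambda>(w, a). w(i := a)) = PiM UNIV M"
proof (rule measure_eqI_PiM_infinite[symmetric, OF refl])
  interpret Mi: prob_space "M i" by fact
  interpret P: prob_space "PiM UNIV M" by (intro prob_space_PiM M)
  interpret P': prob_space "PiM UNIV M'" by (intro prob_space_PiM M')
  have sets_M': "sets (M' j) = sets (M j)" for j using eq sets_i by (cases "j = i") auto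
  have space_M': "space (M' j) = space (M j)" for j by (intro sets_eq_imp_space_eq sets_M')
  have sP: "sets (PiM UNIV M') = sets (PiM UNIV M)" by (intro sets_PiM_cong sets_M') auto
  show "finite_measure (PiM UNIV M)" by unfold_locales
  have [measurable]: "(\<lambda>(w, a). w(i := a)) \<in> PiM UNIV M' \<Otimes>\<^sub>M M i \<rightarrow>\<^sub>M PiM UNIV M"
    by (subst measurable_cong_sets[OF sets_pair_measure_cong[OF sP refl] refl])
       (use measurable_add_dim[of i UNIV M] in simp)
  fix J A assume J: "finite J" "J \<subseteq> UNIV" and A: "\<And>j. j \<in> J \<Longrightarrow> A j \<in> sets (M j)"
  let ?X = "prod_emb UNIV M J (Pi\<^sub>E J A)"
  have A': "\<And>j. j \<in> J - {i} \<Longrightarrow> A j \<in> sets (M' j)" using A sets_M' by auto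
  have "PiM UNIV M ?X = (\<Prod>j\<in>J. M j (A j))"
    using M J A by (intro emeasure_PiM_emb) auto
  also have "\<dots> = M i (if i \<in> J then A i else space (M i)) * (\<Prod>j\<in>J-{i}. M j (A j))"
    using prod.insert_remove[of J "\<lambda>j. M j (A j)" i] J Mi.emeasure_space_1
    by (cases "i \<in> J") (auto simp: insert_absorb)
  also have "(\<Prod>j\<in>J-{i}. M j (A j)) = (\<Prod>j\<in>J-{i}. M' j (A j))"
    by (intro prod.cong) (auto simp: eq)
  also have "\<dots> = PiM UNIV M' (prod_emb UNIV M' (J - {i}) (Pi\<^sub>E (J - {i}) A))"
    using M' J A' by (intro emeasure_PiM_emb[symmetric]) auto
  also have "M i (if i \<in> J then A i else space (M i)) * \<dots> =
    (PiM UNIV M' \<Otimes>\<^sub>M M i) (prod_emb UNIV M' (J - {i}) (Pi\<^sub>E (J - {i}) A) \<times> (if i \<in> J then A i else space (M i)))"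
    using J A A' by (subst Mi.emeasure_pair_measure_Times) (auto simp: mult.commute intro!: sets_PiM_I)
  also have "(prod_emb UNIV M' (J - {i}) (Pi\<^sub>E (J - {i}) A) \<times> (if i \<in> J then A i else space (M i))) =
    (\<lambda>(w, a). w(i := a)) -` ?X \<inter> space (PiM UNIV M' \<Otimes>\<^sub>M M i)"
    using A[THEN sets.sets_into_space] A[of i, THEN sets.sets_into_space]
    unfolding set_eq_iff
    by (auto simp: prod_emb_def space_pair_measure space_PiM PiE_iff space_M' fun_upd_def split: if_splits)
  finally show "PiM UNIV M ?X = distr (PiM UNIV M' \<Otimes>\<^sub>M M i) (PiM UNIV M) (\<lambda>(w, a). w(i := a)) ?X"
    using J A by (simp add: emeasure_distr)
qed simp

lemma
  fixes M M' :: "'i \<Rightarrow> 'a measure" and f :: "('i \<Rightarrow> 'a) \<Rightarrow> real"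
  assumes M: "\<And>j. prob_space (M j)" and M': "\<And>j. prob_space (M' j)"
    and eq: "\<And>j. j \<noteq> i \<Longrightarrow> M' j = M j" and sets_i: "sets (M' i) = sets (M i)"
    and f: "integrable (PiM UNIV M) f"
  shows integral_resample: "(\<integral>w. (\<integral>a. f (w(i := a)) \<partial>M i) \<partial>PiM UNIV M') = integral\<^sup>L (PiM UNIV M) f"
    and integrable_resample: "integrable (PiM UNIV M') (\<lambda>w. \<integral>a. f (w(i := a)) \<partial>M i)"
    and AE_integrable_resample: "AE w in PiM UNIV M'. integrable (M i) (\<lambda>a. f (w(i := a)))"
proof -
  interpret Mi: prob_space "M i" by fact
  interpret P': prob_space "PiM UNIV M'" by (intro prob_space_PiM M')
  interpret PP: pair_sigma_finite "PiM UNIV M'" "M i" ..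
  have sets_M': "sets (M' j) = sets (M j)" for j using eq sets_i by (cases "j = i") auto
  have sP: "sets (PiM UNIV M') = sets (PiM UNIV M)" by (intro sets_PiM_cong sets_M') auto
  have mm: "(\<lambda>(w, a). w(i := a)) \<in> PiM UNIV M' \<Otimes>\<^sub>M M i \<rightarrow>\<^sub>M PiM UNIV M"
    by (subst measurable_cong_sets[OF sets_pair_measure_cong[OF sP refl] refl])
       (use measurable_add_dim[of i UNIV M] in simp)
  have d: "distr (PiM UNIV M' \<Otimes>\<^sub>M M i) (PiM UNIV M) (\<lambda>(w, a). w(i := a)) = PiM UNIV M"
    by (rule distr_resample[of M M' i, OF M M' eq sets_i])
  have fm: "f \<in> borel_measurable (PiM UNIV M)" using f by auto
  have int: "integrable (PiM UNIV M' \<Otimes>\<^sub>M M i) (\<lambda>(w, a). f (w(i := a)))"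
    using integrable_distr_eq[OF mm fm] f unfolding d by (simp add: case_prod_beta')
  show "AE w in PiM UNIV M'. integrable (M i) (\<lambda>a. f (w(i := a)))"
    using PP.AE_integrable_fst'[OF int] by simp
  show "integrable (PiM UNIV M') (\<lambda>w. \<integral>a. f (w(i := a)) \<partial>M i)"
    using PP.integrable_fst'[OF int] by simp
  have "integral\<^sup>L (PiM UNIV M) f = (\<integral>z. (case z of (w, a) \<Rightarrow> f (w(i := a))) \<partial>(PiM UNIV M' \<Otimes>\<^sub>M M i))"
    using integral_distr[OF mm fm] unfolding d by (simp add: case_prod_beta')
  also have "\<dots> = (\<integral>w. (\<integral>a. f (w(i := a)) \<partial>M i) \<partial>PiM UNIV M')"
    using PP.integral_fst'[OF int] by simp
  finally show "(\<integral>w. (\<integral>a. f (w(i := a)) \<partial>M i) \<partial>PiM UNIV M') = integral\<^sup>L (PiM UNIV M) f" by simp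
qed

lemma distr_PiM_componentwise:
  fixes N :: "'i \<Rightarrow> 'b measure" and M :: "'i \<Rightarrow> 'a measure"
  assumes N: "\<And>i. prob_space (N i)" and g: "\<And>i. g i \<in> N i \<rightarrow>\<^sub>M M i"
    and d: "\<And>i. distr (N i) (M i) (g i) = M i"
  shows "distr (PiM UNIV N) (PiM UNIV M) (\<lambda>w i. g i (w i)) = PiM UNIV M"
proof (rule measure_eqI_PiM_infinite[symmetric, OF refl])
  have M: "prob_space (M i)" for i
    using prob_space.prob_space_distr[OF N g, of i] unfolding d .
  interpret P: prob_space "PiM UNIV M" by (intro prob_space_PiM M)
  show "finite_measure (PiM UNIV M)" by unfold_locales
  have mm: "(\<lambda>w i. g i (w i)) \<in> PiM UNIV N \<rightarrow>\<^sub>M PiM UNIV M"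
    using g by (intro measurable_PiM_single') (auto intro!: measurable_compose[OF measurable_component_singleton] simp: space_PiM PiE_iff dest: measurable_space)
  fix J A assume J: "finite J" "J \<subseteq> UNIV" and A: "\<And>j. j \<in> J \<Longrightarrow> A j \<in> sets (M j)"
  let ?X = "prod_emb UNIV M J (Pi\<^sub>E J A)"
  have "PiM UNIV M ?X = (\<Prod>j\<in>J. M j (A j))"
    using M J A by (intro emeasure_PiM_emb) auto
  also have "\<dots> = (\<Prod>j\<in>J. N j (g j -` A j \<inter> space (N j)))"
    by (intro prod.cong refl) (subst d[symmetric], rule emeasure_distr[OF g A])
  also have "\<dots> = PiM UNIV N (prod_emb UNIV N J (Pi\<^sub>E J (\<lambda>j. g j -` A j \<inter> space (N j))))"
    using N J A g by (intro emeasure_PiM_emb[symmetric]) (auto intro: measurable_sets)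
  also have "prod_emb UNIV N J (Pi\<^sub>E J (\<lambda>j. g j -` A j \<inter> space (N j))) = (\<lambda>w i. g i (w i)) -` ?X \<inter> space (PiM UNIV N)"
    using g[THEN measurable_space] by (auto simp: prod_emb_def space_PiM PiE_iff)
  finally show "PiM UNIV M ?X = distr (PiM UNIV N) (PiM UNIV M) (\<lambda>w i. g i (w i)) ?X"
    using J A mm by (subst emeasure_distr) (auto intro: sets_PiM_I)
qed simp


text \<open>An infinite product of pairs is a pair of infinite products. The generating sets of the left-hand
  product are not rectangles, so the equality is first shown for two cylinders, then for a measurable set and
  a cylinder, then for two measurable sets; each step compares two finite measures on a product.\<close>

lemma distr_PiM_pair:
  fixes N :: "'i \<Rightarrow> 'b measure" and M :: "'i \<Rightarrow> 'a measure"
  assumes M: "\<And>i. prob_space (M i)" and N: "\<And>i. prob_space (N i)"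
  shows "distr (PiM UNIV (\<lambda>i. M i \<Otimes>\<^sub>M N i)) (PiM UNIV M \<Otimes>\<^sub>M PiM UNIV N) (\<lambda>w. (\<lambda>i. fst (w i), \<lambda>i. snd (w i)))
    = PiM UNIV M \<Otimes>\<^sub>M PiM UNIV N"
proof -
  define R where "R = PiM UNIV (\<lambda>i. M i \<Otimes>\<^sub>M N i)"
  define X where "X = (\<lambda>(w :: 'i \<Rightarrow> 'a \<times> 'b) i. fst (w i))"
  define Y where "Y = (\<lambda>(w :: 'i \<Rightarrow> 'a \<times> 'b) i. snd (w i))"
  interpret m: prob_space "M i" for i by fact
  interpret n: prob_space "N i" for i by fact
  interpret mn: pair_prob_space "M i" "N i" for i ..
  have MN: "prob_space (M i \<Otimes>\<^sub>M N i)" for i by (rule mn.prob_space_axioms)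
  interpret PM: prob_space "PiM UNIV M" by (intro prob_space_PiM M)
  interpret PN: prob_space "PiM UNIV N" by (intro prob_space_PiM N)
  interpret R: prob_space R unfolding R_def by (intro prob_space_PiM MN)
  interpret PP: pair_prob_space "PiM UNIV M" "PiM UNIV N" ..
  have X[measurable]: "X \<in> R \<rightarrow>\<^sub>M PiM UNIV M" unfolding X_def R_def
    by (intro measurable_PiM_single')
       (auto intro!: measurable_compose[OF measurable_component_singleton] simp: space_PiM PiE_iff space_pair_measure mem_Times_iff)
  have Y[measurable]: "Y \<in> R \<rightarrow>\<^sub>M PiM UNIV N" unfolding Y_def R_def
    by (intro measurable_PiM_single')
       (auto intro!: measurable_compose[OF measurable_component_singleton] simp: space_PiM PiE_iff space_pair_measure mem_Times_iff)
  have cyl: "emeasure R (X -` prod_emb UNIV M J (Pi\<^sub>E J A) \<inter> Y -` prod_emb UNIV N K (Pi\<^sub>E K B) \<inter> space R)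
      = PiM UNIV M (prod_emb UNIV M J (Pi\<^sub>E J A)) * PiM UNIV N (prod_emb UNIV N K (Pi\<^sub>E K B))"
    if J: "finite J" "\<And>j. j \<in> J \<Longrightarrow> A j \<in> sets (M j)" and K: "finite K" "\<And>j. j \<in> K \<Longrightarrow> B j \<in> sets (N j)" for J A K B
  proof -
    define A' where "A' j = (if j \<in> J then A j else space (M j))" for j
    define B' where "B' j = (if j \<in> K then B j else space (N j))" for j
    have A': "A' j \<in> sets (M j)" and B': "B' j \<in> sets (N j)" for j
      using J K by (auto simp: A'_def B'_def)
    have "X -` prod_emb UNIV M J (Pi\<^sub>E J A) \<inter> Y -` prod_emb UNIV N K (Pi\<^sub>E K B) \<inter> space R
      = prod_emb UNIV (\<lambda>i. M i \<Otimes>\<^sub>M N i) (J \<union> K) (Pi\<^sub>E (J \<union> K) (\<lambda>j. A' j \<times> B' j))"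
      using J(2)[THEN sets.sets_into_space] K(2)[THEN sets.sets_into_space]
      by (auto simp: prod_emb_def space_PiM PiE_iff X_def Y_def R_def A'_def B'_def space_pair_measure
          mem_Times_iff split: if_splits)
    then have "emeasure R (X -` prod_emb UNIV M J (Pi\<^sub>E J A) \<inter> Y -` prod_emb UNIV N K (Pi\<^sub>E K B) \<inter> space R)
      = (\<Prod>j\<in>J \<union> K. emeasure (M j \<Otimes>\<^sub>M N j) (A' j \<times> B' j))"
      unfolding R_def using J K A' B' MN by (simp add: emeasure_PiM_emb)
    also have "\<dots> = (\<Prod>j\<in>J \<union> K. M j (A' j)) * (\<Prod>j\<in>J \<union> K. N j (B' j))"
      using A' B' by (simp add: n.emeasure_pair_measure_Times prod.distrib)
    also have "(\<Prod>j\<in>J \<union> K. M j (A' j)) = (\<Prod>j\<in>J. M j (A j))"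
      using J K by (intro prod.mono_neutral_cong_right) (auto simp: A'_def m.emeasure_space_1)
    also have "(\<Prod>j\<in>J \<union> K. N j (B' j)) = (\<Prod>j\<in>K. N j (B j))"
      using J K by (intro prod.mono_neutral_cong_right) (auto simp: B'_def n.emeasure_space_1)
    finally show ?thesis using J K M N by (simp add: emeasure_PiM_emb)
  qed
  have rect1: "emeasure R (X -` A \<inter> Y -` B \<inter> space R) = PiM UNIV M A * PiM UNIV N B"
    if A: "A \<in> sets (PiM UNIV M)" and B: "B = prod_emb UNIV N K (Pi\<^sub>E K B')" "finite K" "\<And>j. j \<in> K \<Longrightarrow> B' j \<in> sets (N j)"
    for A B K B'
  proof -
    have Bs[measurable]: "B \<in> sets (PiM UNIV N)" using B by (auto intro: sets_PiM_I)
    define P where "P = distr (density R (indicator (Y -` B \<inter> space R))) (PiM UNIV M) X"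
    define Q where "Q = scale_measure (PiM UNIV N B) (PiM UNIV M)"
    have P: "emeasure P A = emeasure R (X -` A \<inter> Y -` B \<inter> space R)" if "A \<in> sets (PiM UNIV M)" for A
    proof -
      have [measurable]: "A \<in> sets (PiM UNIV M)" "B \<in> sets (PiM UNIV N)" using that A Bs by auto
      have "emeasure P A  = emeasure (density R (indicator (Y -` B \<inter> space R))) (X -` A \<inter> space R)"
        unfolding P_def by (subst emeasure_distr) auto
      also have "\<dots> = (\<integral>\<^sup>+x. indicator (Y -` B \<inter> space R) x * indicator (X -` A \<inter> space R) x \<partial>R)"
        by (rule emeasure_density) auto
      also have "\<dots> = (\<integral>\<^sup>+x. indicator (X -` A \<inter> Y -` B \<inter> space R) x \<partial>R)"
        by (intro nn_integral_cong) (auto split: split_indicator)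
      also have "\<dots> = emeasure R (X -` A \<inter> Y -` B \<inter> space R)"
        by (rule nn_integral_indicator) auto
      finally show ?thesis .
    qed
    have "P = Q"
    proof (rule measure_eqI_PiM_infinite)
      show "finite_measure P"
        by (rule finite_measureI) (simp add: P_def, subst P[unfolded P_def], auto)
      fix J A assume "finite J" "J \<subseteq> UNIV" and "\<And>j. j \<in> J \<Longrightarrow> A j \<in> sets (M j)"
      then show "emeasure P (prod_emb UNIV M J (Pi\<^sub>E J A)) = emeasure Q (prod_emb UNIV M J (Pi\<^sub>E J A))"
        using cyl[of J A K B'] B by (subst P) (auto simp: Q_def mult.commute intro: sets_PiM_I)
    qed (auto simp: P_def Q_def)
    then show ?thesis using P[OF A] by (simp add: Q_def mult.commute)
  qed
  have rect: "emeasure R (X -` A \<inter> Y -` B \<inter> space R) = PiM UNIV M A * PiM UNIV N B"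
    if A[measurable]: "A \<in> sets (PiM UNIV M)" and B: "B \<in> sets (PiM UNIV N)" for A B
  proof -
    define P where "P = distr (density R (indicator (X -` A \<inter> space R))) (PiM UNIV N) Y"
    define Q where "Q = scale_measure (PiM UNIV M A) (PiM UNIV N)"
    have P: "emeasure P B = emeasure R (X -` A \<inter> Y -` B \<inter> space R)" if "B \<in> sets (PiM UNIV N)" for B
    proof -
      have [measurable]: "A \<in> sets (PiM UNIV M)" "B \<in> sets (PiM UNIV N)" using that A by auto
      have "emeasure P B = emeasure (density R (indicator (X -` A \<inter> space R))) (Y -` B \<inter> space R)"
        unfolding P_def by (subst emeasure_distr) auto
      also have "\<dots> = (\<integral>\<^sup>+x. indicator (X -` A \<inter> space R) x * indicator (Y -` B \<inter> space R) x \<partial>R)"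
        by (rule emeasure_density) auto
      also have "\<dots> = (\<integral>\<^sup>+x. indicator (X -` A \<inter> Y -` B \<inter> space R) x \<partial>R)"
        by (intro nn_integral_cong) (auto split: split_indicator)
      also have "\<dots> = emeasure R (X -` A \<inter> Y -` B \<inter> space R)"
        by (rule nn_integral_indicator) auto
      finally show ?thesis .
    qed
    have "P = Q"
    proof (rule measure_eqI_PiM_infinite)
      show "finite_measure P"
        by (rule finite_measureI) (simp add: P_def, subst P[unfolded P_def], auto)
      fix K B assume "finite K" "K \<subseteq> UNIV" and "\<And>j. j \<in> K \<Longrightarrow> B j \<in> sets (N j)"
      then show "emeasure P (prod_emb UNIV N K (Pi\<^sub>E K B)) = emeasure Q (prod_emb UNIV N K (Pi\<^sub>E K B))"
        using rect1[OF A refl, of K B] by (subst P) (auto simp: Q_def intro: sets_PiM_I)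
    qed (auto simp: P_def Q_def)
    then show ?thesis using P[OF B] by (simp add: Q_def)
  qed
  have "PiM UNIV M \<Otimes>\<^sub>M PiM UNIV N = distr R (PiM UNIV M \<Otimes>\<^sub>M PiM UNIV N) (\<lambda>w. (X w, Y w))"
  proof (rule pair_measure_eqI)
    fix A B assume AB: "A \<in> sets (PiM UNIV M)" "B \<in> sets (PiM UNIV N)"
    have "(\<lambda>w. (X w, Y w)) -` (A \<times> B) \<inter> space R = X -` A \<inter> Y -` B \<inter> space R" by auto
    then show "emeasure (PiM UNIV M) A * emeasure (PiM UNIV N) B
      = emeasure (distr R (PiM UNIV M \<Otimes>\<^sub>M PiM UNIV N) (\<lambda>w. (X w, Y w))) (A \<times> B)"
      using AB rect by (subst emeasure_distr) auto
  qed (auto intro: PM.sigma_finite_measure_axioms PN.sigma_finite_measure_axioms)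
  then show ?thesis unfolding R_def X_def Y_def ..
qed

section \<open>Couplings and tensorization of hypercontractivity\<close>

lemma integrable_mult_L2:
  fixes u v :: "'a \<Rightarrow> real"
  assumes [measurable]: "u \<in> borel_measurable N" "v \<in> borel_measurable N"
    and "integrable N (\<lambda>x. (u x)\<^sup>2)" "integrable N (\<lambda>x. (v x)\<^sup>2)"
  shows "integrable N (\<lambda>x. u x * v x)"
proof (rule Bochner_Integration.integrable_bound)
  show "integrable N (\<lambda>x. (u x)\<^sup>2 + (v x)\<^sup>2)" using assms by auto
  have "\<bar>a * b\<bar> \<le> a\<^sup>2 + b\<^sup>2" for a b :: real
  proof -
    have "2 * \<bar>a\<bar> * \<bar>b\<bar> \<le> a\<^sup>2 + b\<^sup>2" using sum_squares_bound[of "\<bar>a\<bar>" "\<bar>b\<bar>"] by simp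
    moreover have "0 \<le> \<bar>a\<bar> * \<bar>b\<bar>" by simp
    ultimately show ?thesis unfolding abs_mult by linarith
  qed
  then show "AE x in N. norm (u x * v x) \<le> norm ((u x)\<^sup>2 + (v x)\<^sup>2)" by simp
qed measurable

lemma (in finite_measure) integrable_L2:
  fixes u :: "'a \<Rightarrow> real"
  assumes [measurable]: "u \<in> borel_measurable M" and "integrable M (\<lambda>x. (u x)\<^sup>2)"
  shows "integrable M u"
  using integrable_mult_L2[of u M "\<lambda>_. 1"] assms by simp

text \<open>Young's inequality for \<open>f / A\<close>, where \<open>A\<close> is the \<open>L\<^sup>p\<close> norm, integrates to the claim.\<close>

lemma (in prob_space) integral_le_Lp_norm:
  fixes f :: "'a \<Rightarrow> real"
  assumes [measurable]: "f \<in> borel_measurable M" and f: "\<And>x. 0 \<le> f x" "\<And>x. f x \<le> K" and p: "1 \<le> p"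
  shows "(\<integral>x. f x \<partial>M) \<le> (\<integral>x. f x powr p \<partial>M) powr (1 / p)"
proof -
  have K: "0 \<le> K" using f order_trans by blast
  have int: "integrable M f"
    by (rule integrable_const_bound[where B = K]) (use f in auto)
  have intp: "integrable M (\<lambda>x. f x powr p)"
    by (rule integrable_const_bound[where B = "K powr p"]) (use f p in \<open>auto intro!: powr_mono2\<close>)
  define A where "A = (\<integral>x. f x powr p \<partial>M) powr (1 / p)"
  have nn: "0 \<le> (\<integral>x. f x powr p \<partial>M)" by (rule Bochner_Integration.integral_nonneg) auto
  show ?thesis
  proof (cases "(\<integral>x. f x powr p \<partial>M) = 0")
    case True
    then have "AE x in M. f x powr p = 0" using integral_nonneg_eq_0_iff_AE[OF intp] by auto
    then have "AE x in M. f x = 0" by eventually_elim (use p in auto)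
    then have "(\<integral>x. f x \<partial>M) = 0" by (rule integral_eq_zero_AE)
    then show ?thesis using True by simp
  next
    case False
    then have A: "A > 0" unfolding A_def using nn by (auto simp: less_le)
    have Ap: "A powr p = (\<integral>x. f x powr p \<partial>M)" unfolding A_def using p nn by (simp add: powr_powr)
    have "f x / A \<le> (1 / p) * (f x powr p / A powr p) + (1 - 1 / p)" for x
    proof (cases "f x = 0")
      case True then show ?thesis using p by (simp add: field_simps)
    next
      case False
      then have "f x > 0" using f(1)[of x] by simp
      then show ?thesis
        using Youngs_inequality_0[of "1 / p" "1 - 1 / p" "(f x / A) powr p" 1] p A
        by (simp add: powr_powr powr_divide)
    qed
    then have "(\<integral>x. f x / A \<partial>M) \<le> (\<integral>x. (1 / p) * (f x powr p / A powr p) + (1 - 1 / p) \<partial>M)"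
      by (intro integral_mono) (use int intp in auto)
    also have "\<dots> = (1 / p) * ((\<integral>x. f x powr p \<partial>M) / A powr p) + (1 - 1 / p)"
      using intp by (simp add: prob_space)
    also have "\<dots> = 1" unfolding Ap using False by simp
    finally show ?thesis using A unfolding A_def[symmetric] by (simp add: field_simps)
  qed
qed

definition coupling :: "real measure \<Rightarrow> (real \<times> real) measure \<Rightarrow> bool" where
  "coupling M c \<longleftrightarrow> prob_space c \<and> sets c = sets (borel \<Otimes>\<^sub>M borel) \<and>
     distr c borel fst = M \<and> distr c borel snd = M"

text \<open>The two-function form of hypercontractivity. Bounded functions suffice, since all
  integrals then exist and truncation recovers the rest; a real \<open>K\<close> bounds both functions.\<close>

definition hypercontractive :: "real \<Rightarrow> real measure \<Rightarrow> (real \<times> real) measure \<Rightarrow> bool" where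
  "hypercontractive p M c \<longleftrightarrow> (\<forall>f g K. f \<in> borel_measurable borel \<longrightarrow> g \<in> borel_measurable borel \<longrightarrow>
     (\<forall>x. 0 \<le> f x \<and> f x \<le> K) \<longrightarrow> (\<forall>x. 0 \<le> g x \<and> g x \<le> K) \<longrightarrow>
     (\<integral>z. f (fst z) * g (snd z) \<partial>c) \<le> (\<integral>x. f x powr p \<partial>M) powr (1 / p) * (\<integral>x. g x powr p \<partial>M) powr (1 / p))"

lemma coupling_prob_space: "coupling M c \<Longrightarrow> prob_space c"
  by (simp add: coupling_def)

lemma coupling_sets: "coupling M c \<Longrightarrow> sets c = sets (borel \<Otimes>\<^sub>M borel)"
  by (simp add: coupling_def)

lemma coupling_measurable_fst: "coupling M c \<Longrightarrow> fst \<in> c \<rightarrow>\<^sub>M borel"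
  using measurable_cong_sets[of c "borel \<Otimes>\<^sub>M borel" borel borel] by (auto simp: coupling_def)

lemma coupling_measurable_snd: "coupling M c \<Longrightarrow> snd \<in> c \<rightarrow>\<^sub>M borel"
  using measurable_cong_sets[of c "borel \<Otimes>\<^sub>M borel" borel borel] by (auto simp: coupling_def)

lemma coupling_marginal_sets: "coupling M c \<Longrightarrow> sets M = sets borel"
  unfolding coupling_def using sets_distr[of c borel fst] by simp

lemma coupling_marginal_space: "coupling M c \<Longrightarrow> space M = UNIV"
  using sets_eq_imp_space_eq[OF coupling_marginal_sets, of M c] by simp

lemma coupling_marginal_prob_space: "coupling M c \<Longrightarrow> prob_space M"
  using prob_space.prob_space_distr[OF coupling_prob_space coupling_measurable_fst]
  by (fastforce simp: coupling_def)

lemma coupling_product: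
  assumes "prob_space M" "sets M = sets borel" shows "coupling M (M \<Otimes>\<^sub>M M)"
proof -
  interpret M: prob_space M by fact
  interpret MM: pair_prob_space M M ..
  have "distr (M \<Otimes>\<^sub>M M) borel fst = distr (M \<Otimes>\<^sub>M M) M fst" "distr (M \<Otimes>\<^sub>M M) borel snd = distr (M \<Otimes>\<^sub>M M) M snd"
    using assms by (auto intro: distr_cong)
  moreover have "distr (M \<Otimes>\<^sub>M M) M fst = M"
  proof (rule measure_eqI)
    fix A assume "A \<in> sets (distr (M \<Otimes>\<^sub>M M) M fst)"
    then have A: "A \<in> sets M" by simp
    then have "fst -` A \<inter> space (M \<Otimes>\<^sub>M M) = A \<times> space M"
      using sets.sets_into_space by (auto simp: space_pair_measure)
    then show "emeasure (distr (M \<Otimes>\<^sub>M M) M fst) A = emeasure M A"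
      using A by (simp add: emeasure_distr M.emeasure_pair_measure_Times M.emeasure_space_1)
  qed simp
  moreover have "distr (M \<Otimes>\<^sub>M M) M snd = M"
  proof (rule measure_eqI)
    fix A assume "A \<in> sets (distr (M \<Otimes>\<^sub>M M) M snd)"
    then have A: "A \<in> sets M" by simp
    then have "snd -` A \<inter> space (M \<Otimes>\<^sub>M M) = space M \<times> A"
      using sets.sets_into_space by (auto simp: space_pair_measure)
    then show "emeasure (distr (M \<Otimes>\<^sub>M M) M snd) A = emeasure M A"
      using A by (simp add: emeasure_distr M.emeasure_pair_measure_Times M.emeasure_space_1)
  qed simp
  ultimately show ?thesis unfolding coupling_def
    using MM.prob_space_axioms sets_pair_measure_cong[OF assms(2) assms(2)] by auto
qed


lemma integral_fst_times_snd:
  fixes f :: "'a \<Rightarrow> real" and g :: "'b \<Rightarrow> real"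
  assumes "prob_space M" "prob_space N" and f: "integrable M f" and g: "integrable N g"
  shows "(\<integral>z. f (fst z) * g (snd z) \<partial>(M \<Otimes>\<^sub>M N)) = (\<integral>x. f x \<partial>M) * (\<integral>x. g x \<partial>N)"
proof -
  interpret M: prob_space M by fact
  interpret N: prob_space N by fact
  interpret MM: pair_prob_space M N ..
  have [measurable]: "f \<in> borel_measurable M" "g \<in> borel_measurable N" using f g by auto
  have 1: "integrable (M \<Otimes>\<^sub>M N) (\<lambda>(x, y). f x * g y)"
  proof (rule MM.Fubini_integrable)
    show "(\<lambda>(x, y). f x * g y) \<in> borel_measurable (M \<Otimes>\<^sub>M N)" by measurable
    have "(\<lambda>x. \<integral>y. norm (case (x, y) of (x, y) \<Rightarrow> f x * g y) \<partial>N) = (\<lambda>x. \<bar>f x\<bar> * (\<integral>y. \<bar>g y\<bar> \<partial>N))"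
      by (simp add: abs_mult)
    then show "integrable M (\<lambda>x. \<integral>y. norm (case (x, y) of (x, y) \<Rightarrow> f x * g y) \<partial>N)"
      using f by (simp add: integrable_abs)
  qed (use g in simp)
  show "(\<integral>z. f (fst z) * g (snd z) \<partial>(M \<Otimes>\<^sub>M N)) = (\<integral>x. f x \<partial>M) * (\<integral>x. g x \<partial>N)"
    using MM.integral_fst'[OF 1] by (simp add: case_prod_beta')
qed

lemma hypercontractive_product:
  assumes "prob_space M" and sets: "sets M = sets borel" and p: "1 \<le> p"
  shows "hypercontractive p M (M \<Otimes>\<^sub>M M)"
  unfolding hypercontractive_def
proof (intro allI impI)
  interpret M: prob_space M by fact
  fix f g :: "real \<Rightarrow> real" and K
  assume f: "f \<in> borel_measurable borel" and g: "g \<in> borel_measurable borel"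
    and fb: "\<forall>x. 0 \<le> f x \<and> f x \<le> K" and gb: "\<forall>x. 0 \<le> g x \<and> g x \<le> K"
  have [measurable]: "f \<in> borel_measurable M" "g \<in> borel_measurable M"
    using f g sets by (simp_all cong: measurable_cong_sets)
  have "integrable M f" "integrable M g"
    by (rule M.integrable_const_bound[where B = K], use fb gb in auto)+
  then have "(\<integral>z. f (fst z) * g (snd z) \<partial>(M \<Otimes>\<^sub>M M)) = (\<integral>x. f x \<partial>M) * (\<integral>x. g x \<partial>M)"
    by (intro integral_fst_times_snd M.prob_space_axioms)
  also have "\<dots> \<le> (\<integral>x. f x powr p \<partial>M) powr (1 / p) * (\<integral>x. g x powr p \<partial>M) powr (1 / p)"
    using fb gb p by (intro mult_mono M.integral_le_Lp_norm[where K = K]) auto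
  finally show "(\<integral>z. f (fst z) * g (snd z) \<partial>(M \<Otimes>\<^sub>M M))
    \<le> (\<integral>x. f x powr p \<partial>M) powr (1 / p) * (\<integral>x. g x powr p \<partial>M) powr (1 / p)" .
qed

lemma measurable_PiM_fst:
  assumes c: "\<And>i. coupling (M i) (c i)"
  shows "(\<lambda>w i. fst (w i)) \<in> PiM UNIV c \<rightarrow>\<^sub>M PiM UNIV M"
proof (rule measurable_PiM_single')
  have "(\<lambda>w. fst (w i)) \<in> PiM UNIV c \<rightarrow>\<^sub>M borel" for i
    by (rule measurable_compose[OF _ coupling_measurable_fst[OF c[of i]]]) simp
  then show "(\<lambda>w. fst (w i)) \<in> PiM UNIV c \<rightarrow>\<^sub>M M i" for i
    using coupling_marginal_sets[OF c] by (simp cong: measurable_cong_sets)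
  show "(\<lambda>w i. fst (w i)) \<in> space (PiM UNIV c) \<rightarrow> (\<Pi>\<^sub>E i\<in>UNIV. space (M i))"
    using coupling_marginal_space[OF c] by auto
qed

lemma measurable_PiM_snd:
  assumes c: "\<And>i. coupling (M i) (c i)"
  shows "(\<lambda>w i. snd (w i)) \<in> PiM UNIV c \<rightarrow>\<^sub>M PiM UNIV M"
proof (rule measurable_PiM_single')
  have "(\<lambda>w. snd (w i)) \<in> PiM UNIV c \<rightarrow>\<^sub>M borel" for i
    by (rule measurable_compose[OF _ coupling_measurable_snd[OF c[of i]]]) simp
  then show "(\<lambda>w. snd (w i)) \<in> PiM UNIV c \<rightarrow>\<^sub>M M i" for i
    using coupling_marginal_sets[OF c] by (simp cong: measurable_cong_sets)
  show "(\<lambda>w i. snd (w i)) \<in> space (PiM UNIV c) \<rightarrow> (\<Pi>\<^sub>E i\<in>UNIV. space (M i))"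
    using coupling_marginal_space[OF c] by auto
qed

lemma distr_PiM_fst:
  assumes c: "\<And>i. coupling (M i) (c i)"
  shows "distr (PiM UNIV c) (PiM UNIV M) (\<lambda>w i. fst (w i)) = PiM UNIV M"
proof (rule distr_PiM_componentwise)
  fix i
  show "prob_space (c i)" by (rule coupling_prob_space[OF c])
  show "fst \<in> c i \<rightarrow>\<^sub>M M i"
    using coupling_measurable_fst[OF c] coupling_marginal_sets[OF c] by (simp cong: measurable_cong_sets)
  have "distr (c i) (M i) fst = distr (c i) borel fst"
    using coupling_marginal_sets[OF c] by (intro distr_cong) auto
  then show "distr (c i) (M i) fst = M i" using c[of i] by (simp add: coupling_def)
qed

lemma distr_PiM_snd:
  assumes c: "\<And>i. coupling (M i) (c i)"
  shows "distr (PiM UNIV c) (PiM UNIV M) (\<lambda>w i. snd (w i)) = PiM UNIV M"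
proof (rule distr_PiM_componentwise)
  fix i
  show "prob_space (c i)" by (rule coupling_prob_space[OF c])
  show "snd \<in> c i \<rightarrow>\<^sub>M M i"
    using coupling_measurable_snd[OF c] coupling_marginal_sets[OF c] by (simp cong: measurable_cong_sets)
  have "distr (c i) (M i) snd = distr (c i) borel snd"
    using coupling_marginal_sets[OF c] by (intro distr_cong) auto
  then show "distr (c i) (M i) snd = M i" using c[of i] by (simp add: coupling_def)
qed

lemma measurable_upd_section:
  assumes "f \<in> borel_measurable (PiM UNIV M)" "w \<in> space (PiM UNIV M)"
  shows "(\<lambda>a. f (w(i := a))) \<in> borel_measurable (M i)"
proof -
  have "(\<lambda>a. w(i := a)) \<in> M i \<rightarrow>\<^sub>M PiM UNIV M"
    using measurable_compose[OF measurable_Pair1'[OF assms(2), of "M i"] measurable_add_dim[of i UNIV M, simplified]]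
    by simp
  from measurable_compose[OF this assms(1)] show ?thesis .
qed

lemma measurable_upd_pair:
  assumes "f \<in> borel_measurable (PiM UNIV M)"
  shows "(\<lambda>(w, a). f (w(i := a))) \<in> borel_measurable (PiM UNIV M \<Otimes>\<^sub>M M i)"
  using measurable_compose[OF measurable_add_dim[of i UNIV M, simplified] assms]
  by (simp add: case_prod_beta')

text \<open>The correlation of \<open>f\<close> and \<open>g\<close> at two points whose coordinates are coupled independently of each
  other, the \<open>i\<close>-th ones by \<open>c i\<close>.\<close>

definition coupled_form :: "('i \<Rightarrow> (real \<times> real) measure) \<Rightarrow> (('i \<Rightarrow> real) \<Rightarrow> real) \<Rightarrow> (('i \<Rightarrow> real) \<Rightarrow> real) \<Rightarrow> real" where
  "coupled_form c f g = (\<integral>w. f (\<lambda>i. fst (w i)) * g (\<lambda>i. snd (w i)) \<partial>PiM UNIV c)"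

lemma coupled_form_integrable:
  assumes c: "\<And>i. coupling (M i) (c i)"
    and f: "f \<in> L2 (PiM UNIV M)" and g: "g \<in> L2 (PiM UNIV M)"
  shows "integrable (PiM UNIV c) (\<lambda>w. f (\<lambda>i. fst (w i)) * g (\<lambda>i. snd (w i)))"
proof (rule integrable_mult_L2)
  show "(\<lambda>w. f (\<lambda>i. fst (w i))) \<in> borel_measurable (PiM UNIV c)" "(\<lambda>w. g (\<lambda>i. snd (w i))) \<in> borel_measurable (PiM UNIV c)"
    using f g by (auto simp: L2_def intro: measurable_compose[OF measurable_PiM_fst[OF c]] measurable_compose[OF measurable_PiM_snd[OF c]])
  have "integrable (distr (PiM UNIV c) (PiM UNIV M) (\<lambda>w i. fst (w i))) (\<lambda>x. (f x)\<^sup>2)"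
    unfolding distr_PiM_fst[OF c] using f by (simp add: L2_def)
  then show "integrable (PiM UNIV c) (\<lambda>w. (f (\<lambda>i. fst (w i)))\<^sup>2)"
    by (rule integrable_distr[OF measurable_PiM_fst[OF c]])
  have "integrable (distr (PiM UNIV c) (PiM UNIV M) (\<lambda>w i. snd (w i))) (\<lambda>x. (g x)\<^sup>2)"
    unfolding distr_PiM_snd[OF c] using g by (simp add: L2_def)
  then show "integrable (PiM UNIV c) (\<lambda>w. (g (\<lambda>i. snd (w i)))\<^sup>2)"
    by (rule integrable_distr[OF measurable_PiM_snd[OF c]])
qed

text \<open>With the laws of all other coordinates fixed, the form depends on the law \<open>d\<close> of the \<open>i\<close>-th
  pair only through the inner integral. The outer integral runs over the same measure for every \<open>d\<close>, so
  statements about one coordinate integrate to statements about the product.\<close>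

lemma coupled_form_resample:
  fixes c :: "'i \<Rightarrow> (real \<times> real) measure"
  assumes c: "\<And>i. coupling (M i) (c i)" and d: "coupling (M i) d"
    and f: "f \<in> L2 (PiM UNIV M)" and g: "g \<in> L2 (PiM UNIV M)"
  defines "F \<equiv> \<lambda>w. \<integral>z. f ((\<lambda>j. fst (w j))(i := fst z)) * g ((\<lambda>j. snd (w j))(i := snd z)) \<partial>d"
  shows "coupled_form (c(i := d)) f g = (\<integral>w. F w \<partial>PiM UNIV c)" and "integrable (PiM UNIV c) F"
proof -
  have c': "coupling (M j) ((c(i := d)) j)" for j using c d by auto
  have *: "(\<lambda>j. fst ((w(i := z)) j)) = (\<lambda>j. fst (w j))(i := fst z)"
    "(\<lambda>j. snd ((w(i := z)) j)) = (\<lambda>j. snd (w j))(i := snd z)" for w :: "'i \<Rightarrow> real \<times> real" and z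
    by auto
  have sets: "sets (c i) = sets ((c(i := d)) i)"
    using coupling_sets[OF c] coupling_sets[OF d] by simp
  have ps: "prob_space ((c(i := d)) j)" "prob_space (c j)" for j
    using coupling_prob_space[OF c'] coupling_prob_space[OF c] by auto
  note int = coupled_form_integrable[where c = "c(i := d)", OF c' f g]
  show "coupled_form (c(i := d)) f g = (\<integral>w. F w \<partial>PiM UNIV c)"
    using integral_resample[of "c(i := d)" c i, OF ps(1) ps(2) _ sets int]
    unfolding coupled_form_def F_def * by simp
  show "integrable (PiM UNIV c) F"
    using integrable_resample[of "c(i := d)" c i, OF ps(1) ps(2) _ sets int] unfolding F_def * by simp
qed

lemma coupled_form_product:
  assumes M: "\<And>i. prob_space (M i)" and f: "f \<in> L2 (PiM UNIV M)" and g: "g \<in> L2 (PiM UNIV M)"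
  shows "coupled_form (\<lambda>i. M i \<Otimes>\<^sub>M M i) f g = (\<integral>x. f x \<partial>PiM UNIV M) * (\<integral>x. g x \<partial>PiM UNIV M)"
proof -
  interpret P: prob_space "PiM UNIV M" by (intro prob_space_PiM M)
  have fg: "integrable (PiM UNIV M) f" "integrable (PiM UNIV M) g"
    using f g by (auto simp: L2_def intro!: P.integrable_L2)
  have [measurable]: "f \<in> borel_measurable (PiM UNIV M)" "g \<in> borel_measurable (PiM UNIV M)" using f g by (auto simp: L2_def)
  have X: "(\<lambda>w. (\<lambda>i. fst (w i), \<lambda>i. snd (w i))) \<in> PiM UNIV (\<lambda>i. M i \<Otimes>\<^sub>M M i) \<rightarrow>\<^sub>M PiM UNIV M \<Otimes>\<^sub>M PiM UNIV M"
    by (intro measurable_Pair measurable_PiM_single')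
       (auto intro!: measurable_compose[OF measurable_component_singleton] simp: space_PiM PiE_iff space_pair_measure mem_Times_iff)
  have "(\<integral>x. f x \<partial>PiM UNIV M) * (\<integral>x. g x \<partial>PiM UNIV M) = (\<integral>z. f (fst z) * g (snd z) \<partial>(PiM UNIV M \<Otimes>\<^sub>M PiM UNIV M))"
    by (intro integral_fst_times_snd[symmetric] fg P.prob_space_axioms)
  also have "\<dots> = coupled_form (\<lambda>i. M i \<Otimes>\<^sub>M M i) f g"
    unfolding coupled_form_def by (subst distr_PiM_pair[OF M M, symmetric], subst integral_distr[OF X]) auto
  finally show ?thesis ..
qed

lemma (in finite_measure) bounded_L2:
  fixes f :: "'a \<Rightarrow> real"
  assumes [measurable]: "f \<in> borel_measurable M" and "\<And>x. \<bar>f x\<bar> \<le> K" shows "f \<in> L2 M"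
proof -
  have "(f x)\<^sup>2 \<le> K\<^sup>2" for x
    using power_mono[OF assms(2)[of x], of 2] by simp
  then have "AE x in M. norm ((f x)\<^sup>2) \<le> K\<^sup>2" by simp
  then show ?thesis unfolding L2_def using assms(1) by (auto intro!: integrable_const_bound)
qed

text \<open>Tensorization, by induction on the number \<open>m\<close> of coordinates that are not independent. One
  application of the hypothesis in coordinate \<open>m\<close> replaces \<open>f\<close> and \<open>g\<close> by their partial \<open>L\<^sup>p\<close>
  norms \<open>L f\<close> and \<open>L g\<close> in that coordinate. These are constant in the coordinate, whose coupling may
  therefore be exchanged for the independent one.\<close>

lemma coupled_form_hypercontractive:
  fixes c :: "nat \<Rightarrow> (real \<times> real) measure"
  assumes p: "1 \<le> p" and c: "\<And>i. coupling (M i) (c i)" and h: "\<And>i. hypercontractive p (M i) (c i)"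
    and tail: "\<And>i. m \<le> i \<Longrightarrow> c i = M i \<Otimes>\<^sub>M M i"
    and f: "f \<in> borel_measurable (PiM UNIV M)" "\<And>x. 0 \<le> f x" "\<And>x. f x \<le> K"
    and g: "g \<in> borel_measurable (PiM UNIV M)" "\<And>x. 0 \<le> g x" "\<And>x. g x \<le> K"
  shows "coupled_form c f g \<le> (\<integral>x. f x powr p \<partial>PiM UNIV M) powr (1 / p) * (\<integral>x. g x powr p \<partial>PiM UNIV M) powr (1 / p)"
  using c h tail f g
proof (induction m arbitrary: c f g)
  case 0
  have M: "prob_space (M i)" for i by (rule coupling_marginal_prob_space[OF 0(1)])
  interpret P: prob_space "PiM UNIV M" by (intro prob_space_PiM M)
  have cM: "c = (\<lambda>i. M i \<Otimes>\<^sub>M M i)" using 0(3) by auto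
  have "coupled_form c f g = (\<integral>x. f x \<partial>PiM UNIV M) * (\<integral>x. g x \<partial>PiM UNIV M)"
    unfolding cM by (intro coupled_form_product M P.bounded_L2[where K = K]) (use 0 in auto)
  also have "\<dots> \<le> (\<integral>x. f x powr p \<partial>PiM UNIV M) powr (1 / p) * (\<integral>x. g x powr p \<partial>PiM UNIV M) powr (1 / p)"
    using 0 p by (intro mult_mono P.integral_le_Lp_norm[where K = K]) auto
  finally show ?case .
next
  case (Suc m)
  have M: "prob_space (M i)" for i by (rule coupling_marginal_prob_space[OF Suc.prems(1)])
  have setsM: "sets (M i) = sets borel" for i by (rule coupling_marginal_sets[OF Suc.prems(1)])
  have spaceP: "space (PiM UNIV M) = UNIV"
    using coupling_marginal_space[OF Suc.prems(1)] by (auto simp: space_PiM)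
  interpret P: prob_space "PiM UNIV M" by (intro prob_space_PiM M)
  interpret Mm: prob_space "M m" by (rule M)
  define c' where "c' = c(m := M m \<Otimes>\<^sub>M M m)"
  have K: "0 \<le> K" using Suc.prems(5,6) order_trans by blast
  have c': "coupling (M i) (c' i)" for i
    using Suc.prems(1) coupling_product[OF M setsM] by (auto simp: c'_def)
  have h': "hypercontractive p (M i) (c' i)" for i
    using Suc.prems(2) hypercontractive_product[OF M setsM p] by (auto simp: c'_def)
  have tail': "c' i = M i \<Otimes>\<^sub>M M i" if "m \<le> i" for i
    using Suc.prems(3)[of i] that by (cases "i = m") (auto simp: c'_def)
  have cc': "c = c'(m := c m)" by (auto simp: c'_def)
  define L where "L f x = (\<integral>a. f (x(m := a)) powr p \<partial>M m) powr (1 / p)" for f :: "(nat \<Rightarrow> real) \<Rightarrow> real" and x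
  have L: "L f \<in> borel_measurable (PiM UNIV M)" "\<And>x. 0 \<le> L f x" "\<And>x. L f x \<le> K"
     "(\<integral>x. L f x powr p \<partial>PiM UNIV M) = (\<integral>x. f x powr p \<partial>PiM UNIV M)"
    if f: "f \<in> borel_measurable (PiM UNIV M)" "\<And>x. 0 \<le> f x" "\<And>x. f x \<le> K" for f
  proof -
    have [measurable]: "(\<lambda>x. f x powr p) \<in> borel_measurable (PiM UNIV M)" using f by measurable
    show "L f \<in> borel_measurable (PiM UNIV M)"
      unfolding L_def using measurable_upd_pair[of "\<lambda>x. f x powr p" M m]
      by (intro powr_real_measurable Mm.borel_measurable_lebesgue_integral borel_measurable_const) auto
    show "0 \<le> L f x" for x by (simp add: L_def)
    have fp: "f x powr p \<le> K powr p" for x using f p by (intro powr_mono2) auto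
    have i: "0 \<le> (\<integral>a. f (x(m := a)) powr p \<partial>M m)" for x
      by (rule Bochner_Integration.integral_nonneg) auto
    show "L f x \<le> K" for x
    proof -
      have "(\<integral>a. f (x(m := a)) powr p \<partial>M m) \<le> (\<integral>a. K powr p \<partial>M m)"
        by (rule integral_mono, rule Mm.integrable_const_bound[where B = "K powr p"])
          (use fp measurable_upd_section[of "\<lambda>x. f x powr p" M x m] spaceP in auto)
      then have "L f x \<le> (K powr p) powr (1 / p)"
        unfolding L_def using p i by (intro powr_mono2) (auto simp: Mm.prob_space)
      also have "\<dots> = K" using p K by (simp add: powr_powr)
      finally show ?thesis .
    qed
    have "(\<integral>x. L f x powr p \<partial>PiM UNIV M) = (\<integral>x. (\<integral>a. f (x(m := a)) powr p \<partial>M m) \<partial>PiM UNIV M)"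
      unfolding L_def using p i by (simp add: powr_powr)
    also have "\<dots> = (\<integral>x. f x powr p \<partial>PiM UNIV M)"
      by (rule integral_resample[of M M m, OF M M], simp, simp, rule P.integrable_const_bound[where B = "K powr p"])
        (use fp in auto)
    finally show "(\<integral>x. L f x powr p \<partial>PiM UNIV M) = (\<integral>x. f x powr p \<partial>PiM UNIV M)" .
  qed
  have f2: "f \<in> L2 (PiM UNIV M)" "g \<in> L2 (PiM UNIV M)" "L f \<in> L2 (PiM UNIV M)" "L g \<in> L2 (PiM UNIV M)"
    using Suc.prems L[of f] L[of g] by (auto intro!: P.bounded_L2[where K = K])
  have "coupled_form c f g
    = (\<integral>w. (\<integral>z. f ((\<lambda>j. fst (w j))(m := fst z)) * g ((\<lambda>j. snd (w j))(m := snd z)) \<partial>c m) \<partial>PiM UNIV c')"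
    by (subst cc', rule coupled_form_resample[OF c' Suc.prems(1) f2(1,2)])
  also have "\<dots> \<le> (\<integral>w. L f (\<lambda>j. fst (w j)) * L g (\<lambda>j. snd (w j)) \<partial>PiM UNIV c')"
  proof (rule integral_mono)
    show "integrable (PiM UNIV c') (\<lambda>w. \<integral>z. f ((\<lambda>j. fst (w j))(m := fst z)) * g ((\<lambda>j. snd (w j))(m := snd z)) \<partial>c m)"
      by (rule coupled_form_resample[OF c' Suc.prems(1) f2(1,2)])
    show "integrable (PiM UNIV c') (\<lambda>w. L f (\<lambda>j. fst (w j)) * L g (\<lambda>j. snd (w j)))"
      by (rule coupled_form_integrable[OF c' f2(3,4)])
    fix w
    show "(\<integral>z. f ((\<lambda>j. fst (w j))(m := fst z)) * g ((\<lambda>j. snd (w j))(m := snd z)) \<partial>c m)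
      \<le> L f (\<lambda>j. fst (w j)) * L g (\<lambda>j. snd (w j))"
    proof -
      have *: "(\<lambda>a. u (v(m := a))) \<in> borel_measurable borel"
        if "u \<in> borel_measurable (PiM UNIV M)" for u :: "(nat \<Rightarrow> real) \<Rightarrow> real" and v
        using measurable_upd_section[OF that, of v m] spaceP
        unfolding measurable_cong_sets[OF setsM refl] by simp
      show ?thesis
        unfolding L_def using Suc.prems(2)[of m, unfolded hypercontractive_def, rule_format,
          OF *[OF Suc.prems(4)] *[OF Suc.prems(7)]] Suc.prems by blast
    qed
  qed
  also have "\<dots> = coupled_form c' (L f) (L g)" by (simp add: coupled_form_def)
  also have "\<dots> \<le> (\<integral>x. L f x powr p \<partial>PiM UNIV M) powr (1 / p) * (\<integral>x. L g x powr p \<partial>PiM UNIV M) powr (1 / p)"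
    by (rule Suc.IH[OF c' h' tail']) (use L[OF Suc.prems(4-6)] L[OF Suc.prems(7-9)] in auto)
  also have "\<dots> = (\<integral>x. f x powr p \<partial>PiM UNIV M) powr (1 / p) * (\<integral>x. g x powr p \<partial>PiM UNIV M) powr (1 / p)"
    using L(4)[OF Suc.prems(4-6)] L(4)[OF Suc.prems(7-9)] by simp
  finally show ?case .
qed

text \<open>Truncation extends the quadratic inequality to \<open>L\<^sup>2\<close>; the restriction \<open>p \<le> 2\<close> makes
  the \<open>L\<^sup>p\<close> norm finite.\<close>

lemma coupled_form_le_Lp:
  fixes c :: "nat \<Rightarrow> (real \<times> real) measure"
  assumes p: "1 \<le> p" "p \<le> 2" and c: "\<And>i. coupling (M i) (c i)" and h: "\<And>i. hypercontractive p (M i) (c i)"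
    and tail: "\<And>i. m \<le> i \<Longrightarrow> c i = M i \<Otimes>\<^sub>M M i"
    and f: "f \<in> L2 (PiM UNIV M)"
  shows "coupled_form c f f \<le> (\<integral>x. \<bar>f x\<bar> powr p \<partial>PiM UNIV M) powr (2 / p)"
proof -
  have M: "prob_space (M i)" for i by (rule coupling_marginal_prob_space[OF c])
  interpret P: prob_space "PiM UNIV M" by (intro prob_space_PiM M)
  have [measurable]: "f \<in> borel_measurable (PiM UNIV M)" and f2: "integrable (PiM UNIV M) (\<lambda>x. (f x)\<^sup>2)"
    using f by (auto simp: L2_def)
  have absf: "(\<lambda>x. \<bar>f x\<bar>) \<in> L2 (PiM UNIV M)" using f by (auto simp: L2_def)
  have pw: "\<bar>a\<bar> powr p \<le> 1 + a\<^sup>2" for a :: real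
  proof (cases "\<bar>a\<bar> \<le> 1")
    case True
    then have "\<bar>a\<bar> powr p \<le> 1 powr p" using p by (intro powr_mono2) auto
    then show ?thesis by (simp add: add_increasing2)
  next
    case False
    then have "\<bar>a\<bar> powr p \<le> \<bar>a\<bar> powr 2" using p by (intro powr_mono) auto
    then show ?thesis using False by (simp add: add_increasing)
  qed
  have intp: "integrable (PiM UNIV M) (\<lambda>x. \<bar>f x\<bar> powr p)"
    by (rule Bochner_Integration.integrable_bound[of _ "\<lambda>x. 1 + (f x)\<^sup>2"]) (use f2 pw in auto)
  have nn: "0 \<le> (\<integral>x. \<bar>f x\<bar> powr p \<partial>PiM UNIV M)" by (rule Bochner_Integration.integral_nonneg) auto
  define u where "u n x = min \<bar>f x\<bar> (real n)" for n x
  have u: "u n \<in> borel_measurable (PiM UNIV M)" "0 \<le> u n x" "u n x \<le> real n" "u n x \<le> \<bar>f x\<bar>" for n x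
    by (auto simp: u_def[abs_def])
  have uL: "coupled_form c (u n) (u n) \<le> (\<integral>x. \<bar>f x\<bar> powr p \<partial>PiM UNIV M) powr (2 / p)" for n
  proof -
    have un: "0 \<le> (\<integral>x. u n x powr p \<partial>PiM UNIV M)" by (rule Bochner_Integration.integral_nonneg) auto
    have "(\<integral>x. u n x powr p \<partial>PiM UNIV M) \<le> (\<integral>x. \<bar>f x\<bar> powr p \<partial>PiM UNIV M)"
    proof (rule integral_mono[OF _ intp])
      show "integrable (PiM UNIV M) (\<lambda>x. u n x powr p)"
        using u p by (intro P.integrable_const_bound[where B = "real n powr p"]) (auto intro!: powr_mono2 AE_I2)
      show "u n x powr p \<le> \<bar>f x\<bar> powr p" for x using u p by (intro powr_mono2) auto
    qed
    then have *: "(\<integral>x. u n x powr p \<partial>PiM UNIV M) powr (1 / p) \<le> (\<integral>x. \<bar>f x\<bar> powr p \<partial>PiM UNIV M) powr (1 / p)"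
      using un p by (intro powr_mono2) auto
    have "coupled_form c (u n) (u n) \<le> (\<integral>x. u n x powr p \<partial>PiM UNIV M) powr (1 / p) * (\<integral>x. u n x powr p \<partial>PiM UNIV M) powr (1 / p)"
      by (rule coupled_form_hypercontractive[OF p(1) c h tail]) (use u in auto)
    also have "\<dots> \<le> (\<integral>x. \<bar>f x\<bar> powr p \<partial>PiM UNIV M) powr (1 / p) * (\<integral>x. \<bar>f x\<bar> powr p \<partial>PiM UNIV M) powr (1 / p)"
      using * by (intro mult_mono) auto
    also have "\<dots> = (\<integral>x. \<bar>f x\<bar> powr p \<partial>PiM UNIV M) powr (2 / p)"
      by (simp add: powr_add[symmetric])
    finally show ?thesis .
  qed
  have [measurable]: "(\<lambda>w. f (\<lambda>i. fst (w i))) \<in> borel_measurable (PiM UNIV c)" "(\<lambda>w. f (\<lambda>i. snd (w i))) \<in> borel_measurable (PiM UNIV c)"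
    using f by (auto simp: L2_def intro: measurable_compose[OF measurable_PiM_fst[OF c]] measurable_compose[OF measurable_PiM_snd[OF c]])
  have lim: "(\<lambda>n. coupled_form c (u n) (u n)) \<longlonglongrightarrow> coupled_form c (\<lambda>x. \<bar>f x\<bar>) (\<lambda>x. \<bar>f x\<bar>)"
    unfolding coupled_form_def
  proof (rule integral_dominated_convergence[OF _ _ coupled_form_integrable[OF c absf absf]])
    have ul: "(\<lambda>n. u n x) \<longlonglongrightarrow> \<bar>f x\<bar>" for x
    proof (rule tendsto_eventually)
      obtain N where "\<bar>f x\<bar> \<le> real N" using real_arch_simple by blast
      then show "\<forall>\<^sub>F n in sequentially. u n x = \<bar>f x\<bar>"
        by (auto simp: u_def eventually_sequentially intro!: exI[of _ N])
    qed
    show "AE w in PiM UNIV c. (\<lambda>n. u n (\<lambda>i. fst (w i)) * u n (\<lambda>i. snd (w i))) \<longlonglongrightarrow> \<bar>f (\<lambda>i. fst (w i))\<bar> * \<bar>f (\<lambda>i. snd (w i))\<bar>"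
      by (intro AE_I2 tendsto_mult ul)
    show "AE w in PiM UNIV c. norm (u n (\<lambda>i. fst (w i)) * u n (\<lambda>i. snd (w i))) \<le> \<bar>f (\<lambda>i. fst (w i))\<bar> * \<bar>f (\<lambda>i. snd (w i))\<bar>" for n
      unfolding real_norm_def abs_mult abs_of_nonneg[OF u(2)] by (intro AE_I2 mult_mono u abs_ge_zero)
  qed (unfold u_def, measurable)
  have "coupled_form c f f \<le> coupled_form c (\<lambda>x. \<bar>f x\<bar>) (\<lambda>x. \<bar>f x\<bar>)"
    unfolding coupled_form_def
    by (intro integral_mono coupled_form_integrable[OF c f f] coupled_form_integrable[OF c absf absf])
      (metis abs_ge_self abs_mult)
  also have "\<dots> \<le> (\<integral>x. \<bar>f x\<bar> powr p \<partial>PiM UNIV M) powr (2 / p)"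
    by (rule LIMSEQ_le_const2[OF lim]) (use uL in auto)
  finally show ?thesis .
qed

section \<open>The Gaussian coupling of a given correlation\<close>

lemma prob_space_gauss: "prob_space gauss"
  unfolding gauss_def by (rule prob_space_normal_density) simp

interpretation gauss: prob_space gauss by (rule prob_space_gauss)

lemma sets_gauss [measurable_cong, simp]: "sets gauss = sets borel"
  by (simp add: gauss_def)

lemma space_gauss [simp]: "space gauss = UNIV"
  by (simp add: gauss_def)

interpretation gauss_pair: pair_prob_space gauss gauss ..

lemma real_distribution_gauss: "real_distribution gauss"
  unfolding gauss_def by (rule real_dist_normal_dist)

lemma integrable_gauss_bounded:
  assumes [measurable]: "f \<in> borel_measurable borel" and "\<And>x. \<bar>f x :: real\<bar> \<le> K"
  shows "integrable gauss f"
  by (rule gauss.integrable_const_bound[where B = K]) (use assms in auto)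

lemma integral_gauss_cos: "(\<integral>x. cos (a * x + b) \<partial>gauss) = cos b * exp (- a\<^sup>2 / 2)"
proof -
  have i: "integrable gauss (\<lambda>x. iexp (a * x))" by (rule gauss.integrable_iexp) auto
  have ch: "(CLINT x|gauss. iexp (a * x)) = complex_of_real (exp (- a\<^sup>2 / 2))"
    using fun_cong[OF char_std_normal_distribution, of a] by (simp add: char_def gauss_def)
  have R: "Re (iexp t) = cos t" "Im (iexp t) = sin t" for t
    by (simp_all add: cis_conv_exp[symmetric])
  have "(\<integral>x. cos (a * x) \<partial>gauss) = (\<integral>x. Re (iexp (a * x)) \<partial>gauss)"
    by (simp only: R)
  also have "\<dots> = exp (- a\<^sup>2 / 2)" by (simp only: integral_Re[OF i] ch Re_complex_of_real)
  finally have c: "(\<integral>x. cos (a * x) \<partial>gauss) = exp (- a\<^sup>2 / 2)" .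
  have "(\<integral>x. sin (a * x) \<partial>gauss) = (\<integral>x. Im (iexp (a * x)) \<partial>gauss)"
    by (simp only: R)
  also have "\<dots> = 0" by (simp only: integral_Im[OF i] ch Im_complex_of_real)
  finally have s: "(\<integral>x. sin (a * x) \<partial>gauss) = 0" .
  have "(\<integral>x. cos (a * x + b) \<partial>gauss) = (\<integral>x. cos (a * x) * cos b - sin (a * x) * sin b \<partial>gauss)"
    by (simp add: cos_add)
  also have "\<dots> = (\<integral>x. cos (a * x) \<partial>gauss) * cos b - (\<integral>x. sin (a * x) \<partial>gauss) * sin b"
    by (subst Bochner_Integration.integral_diff) (auto intro!: integrable_gauss_bounded[where K = 1] integrable_mult_left)
  finally show ?thesis by (simp add: c s)
qed

text \<open>A convenient form of the uniqueness theorem for characteristic functions: real and imaginary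
  part of the exponential are both cosines with a phase.\<close>

lemma gauss_unique:
  assumes "prob_space N" and sets: "sets N = sets borel"
    and cos: "\<And>a b. (\<integral>x. cos (a * x + b) \<partial>N) = cos b * exp (- a\<^sup>2 / 2)"
  shows "N = gauss"
proof (rule Levy_uniqueness[OF _ real_distribution_gauss])
  interpret N: prob_space N by fact
  show "real_distribution N"
    using assms sets_eq_imp_space_eq[OF sets] by (simp add: real_distribution_def real_distribution_axioms_def)
  have [measurable_cong]: "sets N = sets borel" by fact
  have char: "char L t = Complex (\<integral>x. cos (t * x + 0) \<partial>L) (\<integral>x. cos (t * x + (- pi / 2)) \<partial>L)"
    if "prob_space L" "sets L = sets borel" for L t
  proof -
    interpret L: prob_space L by fact
    have [measurable_cong]: "sets L = sets borel" by fact
    have i: "integrable L (\<lambda>x. iexp (t * x))" by (rule L.integrable_iexp) auto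
    have "Re (char L t) = (\<integral>x. Re (iexp (t * x)) \<partial>L)" "Im (char L t) = (\<integral>x. Im (iexp (t * x)) \<partial>L)"
      by (simp_all only: char_def integral_Re[OF i] integral_Im[OF i])
    moreover have "Re (iexp t) = cos t" "Im (iexp t) = sin t" for t
      by (simp_all add: cis_conv_exp[symmetric])
    ultimately show ?thesis
      by (intro complex_eqI) (simp_all add: cos_diff del: of_real_mult)
  qed
  show "char N = char gauss"
    by (intro ext) (simp only: char[OF assms(1,2)] char[OF prob_space_gauss sets_gauss] cos integral_gauss_cos)
qed

lemma integral_gauss_pair_cos:
  "(\<integral>z. cos (a * fst z + b * snd z + c) \<partial>(gauss \<Otimes>\<^sub>M gauss)) = cos c * exp (- (a\<^sup>2 + b\<^sup>2) / 2)"
proof -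
  have "integrable (gauss \<Otimes>\<^sub>M gauss) (\<lambda>(x, y). cos (a * x + b * y + c))"
    by (rule gauss_pair.integrable_const_bound[where B = 1]) auto
  from gauss_pair.integral_fst'[OF this]
  have "(\<integral>z. cos (a * fst z + b * snd z + c) \<partial>(gauss \<Otimes>\<^sub>M gauss)) = (\<integral>x. (\<integral>y. cos (a * x + b * y + c) \<partial>gauss) \<partial>gauss)"
    by (simp add: case_prod_beta')
  also have "\<dots> = (\<integral>x. cos (a * x + c) * exp (- b\<^sup>2 / 2) \<partial>gauss)"
    using integral_gauss_cos[of b "a * x + c" for x] by (simp add: algebra_simps)
  also have "\<dots> = cos c * exp (- (a\<^sup>2 + b\<^sup>2) / 2)"
    by (simp add: integral_gauss_cos exp_add[symmetric] add_divide_distrib diff_divide_distrib)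
  finally show ?thesis .
qed

text \<open>The law of a standard Gaussian pair with correlation \<open>s\<close>, written as in Mehler's formula.\<close>

definition mehler :: "real \<Rightarrow> (real \<times> real) measure" where
  "mehler s = distr (gauss \<Otimes>\<^sub>M gauss) (borel \<Otimes>\<^sub>M borel) (\<lambda>z. (fst z, s * fst z + sqrt (1 - s\<^sup>2) * snd z))"

lemma sets_mehler [measurable_cong, simp]: "sets (mehler s) = sets (borel \<Otimes>\<^sub>M borel)"
  by (simp add: mehler_def)

lemma space_mehler [simp]: "space (mehler s) = UNIV"
  by (simp add: mehler_def space_pair_measure)

lemma prob_space_mehler: "prob_space (mehler s)"
  unfolding mehler_def by (rule gauss_pair.prob_space_distr) simp

lemma integrable_mehler_bounded:
  assumes [measurable]: "F \<in> borel_measurable (borel \<Otimes>\<^sub>M borel)" and "\<And>z. \<bar>F z :: real\<bar> \<le> K"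
  shows "integrable (mehler s) F"
proof -
  interpret prob_space "mehler s" by (rule prob_space_mehler)
  show ?thesis by (rule integrable_const_bound[where B = K]) (use assms in auto)
qed

lemma integral_mehler:
  assumes "F \<in> borel_measurable (borel \<Otimes>\<^sub>M borel)"
  shows "(\<integral>z. F z \<partial>mehler s) = (\<integral>z. F (fst z, s * fst z + sqrt (1 - s\<^sup>2) * snd z) \<partial>(gauss \<Otimes>\<^sub>M gauss) :: real)"
  unfolding mehler_def by (subst integral_distr) (use assms in auto)

lemma integral_mehler_cos:
  assumes "\<bar>s\<bar> \<le> 1"
  shows "(\<integral>z. cos (a * fst z + b * snd z + c) \<partial>mehler s) = cos c * exp (- (a\<^sup>2 + 2 * s * a * b + b\<^sup>2) / 2)"
proof -
  have s: "s\<^sup>2 \<le> 1" using assms by (simp add: abs_square_le_1)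
  have *: "(a + b * s)\<^sup>2 + (b * sqrt (1 - s\<^sup>2))\<^sup>2 = a\<^sup>2 + 2 * s * a * b + b\<^sup>2"
  proof -
    have "(b * sqrt (1 - s\<^sup>2))\<^sup>2 = b\<^sup>2 * (1 - s\<^sup>2)" using s by (simp add: power_mult_distrib)
    then show ?thesis by (simp add: power2_eq_square algebra_simps)
  qed
  have "(\<integral>z. cos (a * fst z + b * snd z + c) \<partial>mehler s)
    = (\<integral>z. cos ((a + b * s) * fst z + (b * sqrt (1 - s\<^sup>2)) * snd z + c) \<partial>(gauss \<Otimes>\<^sub>M gauss))"
    by (subst integral_mehler) (auto simp: algebra_simps)
  then show ?thesis by (simp only: integral_gauss_pair_cos *)
qed

lemma coupling_mehler:
  assumes "\<bar>s\<bar> \<le> 1" shows "coupling gauss (mehler s)"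
proof -
  interpret prob_space "mehler s" by (rule prob_space_mehler)
  have "distr (mehler s) borel fst = gauss" 
  proof (rule gauss_unique)
    show "prob_space (distr (mehler s) borel fst)" by (rule prob_space_distr) simp
    show "(\<integral>x. cos (a * x + b) \<partial>distr (mehler s) borel fst) = cos b * exp (- a\<^sup>2 / 2)" for a b
      using integral_mehler_cos[OF assms, of a 0 b] by (subst integral_distr) auto
  qed simp
  moreover have "distr (mehler s) borel snd = gauss" 
  proof (rule gauss_unique)
    show "prob_space (distr (mehler s) borel snd)" by (rule prob_space_distr) simp
    show "(\<integral>x. cos (a * x + b) \<partial>distr (mehler s) borel snd) = cos b * exp (- a\<^sup>2 / 2)" for a b
      using integral_mehler_cos[OF assms, of 0 a b] by (subst integral_distr) auto
  qed simp
  ultimately show ?thesis using prob_space_axioms by (simp add: coupling_def)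
qed

section \<open>Trigonometric polynomials\<close>

text \<open>Real combinations of cosines with arbitrary frequencies and phases. All Gaussian integrals of
  such functions are explicit.\<close>

inductive trig :: "(real \<Rightarrow> real) \<Rightarrow> bool" where
  trig_cos: "trig (\<lambda>x. c * cos (a * x + b))"
| trig_add: "trig f \<Longrightarrow> trig g \<Longrightarrow> trig (\<lambda>x. f x + g x)"

lemma trig_const: "trig (\<lambda>x. c)"
  using trig_cos[of c 0 0] by simp

lemma trig_sin: "trig (\<lambda>x. sin (x / L))"
  using trig_cos[of 1 "1 / L" "- pi / 2"] by (simp add: cos_diff)

lemma trig_continuous: "trig f \<Longrightarrow> continuous_on A f"
  by (induction rule: trig.induct) (auto intro!: continuous_intros)

lemma trig_measurable: "trig f \<Longrightarrow> f \<in> borel_measurable borel"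
  by (rule borel_measurable_continuous_onI[OF trig_continuous])

lemma trig_bounded: "trig f \<Longrightarrow> \<exists>K. \<forall>x. \<bar>f x\<bar> \<le> K"
proof (induction rule: trig.induct)
  case (trig_cos c a b)
  have "\<bar>c * cos (a * x + b)\<bar> \<le> \<bar>c\<bar>" for x using mult_left_mono[OF abs_cos_le_one[of "a * x + b"], of "\<bar>c\<bar>"] by (simp add: abs_mult)
  then show ?case by blast
next
  case (trig_add f g)
  then obtain K L where "\<forall>x. \<bar>f x\<bar> \<le> K" "\<forall>x. \<bar>g x\<bar> \<le> L" by blast
  then have "\<bar>f x + g x\<bar> \<le> K + L" for x by (meson abs_triangle_ineq add_mono order_trans)
  then show ?case by blast
qed

lemma trig_mult:
  assumes "trig f" "trig g" shows "trig (\<lambda>x. f x * g x)"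
  using assms(1)
proof (induction rule: trig.induct)
  case (trig_cos c a b)
  show ?case using assms(2)
  proof (induction rule: trig.induct)
    case (trig_cos c' a' b')
    have "(\<lambda>x. c * cos (a * x + b) * (c' * cos (a' * x + b')))
      = (\<lambda>x. (c * c' / 2) * cos ((a - a') * x + (b - b')) + (c * c' / 2) * cos ((a + a') * x + (b + b')))"
    proof
      fix x
      have "c * cos (a * x + b) * (c' * cos (a' * x + b')) = c * c' * (cos (a * x + b) * cos (a' * x + b'))"
        by simp
      also have "\<dots> = (c * c' / 2) * cos ((a - a') * x + (b - b')) + (c * c' / 2) * cos ((a + a') * x + (b + b'))"
        unfolding cos_times_cos by (simp add: algebra_simps add_divide_distrib)
      finally show "c * cos (a * x + b) * (c' * cos (a' * x + b')) = \<dots>" .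
    qed
    then show ?case by (simp only:) (intro trig.trig_add trig.trig_cos)
  next
    case (trig_add f g) then show ?case by (simp add: distrib_left trig.trig_add)
  qed
next
  case (trig_add f1 f2) then show ?case by (simp add: distrib_right trig.trig_add)
qed

lemma trig_polynomial_sin:
  assumes "real_polynomial_function p" shows "trig (\<lambda>x. p (sin (x / L)))"
  using assms
proof (induction rule: real_polynomial_function.induct)
  case (linear f)
  then have "f y = f 1 * y" for y :: real
    using linear_scale[OF bounded_linear.linear[OF linear], of y 1] by simp
  then have "(\<lambda>x. f (sin (x / L))) = (\<lambda>x. f 1 * sin (x / L))" by blast
  then show ?case using trig_mult[OF trig_const[of "f 1"] trig_sin[of L]] by simp
qed (auto intro: trig_const trig_mult trig_add)

text \<open>A continuous function of \<open>sin (x / L)\<close> is uniformly close to a polynomial in \<open>sin (x / L)\<close>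
  by the Weierstrass theorem on \<open>[-1, 1]\<close>, and polynomials in a sine are trigonometric polynomials.\<close>

lemma trig_dense_periodic:
  assumes "continuous_on {-1..1} G" "0 < e"
  shows "\<exists>t. trig t \<and> (\<forall>x. \<bar>G (sin (x / L)) - t x\<bar> < e)"
proof -
  obtain p where p: "real_polynomial_function p" "\<And>y. y \<in> {-1..1} \<Longrightarrow> \<bar>G y - p y\<bar> < e"
    using Stone_Weierstrass_real_polynomial_function[of "{-1..1}" G e] assms by auto
  then show ?thesis using trig_polynomial_sin[OF p(1), of L] by (intro exI[of _ "\<lambda>x. p (sin (x / L))"]) auto
qed

section \<open>Gaussian hypercontractivity from random walks\<close>

text \<open>The expectation of \<open>F\<close> after \<open>n\<close> steps of size \<open>d\<close> of two simple random walks
  started at \<open>x\<close> and \<open>y\<close> whose simultaneous steps have correlation \<open>s\<close>. The recursion replaces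
  a product of \<open>n\<close> coins.\<close>

fun walk2 :: "real \<Rightarrow> real \<Rightarrow> nat \<Rightarrow> (real \<Rightarrow> real \<Rightarrow> real) \<Rightarrow> real \<Rightarrow> real \<Rightarrow> real" where
  "walk2 d s 0 F x y = F x y"
| "walk2 d s (Suc n) F x y =
    (1 + s) / 4 * (walk2 d s n F (x + d) (y + d) + walk2 d s n F (x - d) (y - d)) +
    (1 - s) / 4 * (walk2 d s n F (x + d) (y - d) + walk2 d s n F (x - d) (y + d))"

fun walk1 :: "real \<Rightarrow> nat \<Rightarrow> (real \<Rightarrow> real) \<Rightarrow> real \<Rightarrow> real" where
  "walk1 d 0 f x = f x"
| "walk1 d (Suc n) f x = (walk1 d n f (x + d) + walk1 d n f (x - d)) / 2"

lemma walk1_nonneg: "(\<And>x. 0 \<le> f x) \<Longrightarrow> 0 \<le> walk1 d n f x"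
  by (induction n arbitrary: x) auto

lemma walk2_fst: "walk2 d s n (\<lambda>x y. f x) x y = walk1 d n f x"
  by (induction n arbitrary: x y) (auto simp: field_simps)

text \<open>The two-point inequality for the first step, with the norms after the remaining steps as values;
  this is tensorization for the product of \<open>n\<close> coins.\<close>

lemma walk2_hypercontractive:
  assumes p: "1 \<le> p" "p \<le> 2" "0 \<le> s" "s \<le> p - 1" and f: "\<And>x. 0 \<le> f x" and g: "\<And>x. 0 \<le> g x"
  shows "walk2 d s n (\<lambda>x y. f x * g y) x y
    \<le> walk1 d n (\<lambda>x. f x powr p) x powr (1 / p) * walk1 d n (\<lambda>x. g x powr p) y powr (1 / p)"
proof (induction n arbitrary: x y)
  case 0
  then show ?case using p f g by (simp add: powr_powr)
next
  case (Suc n)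
  define a b where "a = walk1 d n (\<lambda>x. f x powr p) (x + d) powr (1 / p)" and "b = walk1 d n (\<lambda>x. f x powr p) (x - d) powr (1 / p)"
  define a' b' where "a' = walk1 d n (\<lambda>x. g x powr p) (y + d) powr (1 / p)" and "b' = walk1 d n (\<lambda>x. g x powr p) (y - d) powr (1 / p)"
  have *: "a powr p = walk1 d n (\<lambda>x. f x powr p) (x + d)" "b powr p = walk1 d n (\<lambda>x. f x powr p) (x - d)"
    "a' powr p = walk1 d n (\<lambda>x. g x powr p) (y + d)" "b' powr p = walk1 d n (\<lambda>x. g x powr p) (y - d)"
    unfolding a_def b_def a'_def b'_def using p by (simp_all add: powr_powr walk1_nonneg)
  have "walk2 d s (Suc n) (\<lambda>x y. f x * g y) x y \<le> (1 + s) / 4 * (a * a' + b * b') + (1 - s) / 4 * (a * b' + b * a')"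
    unfolding walk2.simps a_def b_def a'_def b'_def using p
    by (intro add_mono mult_left_mono Suc.IH) auto
  also have "\<dots> \<le> ((a powr p + b powr p) / 2) powr (1 / p) * ((a' powr p + b' powr p) / 2) powr (1 / p)"
    by (rule two_point_bilinear) (use p in \<open>auto simp: a_def b_def a'_def b'_def\<close>)
  finally show ?case by (simp add: *)
qed

lemma walk2_add: "walk2 d s n (\<lambda>x y. F x y + G x y) x y = walk2 d s n F x y + walk2 d s n G x y"
  by (induction n arbitrary: x y) (auto simp: algebra_simps add_divide_distrib)

lemma walk2_cmult: "walk2 d s n (\<lambda>x y. c * F x y) x y = c * walk2 d s n F x y"
  by (induction n arbitrary: x y) (auto simp: algebra_simps)

lemma walk2_dist:
  assumes "\<bar>s\<bar> \<le> 1" and "\<And>x y. \<bar>F x y - G x y\<bar> \<le> e"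
  shows "\<bar>walk2 d s n F x y - walk2 d s n G x y\<bar> \<le> e"
proof (induction n arbitrary: x y)
  case 0 then show ?case using assms(2) by simp
next
  case (Suc n)
  have mean: "\<bar>((1 + s) / 4 * (a1 + a2) + (1 - s) / 4 * (a3 + a4)) - ((1 + s) / 4 * (b1 + b2) + (1 - s) / 4 * (b3 + b4))\<bar> \<le> e"
    if "\<bar>a1 - b1\<bar> \<le> e" "\<bar>a2 - b2\<bar> \<le> e" "\<bar>a3 - b3\<bar> \<le> e" "\<bar>a4 - b4\<bar> \<le> e" for a1 a2 a3 a4 b1 b2 b3 b4
  proof -
    have "\<bar>(1 + s) / 4 * ((a1 - b1) + (a2 - b2)) + (1 - s) / 4 * ((a3 - b3) + (a4 - b4))\<bar>
      \<le> (1 + s) / 4 * \<bar>(a1 - b1) + (a2 - b2)\<bar> + (1 - s) / 4 * \<bar>(a3 - b3) + (a4 - b4)\<bar>"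
      using assms(1) by (intro order_trans[OF abs_triangle_ineq]) (auto simp: abs_mult)
    also have "\<dots> \<le> (1 + s) / 4 * (e + e) + (1 - s) / 4 * (e + e)"
      using assms(1) that by (intro add_mono mult_left_mono order_trans[OF abs_triangle_ineq]) auto
    also have "\<dots> = e" by (simp add: field_simps)
    also have "(1 + s) / 4 * ((a1 - b1) + (a2 - b2)) + (1 - s) / 4 * ((a3 - b3) + (a4 - b4))
      = ((1 + s) / 4 * (a1 + a2) + (1 - s) / 4 * (a3 + a4)) - ((1 + s) / 4 * (b1 + b2) + (1 - s) / 4 * (b3 + b4))"
      by (simp add: field_simps)
    finally show ?thesis .
  qed
  show ?case unfolding walk2.simps by (intro mean Suc.IH)
qed

text \<open>Cosines are eigenfunctions of a step.\<close>

lemma walk2_cos: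
  "walk2 d s n (\<lambda>x y. cos (a * x + b * y + c)) x y
    = ((1 + s) / 2 * cos (d * (a + b)) + (1 - s) / 2 * cos (d * (a - b))) ^ n * cos (a * x + b * y + c)"
proof (induction n arbitrary: x y)
  case (Suc n)
  have 1: "cos (a * (x + d) + b * (y + d) + c) + cos (a * (x - d) + b * (y - d) + c) = 2 * cos (d * (a + b)) * cos (a * x + b * y + c)"
    using cos_times_cos[of "d * (a + b)" "a * x + b * y + c"] cos_minus[of "a * (x - d) + b * (y - d) + c"]
    by (simp add: algebra_simps)
  have 2: "cos (a * (x + d) + b * (y - d) + c) + cos (a * (x - d) + b * (y + d) + c) = 2 * cos (d * (a - b)) * cos (a * x + b * y + c)"
    using cos_times_cos[of "d * (a - b)" "a * x + b * y + c"] cos_minus[of "a * (x - d) + b * (y + d) + c"]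
    by (simp add: algebra_simps)
  have 3: "(1 + s) / 4 * (P * (2 * A * C)) + (1 - s) / 4 * (P * (2 * B * C)) = ((1 + s) / 2 * A + (1 - s) / 2 * B) * P * C" for A B C P
    by (simp add: field_simps)
  show ?case
    unfolding walk2.simps Suc.IH distrib_left[symmetric] 1 2 3 power_Suc ..
qed simp

text \<open>The eigenvalue is \<open>m n\<close>, and \<open>w n\<close> is the \<open>n\<close>-th root of the limit. For numbers of modulus at most one the
  difference of \<open>n\<close>-th powers is at most \<open>n\<close> times the difference, and \<open>m n - w n\<close> is \<open>o(1 / n)\<close>
  because the expansions of both agree to first order in \<open>1 / n\<close>.\<close>

lemma walk_limit:
  assumes "\<bar>s\<bar> \<le> 1"
  shows "(\<lambda>n. ((1 + s) / 2 * cos (1 / sqrt n * (a + b)) + (1 - s) / 2 * cos (1 / sqrt n * (a - b))) ^ n)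
    \<longlonglongrightarrow> exp (- (a\<^sup>2 + 2 * s * a * b + b\<^sup>2) / 2)"
proof -
  define m where "m n = (1 + s) / 2 * cos (1 / sqrt n * (a + b)) + (1 - s) / 2 * cos (1 / sqrt n * (a - b))" for n :: nat
  define v where "v = a\<^sup>2 + 2 * s * a * b + b\<^sup>2"
  have v_nonneg: "0 \<le> v"
  proof -
    have "v = (a + s * b)\<^sup>2 + (1 - s\<^sup>2) * b\<^sup>2" by (simp add: v_def power2_eq_square algebra_simps)
    then show ?thesis using assms by (simp add: abs_square_le_1)
  qed
  define w where "w n = exp (- v / (2 * real n))" for n :: nat
  have m1: "\<bar>m n\<bar> \<le> 1" for n
  proof -
    have "\<bar>m n\<bar> \<le> (1 + s) / 2 * \<bar>cos (1 / sqrt n * (a + b))\<bar> + (1 - s) / 2 * \<bar>cos (1 / sqrt n * (a - b))\<bar>"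
      unfolding m_def using assms by (intro order_trans[OF abs_triangle_ineq]) (auto simp: abs_mult)
    also have "\<dots> \<le> (1 + s) / 2 * 1 + (1 - s) / 2 * 1"
      using assms by (intro add_mono mult_left_mono) auto
    finally show ?thesis by (simp add: field_simps)
  qed
  have w1: "\<bar>w n\<bar> \<le> 1" for n using v_nonneg by (auto simp: w_def divide_nonneg_nonneg)
  have wn: "w n ^ n = exp (- v / 2)" if "n > 0" for n
    using that by (simp add: w_def exp_of_nat_mult[symmetric])
  have "(\<lambda>n. real n * (m n - w n)) \<longlonglongrightarrow> 0"
  proof -
    (* The second order terms of the cosines add up to v / 2. *)
    have "(\<lambda>n. real n * (((1 + s) / 2 * cos (1 / sqrt n * (a + b)) + (1 - s) / 2 * cos (1 / sqrt n * (a - b))) - exp (- v / (2 * real n)))) \<longlonglongrightarrow> 0"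
    proof -
      have c: "(\<lambda>n. real n * (cos (1 / sqrt n * c) - 1)) \<longlonglongrightarrow> - (c * c / 2)" for c
      proof -
        have "(\<lambda>n. real n * (cos (1 / sqrt n * c) - 1)) \<longlonglongrightarrow> - (c * c / 2)" if "c > 0" for c
          using that by real_asymp
        from this[of c] this[of "- c"] show ?thesis by (cases "c = 0"; cases "c > 0") auto
      qed
      have e: "(\<lambda>n. real n * (exp (- v / (2 * real n)) - 1)) \<longlonglongrightarrow> - v / 2"
        by real_asymp
      have "(\<lambda>n. (1 + s) / 2 * (real n * (cos (1 / sqrt n * (a + b)) - 1)) + (1 - s) / 2 * (real n * (cos (1 / sqrt n * (a - b)) - 1))
          - real n * (exp (- v / (2 * real n)) - 1))
        \<longlonglongrightarrow> (1 + s) / 2 * - ((a + b) * (a + b) / 2) + (1 - s) / 2 * - ((a - b) * (a - b) / 2) - (- v / 2)"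
        by (intro tendsto_intros c e)
      moreover have "(1 + s) / 2 * - ((a + b) * (a + b) / 2) + (1 - s) / 2 * - ((a - b) * (a - b) / 2) - (- v / 2) = 0"
        by (simp add: v_def power2_eq_square field_simps)
      ultimately show ?thesis by (simp add: field_simps)
    qed
    then show ?thesis by (simp add: m_def w_def)
  qed
  then have "(\<lambda>n. \<bar>real n * (m n - w n)\<bar>) \<longlonglongrightarrow> 0" by (rule tendsto_rabs_zero)
  then have "(\<lambda>n. m n ^ n - w n ^ n) \<longlonglongrightarrow> 0"
  proof (rule Lim_null_comparison[rotated])
    show "\<forall>\<^sub>F n in sequentially. norm (m n ^ n - w n ^ n) \<le> \<bar>real n * (m n - w n)\<bar>"
      using norm_power_diff[of "m n" "w n" n for n] m1 w1 by (auto simp: abs_mult)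
  qed
  then have "(\<lambda>n. m n ^ n - exp (- v / 2)) \<longlonglongrightarrow> 0"
    by (rule Lim_transform_eventually) (auto simp: eventually_sequentially wn intro!: exI[of _ 1])
  then show ?thesis unfolding m_def v_def by (simp add: LIM_zero_iff)
qed

text \<open>A central limit theorem for the pair of walks on trigonometric test functions.\<close>

lemma walk2_trig_limit:
  assumes s: "\<bar>s\<bar> \<le> 1" and f: "trig f" and g: "trig g"
  shows "(\<lambda>n. walk2 (1 / sqrt n) s n (\<lambda>x y. f x * g y) 0 0) \<longlonglongrightarrow> (\<integral>z. f (fst z) * g (snd z) \<partial>mehler s)"
  using f
proof (induction rule: trig.induct)
  case (trig_cos c a b)
  show ?case using g
  proof (induction rule: trig.induct)
    case (trig_cos c' a' b')
    have *: "c * cos (a * x + b) * (c' * cos (a' * y + b'))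
      = (c * c' / 2) * cos (a * x + (- a') * y + (b - b')) + (c * c' / 2) * cos (a * x + a' * y + (b + b'))" for x y
    proof -
      have "c * cos (a * x + b) * (c' * cos (a' * y + b')) = c * c' * (cos (a * x + b) * cos (a' * y + b'))"
        by simp
      then show ?thesis unfolding cos_times_cos by (simp add: algebra_simps add_divide_distrib)
    qed
    have i: "integrable (mehler s) (\<lambda>z. c * cos (a * fst z + b * snd z + e))" for a b c e
      by (intro integrable_mult_right integrable_mehler_bounded[where K = 1]) auto
    define k where "k = c * c' / 2"
    have l: "(\<lambda>n. k * walk2 (1 / sqrt n) s n (\<lambda>x y. cos (a * x + a'' * y + e)) 0 0)
        \<longlonglongrightarrow> (\<integral>z. k * cos (a * fst z + a'' * snd z + e) \<partial>mehler s)" for a'' e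
    proof -
      have "(\<lambda>n. k * walk2 (1 / sqrt n) s n (\<lambda>x y. cos (a * x + a'' * y + e)) 0 0)
        \<longlonglongrightarrow> k * (exp (- (a\<^sup>2 + 2 * s * a * a'' + a''\<^sup>2) / 2) * cos (a * 0 + a'' * 0 + e))"
        unfolding walk2_cos by (intro tendsto_intros walk_limit[OF s])
      then show ?thesis by (simp add: integral_mehler_cos[OF s] mult.commute)
    qed
    show ?case
      unfolding * walk2_add walk2_cmult k_def[symmetric]
      by (subst Bochner_Integration.integral_add[OF i i]) (intro tendsto_add l)
  next
    case (trig_add g1 g2)
    obtain K1 K2 where K: "\<And>x. \<bar>g1 x\<bar> \<le> K1" "\<And>x. \<bar>g2 x\<bar> \<le> K2" using trig_add.hyps trig_bounded by meson
    have i: "integrable (mehler s) (\<lambda>z. c * cos (a * fst z + b) * g (snd z))" if "trig g" for g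
    proof -
      obtain K where K: "\<And>x. \<bar>g x\<bar> \<le> K" using trig_bounded[OF \<open>trig g\<close>] by blast
      have [measurable]: "g \<in> borel_measurable borel" using that by (rule trig_measurable)
      have "\<bar>cos u * g v\<bar> \<le> 1 * K" for u v unfolding abs_mult by (intro mult_mono K) auto
      then show ?thesis unfolding mult.assoc
        by (intro integrable_mult_right integrable_mehler_bounded[where K = K]) auto
    qed
    show ?case unfolding distrib_left walk2_add
      by (subst Bochner_Integration.integral_add[OF i i]) (use trig_add in \<open>auto intro!: tendsto_add\<close>)
  qed
next
  case (trig_add f1 f2)
  obtain K where K: "\<And>x. \<bar>g x\<bar> \<le> K" using trig_bounded[OF g] by blast
  have [measurable]: "g \<in> borel_measurable borel" using g by (rule trig_measurable)
  have i: "integrable (mehler s) (\<lambda>z. f (fst z) * g (snd z))" if "trig f" for f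
  proof -
    obtain L where L: "\<And>x. \<bar>f x\<bar> \<le> L" using trig_bounded[OF \<open>trig f\<close>] by blast
    have [measurable]: "f \<in> borel_measurable borel" using that by (rule trig_measurable)
    have "0 \<le> L" using L[of 0] by linarith
    then have "\<bar>f u * g v\<bar> \<le> L * K" for u v unfolding abs_mult by (intro mult_mono K L) auto
    then show ?thesis by (intro integrable_mehler_bounded[where K = "L * K"]) auto
  qed
  show ?case unfolding distrib_right walk2_add
    by (subst Bochner_Integration.integral_add[OF i i]) (use trig_add in \<open>auto intro!: tendsto_add\<close>)
qed


lemma walk2_uniform_limit:
  assumes s: "\<bar>s\<bar> \<le> 1" and [measurable]: "case_prod F \<in> borel_measurable (borel \<Otimes>\<^sub>M borel)"
    and approx: "\<And>e. 0 < e \<Longrightarrow> \<exists>G K. case_prod G \<in> borel_measurable (borel \<Otimes>\<^sub>M borel) \<and> (\<forall>x y. \<bar>G x y\<bar> \<le> K) \<and>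
        (\<forall>x y. \<bar>F x y - G x y\<bar> \<le> e) \<and>
        (\<lambda>n. walk2 (1 / sqrt n) s n G 0 0) \<longlonglongrightarrow> (\<integral>z. G (fst z) (snd z) \<partial>mehler s)"
  shows "(\<lambda>n. walk2 (1 / sqrt n) s n F 0 0) \<longlonglongrightarrow> (\<integral>z. F (fst z) (snd z) \<partial>mehler s)"
proof (rule LIMSEQ_I)
  fix r :: real assume "0 < r"
  interpret prob_space "mehler s" by (rule prob_space_mehler)
  obtain G K where G[measurable]: "case_prod G \<in> borel_measurable (borel \<Otimes>\<^sub>M borel)" and K: "\<And>x y. \<bar>G x y\<bar> \<le> K"
    and FG: "\<And>x y. \<bar>F x y - G x y\<bar> \<le> r / 3"
    and lim: "(\<lambda>n. walk2 (1 / sqrt n) s n G 0 0) \<longlonglongrightarrow> (\<integral>z. G (fst z) (snd z) \<partial>mehler s)"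
    using approx[of "r / 3"] \<open>0 < r\<close> by auto
  have "\<bar>F x y\<bar> \<le> K + r / 3" for x y using K[of x y] FG[of x y] by linarith
  then have iF: "integrable (mehler s) (\<lambda>z. F (fst z) (snd z))"
    by (intro integrable_mehler_bounded[where K = "K + r / 3"]) auto
  have iG: "integrable (mehler s) (\<lambda>z. G (fst z) (snd z))"
    using K by (intro integrable_mehler_bounded[where K = K]) auto
  have "\<bar>(\<integral>z. F (fst z) (snd z) \<partial>mehler s) - (\<integral>z. G (fst z) (snd z) \<partial>mehler s)\<bar>
    \<le> (\<integral>z. \<bar>F (fst z) (snd z) - G (fst z) (snd z)\<bar> \<partial>mehler s)"
    unfolding Bochner_Integration.integral_diff[OF iF iG, symmetric] by (rule integral_abs_bound)
  also have "\<dots> \<le> (\<integral>z. r / 3 \<partial>mehler s)"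
    by (rule integral_mono) (use iF iG FG in auto)
  finally have 1: "\<bar>(\<integral>z. F (fst z) (snd z) \<partial>mehler s) - (\<integral>z. G (fst z) (snd z) \<partial>mehler s)\<bar> \<le> r / 3"
    by (simp add: prob_space[simplified])
  obtain N where N: "\<And>n. n \<ge> N \<Longrightarrow> \<bar>walk2 (1 / sqrt n) s n G 0 0 - (\<integral>z. G (fst z) (snd z) \<partial>mehler s)\<bar> < r / 3"
    using LIMSEQ_D[OF lim, of "r / 3"] \<open>0 < r\<close> by auto
  have "norm (walk2 (1 / sqrt n) s n F 0 0 - (\<integral>z. F (fst z) (snd z) \<partial>mehler s)) < r" if "n \<ge> N" for n
    using N[OF that] 1 walk2_dist[OF s, of F G "r / 3" "1 / sqrt n" n 0 0, OF FG] unfolding real_norm_def by linarith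
  then show "\<exists>N. \<forall>n\<ge>N. norm (walk2 (1 / sqrt n) s n F 0 0 - (\<integral>z. F (fst z) (snd z) \<partial>mehler s)) < r" by blast
qed

lemma measurable_periodic:
  fixes G :: "real \<Rightarrow> real"
  assumes "continuous_on {-1..1} G" shows "(\<lambda>x. G (sin (x / L))) \<in> borel_measurable borel"
proof (rule borel_measurable_continuous_onI)
  show "continuous_on UNIV (\<lambda>x. G (sin (x / L)))"
  proof (cases "L = 0")
    case False
    then show ?thesis
      by (intro continuous_on_compose2[OF assms] continuous_intros) auto
  qed simp
qed

lemma walk2_periodic_limit:
  fixes L :: real
  assumes s: "\<bar>s\<bar> \<le> 1" and F: "continuous_on {-1..1} F" and G: "continuous_on {-1..1} G"
  defines "f \<equiv> \<lambda>x. F (sin (x / L))" and "g \<equiv> \<lambda>x. G (sin (x / L))"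
  shows "(\<lambda>n. walk2 (1 / sqrt n) s n (\<lambda>x y. f x * g y) 0 0) \<longlonglongrightarrow> (\<integral>z. f (fst z) * g (snd z) \<partial>mehler s)"
proof (rule walk2_uniform_limit[OF s])
  have [measurable]: "f \<in> borel_measurable borel" "g \<in> borel_measurable borel"
    unfolding f_def g_def using F G by (auto intro: measurable_periodic)
  show "(\<lambda>(x, y). f x * g y) \<in> borel_measurable (borel \<Otimes>\<^sub>M borel)" by measurable
  have "bounded (F ` {-1..1})" "bounded (G ` {-1..1})"
    using F G by (auto intro: compact_imp_bounded compact_continuous_image)
  then obtain A B where AB: "\<And>y. y \<in> {-1..1} \<Longrightarrow> \<bar>F y\<bar> \<le> A" "\<And>y. y \<in> {-1..1} \<Longrightarrow> \<bar>G y\<bar> \<le> B"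
    unfolding bounded_iff by (metis imageI real_norm_def)
  have fA: "\<bar>f x\<bar> \<le> A" and gB: "\<bar>g x\<bar> \<le> B" for x by (auto simp: f_def g_def intro: AB)
  have A0: "0 \<le> A" and B0: "0 \<le> B" using fA[of 0] gB[of 0] by auto
  fix e :: real assume "0 < e"
  define d where "d = min 1 (e / (A + B + 1))"
  have "0 < A + B + 1" using A0 B0 by simp
  moreover have "d \<le> e / (A + B + 1)" by (simp add: d_def)
  ultimately have "0 < A + B + 1" "d * (A + B + 1) \<le> e"
    by (simp_all add: pos_le_divide_eq)
  then have d: "0 < d" "d \<le> 1" "d * (A + B + 1) \<le> e"
    using \<open>0 < e\<close> by (auto simp: d_def)
  obtain t u where t: "trig t" "\<And>x. \<bar>f x - t x\<bar> < d" and u: "trig u" "\<And>x. \<bar>g x - u x\<bar> < d"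
    unfolding f_def g_def using trig_dense_periodic[OF F d(1)] trig_dense_periodic[OF G d(1)] by meson
  have [measurable]: "t \<in> borel_measurable borel" "u \<in> borel_measurable borel" using t u by (auto intro: trig_measurable)
  have tA: "\<bar>t x\<bar> \<le> A + d" and uB: "\<bar>u x\<bar> \<le> B + d" for x
    using fA[of x] gB[of x] t(2)[of x] u(2)[of x] by linarith+
  have "\<bar>f x * g y - t x * u y\<bar> \<le> e" for x y
  proof -
    have "\<bar>f x * g y - t x * u y\<bar> = \<bar>(f x - t x) * g y + t x * (g y - u y)\<bar>" by (simp add: algebra_simps)
    also have "\<dots> \<le> \<bar>f x - t x\<bar> * \<bar>g y\<bar> + \<bar>t x\<bar> * \<bar>g y - u y\<bar>" by (metis abs_triangle_ineq abs_mult)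
    also have "\<dots> \<le> d * B + (A + d) * d"
      using t(2)[of x] u(2)[of y] gB[of y] tA[of x] d A0 B0 by (intro add_mono mult_mono) auto
    also have "\<dots> \<le> d * B + (A + 1) * d" using d by (simp add: mult_right_mono)
    also have "\<dots> \<le> e" using d(3) by (simp add: algebra_simps)
    finally show ?thesis .
  qed
  moreover have "\<bar>t x * u y\<bar> \<le> (A + d) * (B + d)" for x y
    unfolding abs_mult using tA uB A0 d by (intro mult_mono) auto
  moreover have "(\<lambda>(x, y). t x * u y) \<in> borel_measurable (borel \<Otimes>\<^sub>M borel)" by measurable
  ultimately show "\<exists>H K. case_prod H \<in> borel_measurable (borel \<Otimes>\<^sub>M borel) \<and> (\<forall>x y. \<bar>H x y\<bar> \<le> K) \<and>
        (\<forall>x y. \<bar>f x * g y - H x y\<bar> \<le> e) \<and>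
        (\<lambda>n. walk2 (1 / sqrt n) s n H 0 0) \<longlonglongrightarrow> (\<integral>z. H (fst z) (snd z) \<partial>mehler s)"
    using walk2_trig_limit[OF s t(1) u(1)]
    by (intro exI[of _ "\<lambda>x y. t x * u y"] exI[of _ "(A + d) * (B + d)"]) auto
qed

lemma walk1_periodic_limit:
  fixes L :: real
  assumes F: "continuous_on {-1..1} F"
  defines "f \<equiv> \<lambda>x. F (sin (x / L))"
  shows "(\<lambda>n. walk1 (1 / sqrt n) n f 0) \<longlonglongrightarrow> (\<integral>x. f x \<partial>gauss)"
proof -
  have [measurable]: "f \<in> borel_measurable borel" unfolding f_def using F by (rule measurable_periodic)
  have "(\<lambda>n. walk2 (1 / sqrt n) 0 n (\<lambda>x y. f x * 1) 0 0) \<longlonglongrightarrow> (\<integral>z. f (fst z) * 1 \<partial>mehler 0)"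
    using walk2_periodic_limit[OF _ F, of 0 "\<lambda>_. 1" L] unfolding f_def by simp
  moreover have "(\<integral>x. f x \<partial>gauss) = (\<integral>z. f (fst z) \<partial>mehler 0)"
  proof -
    have "distr (mehler 0) borel fst = gauss" using coupling_mehler[of 0] by (simp add: coupling_def)
    then have "(\<integral>x. f x \<partial>gauss) = (\<integral>x. f x \<partial>distr (mehler 0) borel fst)" by simp
    also have "\<dots> = (\<integral>z. f (fst z) \<partial>mehler 0)" by (rule integral_distr) auto
    finally show ?thesis .
  qed
  ultimately show ?thesis by (simp add: walk2_fst)
qed

text \<open>The limit of the inequality for walks. Functions of \<open>sin (x / L)\<close> are used rather than
  trigonometric polynomials because the \<open>p\<close>-th power of a nonnegative one is again such a function.\<close>

lemma hypercontractive_periodic: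
  fixes L :: real
  assumes p: "1 \<le> p" "p \<le> 2" and s: "0 \<le> s" "s \<le> p - 1"
    and F: "continuous_on {-1..1} F" "\<And>x. 0 \<le> F x" and G: "continuous_on {-1..1} G" "\<And>x. 0 \<le> G x"
  defines "f \<equiv> \<lambda>x. F (sin (x / L))" and "g \<equiv> \<lambda>x. G (sin (x / L))"
  shows "(\<integral>z. f (fst z) * g (snd z) \<partial>mehler s)
    \<le> (\<integral>x. f x powr p \<partial>gauss) powr (1 / p) * (\<integral>x. g x powr p \<partial>gauss) powr (1 / p)"
proof (rule LIMSEQ_le)
  have s1: "\<bar>s\<bar> \<le> 1" using p s by auto
  show "(\<lambda>n. walk2 (1 / sqrt n) s n (\<lambda>x y. f x * g y) 0 0) \<longlonglongrightarrow> (\<integral>z. f (fst z) * g (snd z) \<partial>mehler s)"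
    unfolding f_def g_def by (rule walk2_periodic_limit[OF s1 F(1) G(1)])
  have lim: "(\<lambda>n. walk1 (1 / sqrt n) n (\<lambda>x. F (sin (x / L)) powr p) 0 powr (1 / p))
      \<longlonglongrightarrow> (\<integral>x. F (sin (x / L)) powr p \<partial>gauss) powr (1 / p)"
    if "continuous_on {-1..1} F" "\<And>x. 0 \<le> F x" for F
  proof -
    have "(\<lambda>n. walk1 (1 / sqrt n) n (\<lambda>x. F (sin (x / L)) powr p) 0) \<longlonglongrightarrow> (\<integral>x. F (sin (x / L)) powr p \<partial>gauss)"
      using that p by (intro walk1_periodic_limit[of "\<lambda>y. F y powr p"] continuous_on_powr' continuous_on_const) auto
    moreover have "0 \<le> (\<integral>x. F (sin (x / L)) powr p \<partial>gauss)"
      by (rule Bochner_Integration.integral_nonneg) auto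
    ultimately show ?thesis
      using p by (intro tendsto_powr2[OF _ tendsto_const]) (auto intro!: always_eventually walk1_nonneg)
  qed
  show "(\<lambda>n. walk1 (1 / sqrt n) n (\<lambda>x. f x powr p) 0 powr (1 / p) * walk1 (1 / sqrt n) n (\<lambda>x. g x powr p) 0 powr (1 / p))
    \<longlonglongrightarrow> (\<integral>x. f x powr p \<partial>gauss) powr (1 / p) * (\<integral>x. g x powr p \<partial>gauss) powr (1 / p)"
    unfolding f_def g_def by (intro tendsto_mult lim F G)
  show "\<exists>N. \<forall>n\<ge>N. walk2 (1 / sqrt n) s n (\<lambda>x y. f x * g y) 0 0
    \<le> walk1 (1 / sqrt n) n (\<lambda>x. f x powr p) 0 powr (1 / p) * walk1 (1 / sqrt n) n (\<lambda>x. g x powr p) 0 powr (1 / p)"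
    using walk2_hypercontractive[OF p s] F(2) G(2) by (auto simp: f_def g_def)
qed

text \<open>A bounded measurable function is almost everywhere a limit of continuous functions \<open>g n\<close>.
  Replacing \<open>x\<close> by \<open>(n + 1) * arcsin (sin (x / (n + 1)))\<close> makes \<open>g n\<close> a continuous function of a sine
  and changes nothing for \<open>\<bar>x\<bar> \<le> n\<close>.\<close>

lemma periodic_approximation:
  fixes u :: "real \<Rightarrow> real"
  assumes [measurable]: "u \<in> borel_measurable borel" and u: "\<And>x. A \<le> u x" "\<And>x. u x \<le> B"
  obtains F where "\<And>n. continuous_on {-1..1} (F n)" "\<And>n y. A \<le> F n y" "\<And>n y. F n y \<le> B"
    "AE x in lborel. (\<lambda>n. F n (sin (x / real (Suc n)))) \<longlonglongrightarrow> u x"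
proof -
  have AB: "A \<le> B" using u order_trans by blast
  have "u measurable_on UNIV"
    by (rule lebesgue_measurable_imp_measurable_on) (auto intro: measurable_completion)
  then obtain N g where N: "negligible N" and g: "\<And>n. continuous_on UNIV (g n)"
    and lim: "\<And>x. x \<notin> N \<Longrightarrow> (\<lambda>n. g n x) \<longlonglongrightarrow> u x"
    unfolding measurable_on_def by auto
  define h where "h n x = max A (min B (g n x))" for n x
  define F where "F n y = h n (real (Suc n) * arcsin (max (-1) (min 1 y)))" for n y
  show ?thesis
  proof
    show "A \<le> F n y" "F n y \<le> B" for n y using AB by (auto simp: F_def h_def)
    show "continuous_on {-1..1} (F n)" for n
      unfolding F_def h_def
      by (intro continuous_intros continuous_on_compose2[OF g] continuous_on_arcsin) auto
    have hlim: "(\<lambda>n. h n x) \<longlonglongrightarrow> u x" if "x \<notin> N" for x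
    proof -
      have "(\<lambda>n. h n x) \<longlonglongrightarrow> max A (min B (u x))"
        unfolding h_def by (intro tendsto_intros lim that)
      then show ?thesis using u by (simp add: min_absorb2 max_absorb2)
    qed
    have Fh: "F n (sin (x / real (Suc n))) = h n x" if "\<bar>x\<bar> \<le> real n" for n x
    proof -
      have x: "\<bar>x / real (Suc n)\<bar> \<le> 1" using that by (simp add: field_simps)
      moreover have "1 \<le> pi / 2" using pi_gt3 by simp
      ultimately have "arcsin (sin (x / real (Suc n))) = x / real (Suc n)"
        by (intro arcsin_sin) linarith+
      then show ?thesis by (simp add: F_def)
    qed
    have "(\<lambda>n. F n (sin (x / real (Suc n)))) \<longlonglongrightarrow> u x" if "x \<notin> N" for x
    proof (rule Lim_transform_eventually[OF hlim[OF that]])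
      obtain m where "\<bar>x\<bar> \<le> real m" using real_arch_simple by blast
      then show "\<forall>\<^sub>F n in sequentially. h n x = F n (sin (x / real (Suc n)))"
        by (auto simp: eventually_sequentially Fh simp del: of_nat_Suc intro!: exI[of _ m])
    qed
    moreover have "AE x in lebesgue. x \<notin> N"
      using N by (simp add: negligible_iff_null_sets AE_not_in)
    ultimately have "AE x in lebesgue. (\<lambda>n. F n (sin (x / real (Suc n)))) \<longlonglongrightarrow> u x"
      by auto
    then show "AE x in lborel. (\<lambda>n. F n (sin (x / real (Suc n)))) \<longlonglongrightarrow> u x"
      by (simp add: AE_completion_iff)
  qed
qed

lemma AE_gauss: "(AE x in lborel. P x) \<Longrightarrow> AE x in gauss. P x"
  unfolding gauss_def by (subst AE_density) auto

lemma coupling_AE_fst: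
  assumes "coupling M c" "AE x in M. P x" shows "AE z in c. P (fst z)"
proof -
  have d: "distr c borel fst = M" using assms(1) by (simp add: coupling_def)
  have "AE x in distr c borel fst. P x" unfolding d by (rule assms(2))
  then show ?thesis by (rule AE_distrD[OF coupling_measurable_fst[OF assms(1)]])
qed

lemma coupling_AE_snd:
  assumes "coupling M c" "AE x in M. P x" shows "AE z in c. P (snd z)"
proof -
  have d: "distr c borel snd = M" using assms(1) by (simp add: coupling_def)
  have "AE x in distr c borel snd. P x" unfolding d by (rule assms(2))
  then show ?thesis by (rule AE_distrD[OF coupling_measurable_snd[OF assms(1)]])
qed

text \<open>Nelson's theorem, from the periodic case by dominated convergence.\<close>

theorem hypercontractive_mehler:
  assumes p: "1 \<le> p" "p \<le> 2" and s: "0 \<le> s" "s \<le> p - 1"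
  shows "hypercontractive p gauss (mehler s)"
  unfolding hypercontractive_def
proof (intro allI impI)
  fix f g :: "real \<Rightarrow> real" and K
  assume f[measurable]: "f \<in> borel_measurable borel" and g[measurable]: "g \<in> borel_measurable borel"
    and fb: "\<forall>x. 0 \<le> f x \<and> f x \<le> K" and gb: "\<forall>x. 0 \<le> g x \<and> g x \<le> K"
  have K: "0 \<le> K" using fb order_trans by blast
  have c: "coupling gauss (mehler s)" using p s by (intro coupling_mehler) auto
  interpret prob_space "mehler s" by (rule prob_space_mehler)
  obtain F where F: "\<And>n. continuous_on {-1..1} (F n)" "\<And>n y. 0 \<le> F n y" "\<And>n y. F n y \<le> K"
    "AE x in lborel. (\<lambda>n. F n (sin (x / real (Suc n)))) \<longlonglongrightarrow> f x"
    using periodic_approximation[OF f, of 0 K] fb by blast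
  obtain G where G: "\<And>n. continuous_on {-1..1} (G n)" "\<And>n y. 0 \<le> G n y" "\<And>n y. G n y \<le> K"
    "AE x in lborel. (\<lambda>n. G n (sin (x / real (Suc n)))) \<longlonglongrightarrow> g x"
    using periodic_approximation[OF g, of 0 K] gb by blast
  have [measurable]: "(\<lambda>x. F n (sin (x / real (Suc n)))) \<in> borel_measurable borel"
    "(\<lambda>x. G n (sin (x / real (Suc n)))) \<in> borel_measurable borel" for n
    by (rule measurable_periodic[OF F(1)] measurable_periodic[OF G(1)])+
  show "(\<integral>z. f (fst z) * g (snd z) \<partial>mehler s)
    \<le> (\<integral>x. f x powr p \<partial>gauss) powr (1 / p) * (\<integral>x. g x powr p \<partial>gauss) powr (1 / p)"
  proof (rule LIMSEQ_le)
    show "(\<lambda>n. \<integral>z. F n (sin (fst z / real (Suc n))) * G n (sin (snd z / real (Suc n))) \<partial>mehler s)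
      \<longlonglongrightarrow> (\<integral>z. f (fst z) * g (snd z) \<partial>mehler s)"
    proof (rule integral_dominated_convergence[where w = "\<lambda>_. K * K"])
      show "AE z in mehler s. (\<lambda>n. F n (sin (fst z / real (Suc n))) * G n (sin (snd z / real (Suc n)))) \<longlonglongrightarrow> f (fst z) * g (snd z)"
        using coupling_AE_fst[OF c AE_gauss[OF F(4)]] coupling_AE_snd[OF c AE_gauss[OF G(4)]]
        by eventually_elim (rule tendsto_mult)
      show "AE z in mehler s. norm (F n (sin (fst z / real (Suc n))) * G n (sin (snd z / real (Suc n)))) \<le> K * K" for n
        using F G K by (intro AE_I2) (simp add: mult_mono)
    qed (auto simp del: of_nat_Suc)
    have lim: "(\<lambda>n. (\<integral>x. F n (sin (x / real (Suc n))) powr p \<partial>gauss) powr (1 / p)) \<longlonglongrightarrow> (\<integral>x. f x powr p \<partial>gauss) powr (1 / p)"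
      if F: "\<And>n. continuous_on {-1..1} (F n)" "\<And>n y. 0 \<le> F n y" "\<And>n y. F n y \<le> K"
        "AE x in lborel. (\<lambda>n. F n (sin (x / real (Suc n)))) \<longlonglongrightarrow> f x" and [measurable]: "f \<in> borel_measurable borel"
      for F :: "nat \<Rightarrow> real \<Rightarrow> real" and f
    proof (rule tendsto_powr2[OF _ tendsto_const])
      have [measurable]: "f \<in> borel_measurable borel" by fact
      have [measurable]: "(\<lambda>x. F n (sin (x / real (Suc n)))) \<in> borel_measurable borel" for n
        by (rule measurable_periodic[OF F(1)])
      show "(\<lambda>n. \<integral>x. F n (sin (x / real (Suc n))) powr p \<partial>gauss) \<longlonglongrightarrow> (\<integral>x. f x powr p \<partial>gauss)"
      proof (rule integral_dominated_convergence[where w = "\<lambda>_. K powr p"])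
        show "AE x in gauss. (\<lambda>n. F n (sin (x / real (Suc n))) powr p) \<longlonglongrightarrow> f x powr p"
          using AE_gauss[OF F(4)]
          by eventually_elim (use p F(2) in \<open>auto intro!: tendsto_powr2 tendsto_const always_eventually\<close>)
        show "AE x in gauss. norm (F n (sin (x / real (Suc n))) powr p) \<le> K powr p" for n
          using F p by (intro AE_I2) (auto intro!: powr_mono2)
        show "(\<lambda>x. f x powr p) \<in> borel_measurable gauss" by measurable
        show "(\<lambda>x. F n (sin (x / real (Suc n))) powr p) \<in> borel_measurable gauss" for n by measurable
      qed (auto simp del: of_nat_Suc)
      show "\<forall>\<^sub>F n in sequentially. 0 \<le> (\<integral>x. F n (sin (x / real (Suc n))) powr p \<partial>gauss)"
        by (intro always_eventually allI Bochner_Integration.integral_nonneg) auto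
    qed (use p in auto)
    show "(\<lambda>n. (\<integral>x. F n (sin (x / real (Suc n))) powr p \<partial>gauss) powr (1 / p) * (\<integral>x. G n (sin (x / real (Suc n))) powr p \<partial>gauss) powr (1 / p))
      \<longlonglongrightarrow> (\<integral>x. f x powr p \<partial>gauss) powr (1 / p) * (\<integral>x. g x powr p \<partial>gauss) powr (1 / p)"
      by (intro tendsto_mult lim F G f g)
    show "\<exists>N. \<forall>n\<ge>N. (\<integral>z. F n (sin (fst z / real (Suc n))) * G n (sin (snd z / real (Suc n))) \<partial>mehler s)
      \<le> (\<integral>x. F n (sin (x / real (Suc n))) powr p \<partial>gauss) powr (1 / p) * (\<integral>x. G n (sin (x / real (Suc n))) powr p \<partial>gauss) powr (1 / p)"
      using hypercontractive_periodic[OF p s F(1,2) G(1,2)] by blast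
  qed
qed

section \<open>The Gaussian coupling as a function of the correlation\<close>

text \<open>Pairs of a trigonometric polynomial and its derivative. The second component is again written with
  cosines, so that the integrals of both components are given by the same formula.\<close>

inductive trig_deriv :: "(real \<Rightarrow> real) \<Rightarrow> (real \<Rightarrow> real) \<Rightarrow> bool" where
  trig_deriv_cos: "trig_deriv (\<lambda>x. c * cos (a * x + b)) (\<lambda>x. (c * a) * cos (a * x + (b + pi / 2)))"
| trig_deriv_add: "trig_deriv F f \<Longrightarrow> trig_deriv G g \<Longrightarrow> trig_deriv (\<lambda>x. F x + G x) (\<lambda>x. f x + g x)"

lemma trig_deriv_trig: "trig_deriv F f \<Longrightarrow> trig F \<and> trig f"
  by (induction rule: trig_deriv.induct) (auto intro: trig_cos trig_add)

lemma trig_deriv_DERIV: "trig_deriv F f \<Longrightarrow> (F has_real_derivative f x) (at x)"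
proof (induction rule: trig_deriv.induct)
  case (trig_deriv_cos c a b)
  have "cos (a * x + (b + pi / 2)) = - sin (a * x + b)"
    by (simp add: cos_add[of _ "pi / 2"] add.assoc[symmetric])
  then show ?case by (auto intro!: derivative_eq_intros)
qed (auto intro: DERIV_add)

lemma trig_deriv_add_const: "trig_deriv F f \<Longrightarrow> trig_deriv (\<lambda>x. F x + k) f"
  using trig_deriv_add[OF _ trig_deriv_cos[of k 0 0]] by simp

lemma trig_integrable_mehler:
  assumes "trig f" "trig g" shows "integrable (mehler s) (\<lambda>z. f (fst z) * g (snd z))"
proof -
  obtain K L where K: "\<And>x. \<bar>f x\<bar> \<le> K" "\<And>x. \<bar>g x\<bar> \<le> L" using assms trig_bounded by meson
  have [measurable]: "f \<in> borel_measurable borel" "g \<in> borel_measurable borel" using assms by (auto intro: trig_measurable)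
  have "0 \<le> K" using K(1)[of 0] by linarith
  then have "\<bar>f u * g v\<bar> \<le> K * L" for u v unfolding abs_mult by (intro mult_mono K) auto
  then show ?thesis by (intro integrable_mehler_bounded[where K = "K * L"]) auto
qed

lemma integral_mehler_cos_cos:
  assumes "\<bar>s\<bar> \<le> 1"
  shows "(\<integral>z. (c * cos (a * fst z + b)) * (c' * cos (a' * snd z + b')) \<partial>mehler s)
    = c * c' / 2 * (cos (b - b') * exp (- (a\<^sup>2 - 2 * s * a * a' + a'\<^sup>2) / 2) + cos (b + b') * exp (- (a\<^sup>2 + 2 * s * a * a' + a'\<^sup>2) / 2))"
proof -
  have *: "c * cos (a * x + b) * (c' * cos (a' * y + b'))
      = (c * c' / 2) * cos (a * x + (- a') * y + (b - b')) + (c * c' / 2) * cos (a * x + a' * y + (b + b'))" for x y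
  proof -
    have "c * cos (a * x + b) * (c' * cos (a' * y + b')) = c * c' * (cos (a * x + b) * cos (a' * y + b'))"
      by simp
    then show ?thesis unfolding cos_times_cos by (simp add: algebra_simps add_divide_distrib)
  qed
  have i: "integrable (mehler s) (\<lambda>z. c * cos (a * fst z + b * snd z + e))" for a b c e
    by (intro integrable_mult_right integrable_mehler_bounded[where K = 1]) auto
  show ?thesis unfolding *
    by (subst Bochner_Integration.integral_add[OF i i], simp only: integral_mult_right_zero integral_mehler_cos[OF assms])
      (simp add: distrib_left)
qed

lemma mehler_form_continuous:
  assumes "trig f" "trig g"
  shows "continuous_on {0..1} (\<lambda>s. \<integral>z. f (fst z) * g (snd z) \<partial>mehler s)"
  using assms
proof (induction rule: trig.induct)
  case (trig_cos c a b)
  show ?case using trig_cos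
  proof (induction rule: trig.induct)
    case (trig_cos c' a' b')
    have "continuous_on {0..1} (\<lambda>s. c * c' / 2 * (cos (b - b') * exp (- (a\<^sup>2 - 2 * s * a * a' + a'\<^sup>2) / 2) + cos (b + b') * exp (- (a\<^sup>2 + 2 * s * a * a' + a'\<^sup>2) / 2)))"
      by (intro continuous_intros) auto
    then show ?case by (rule continuous_on_eq) (rule integral_mehler_cos_cos[symmetric], auto)
  next
    case (trig_add g1 g2)
    note i = trig_integrable_mehler[OF trig.trig_cos]
    show ?case unfolding distrib_left Bochner_Integration.integral_add[OF i[OF trig_add.hyps(1)] i[OF trig_add.hyps(2)]]
      by (intro continuous_on_add trig_add)
  qed
next
  case (trig_add f1 f2)
  note i = trig_integrable_mehler[OF _ \<open>trig g\<close>]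
  show ?case unfolding distrib_right Bochner_Integration.integral_add[OF i[OF trig_add.hyps(1)] i[OF trig_add.hyps(2)]]
    by (intro continuous_on_add trig_add)
qed

text \<open>The correlation enters the formula only through \<open>exp (- s * a * b)\<close> for the frequencies
  \<open>a\<close> and \<open>b\<close>, and the factor \<open>- a * b\<close> that the derivative produces comes from differentiating both
  functions once.\<close>

lemma mehler_form_derivative:
  assumes "trig_deriv F f" "trig_deriv G g" and s: "s \<in> {0..1}"
  shows "((\<lambda>s. \<integral>z. F (fst z) * G (snd z) \<partial>mehler s) has_real_derivative (\<integral>z. f (fst z) * g (snd z) \<partial>mehler s)) (at s within {0..1})"
  using assms(1,2)
proof (induction rule: trig_deriv.induct)
  case (trig_deriv_cos c a b)
  show ?case using trig_deriv_cos
  proof (induction rule: trig_deriv.induct)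
    case (trig_deriv_cos c' a' b')
    have s1: "\<bar>s\<bar> \<le> 1" using s by auto
    have "((\<lambda>s. c * c' / 2 * (cos (b - b') * exp (- (a\<^sup>2 - 2 * s * a * a' + a'\<^sup>2) / 2) + cos (b + b') * exp (- (a\<^sup>2 + 2 * s * a * a' + a'\<^sup>2) / 2)))
      has_real_derivative c * a * (c' * a') / 2 *
        (cos (b - b') * exp (- (a\<^sup>2 - 2 * s * a * a' + a'\<^sup>2) / 2) - cos (b + b') * exp (- (a\<^sup>2 + 2 * s * a * a' + a'\<^sup>2) / 2)))
      (at s within {0..1})"
      by (rule derivative_eq_intros refl | simp)+ (simp add: field_simps)
    also have "cos (b - b') = cos ((b + pi / 2) - (b' + pi / 2))" by simp
    also have "X - cos (b + b') * Y = X + cos ((b + pi / 2) + (b' + pi / 2)) * Y" for X Y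
    proof -
      have "(b + pi / 2) + (b' + pi / 2) = (b + b') + pi" by simp
      then show ?thesis by simp
    qed
    finally have "((\<lambda>s. c * c' / 2 * (cos (b - b') * exp (- (a\<^sup>2 - 2 * s * a * a' + a'\<^sup>2) / 2) + cos (b + b') * exp (- (a\<^sup>2 + 2 * s * a * a' + a'\<^sup>2) / 2)))
      has_real_derivative (\<integral>z. ((c * a) * cos (a * fst z + (b + pi / 2))) * ((c' * a') * cos (a' * snd z + (b' + pi / 2))) \<partial>mehler s))
      (at s within {0..1})"
      unfolding integral_mehler_cos_cos[OF s1] by simp
    then show ?case
      by (rule has_field_derivative_transform_within[where d = 1], simp, intro s, intro integral_mehler_cos_cos[symmetric]) auto
  next
    case (trig_deriv_add G1 g1 G2 g2)
    note i = trig_integrable_mehler[OF trig.trig_cos]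
    have t: "trig G1" "trig G2" "trig g1" "trig g2" using trig_deriv_add trig_deriv_trig by auto
    show ?case unfolding distrib_left Bochner_Integration.integral_add[OF i[OF t(1)] i[OF t(2)]]
        Bochner_Integration.integral_add[OF i[OF t(3)] i[OF t(4)]]
      by (intro DERIV_add trig_deriv_add)
  qed
next
  case (trig_deriv_add F1 f1 F2 f2)
  have G: "trig G" "trig g" using \<open>trig_deriv G g\<close> trig_deriv_trig by auto
  have t: "trig F1" "trig F2" "trig f1" "trig f2" using trig_deriv_add trig_deriv_trig by auto
  note i = trig_integrable_mehler[OF _ G(1)] and i' = trig_integrable_mehler[OF _ G(2)]
  show ?case unfolding distrib_right Bochner_Integration.integral_add[OF i[OF t(1)] i[OF t(2)]]
      Bochner_Integration.integral_add[OF i'[OF t(3)] i'[OF t(4)]]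
    by (intro DERIV_add trig_deriv_add)
qed

definition unif :: "real measure" where
  "unif = density lborel (\<lambda>u. ennreal (indicator {0..1} u))"

lemma prob_space_unif: "prob_space unif"
  by (rule prob_spaceI) (simp add: unif_def emeasure_density ennreal_indicator)

lemma sets_unif [measurable_cong, simp]: "sets unif = sets borel"
  by (simp add: unif_def)

lemma space_unif [simp]: "space unif = UNIV"
  by (simp add: unif_def)

lemma integral_unif:
  fixes f :: "real \<Rightarrow> real"
  assumes "f \<in> borel_measurable borel" shows "(\<integral>u. f u \<partial>unif) = (\<integral>u. indicator {0..1} u *\<^sub>R f u \<partial>lborel)"
  unfolding unif_def by (rule integral_density) (use assms in auto)

text \<open>The mixture of the Gaussian couplings whose correlation is uniform in \<open>[s, s']\<close>. It turns the
  integral over the correlation in the increment formula into one more coupling, which can be a factor of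
  a product.\<close>

definition mehler_avg :: "real \<Rightarrow> real \<Rightarrow> (real \<times> real) measure" where
  "mehler_avg s s' = distr (unif \<Otimes>\<^sub>M (gauss \<Otimes>\<^sub>M gauss)) (borel \<Otimes>\<^sub>M borel)
     (\<lambda>(u, z). (fst z, (s + (s' - s) * u) * fst z + sqrt (1 - (s + (s' - s) * u)\<^sup>2) * snd z))"

interpretation unif: prob_space unif by (rule prob_space_unif)
interpretation unif_gauss: pair_prob_space unif "gauss \<Otimes>\<^sub>M gauss" ..

lemma sets_mehler_avg [measurable_cong, simp]: "sets (mehler_avg s s') = sets (borel \<Otimes>\<^sub>M borel)"
  by (simp add: mehler_avg_def)

lemma space_mehler_avg [simp]: "space (mehler_avg s s') = UNIV"
  by (simp add: mehler_avg_def space_pair_measure)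

lemma prob_space_mehler_avg: "prob_space (mehler_avg s s')"
  unfolding mehler_avg_def by (rule unif_gauss.prob_space_distr) measurable

lemma
  assumes F[measurable]: "F \<in> borel_measurable (borel \<Otimes>\<^sub>M borel)" and K: "\<And>z. \<bar>F z :: real\<bar> \<le> K"
  shows integral_mehler_avg: "(\<integral>z. F z \<partial>mehler_avg s s') = (\<integral>u. (\<integral>z. F z \<partial>mehler (s + (s' - s) * u)) \<partial>unif)"
    and integrable_mehler_avg: "integrable unif (\<lambda>u. \<integral>z. F z \<partial>mehler (s + (s' - s) * u))"
proof -
  let ?g = "\<lambda>(u, z). F (fst z, (s + (s' - s) * u) * fst z + sqrt (1 - (s + (s' - s) * u)\<^sup>2) * snd z)"
  have i: "integrable (unif \<Otimes>\<^sub>M (gauss \<Otimes>\<^sub>M gauss)) ?g"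
    by (rule unif_gauss.integrable_const_bound[where B = K]) (use K in auto)
  have m: "(\<integral>z. F z \<partial>mehler r) = (\<integral>z. F (fst z, r * fst z + sqrt (1 - r\<^sup>2) * snd z) \<partial>(gauss \<Otimes>\<^sub>M gauss))" for r
    by (rule integral_mehler[OF F])
  have "(\<integral>z. F z \<partial>mehler_avg s s') = (\<integral>x. ?g x \<partial>(unif \<Otimes>\<^sub>M (gauss \<Otimes>\<^sub>M gauss)))"
    unfolding mehler_avg_def by (subst integral_distr) (auto simp: case_prod_beta')
  also have "\<dots> = (\<integral>u. (\<integral>z. F z \<partial>mehler (s + (s' - s) * u)) \<partial>unif)"
    using unif_gauss.integral_fst'[OF i] by (simp add: m)
  finally show "(\<integral>z. F z \<partial>mehler_avg s s') = (\<integral>u. (\<integral>z. F z \<partial>mehler (s + (s' - s) * u)) \<partial>unif)" .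
  show "integrable unif (\<lambda>u. \<integral>z. F z \<partial>mehler (s + (s' - s) * u))"
    using unif_gauss.integrable_fst'[OF i] by (simp add: m)
qed

lemma integral_mehler_avg_bounds:
  fixes s s' u :: real
  assumes "0 \<le> s" "s \<le> s'" "s' \<le> 1" "0 \<le> u" "u \<le> 1"
  shows "s \<le> s + (s' - s) * u" "s + (s' - s) * u \<le> s'" "s + (s' - s) * u \<in> {0..1}"
proof -
  have "0 \<le> (s' - s) * u" using assms by (intro mult_nonneg_nonneg) auto
  moreover have "(s' - s) * u \<le> (s' - s) * 1" using assms by (intro mult_left_mono) auto
  ultimately show "s \<le> s + (s' - s) * u" "s + (s' - s) * u \<le> s'" "s + (s' - s) * u \<in> {0..1}" using assms by auto
qed

lemma AE_unif: "AE u in unif. 0 \<le> u \<and> u \<le> 1"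
  unfolding unif_def by (subst AE_density) (auto simp: indicator_def)

lemma coupling_mehler_avg:
  assumes s: "0 \<le> s" "s \<le> s'" "s' \<le> 1" shows "coupling gauss (mehler_avg s s')"
proof -
  interpret prob_space "mehler_avg s s'" by (rule prob_space_mehler_avg)
  have *: "(\<integral>z. cos (a * fst z + b * snd z + c) \<partial>mehler_avg s s') = cos c * exp (- (a\<^sup>2 + b\<^sup>2) / 2)"
    if ab: "a * b = 0" for a b c
  proof -
    have "(\<integral>z. cos (a * fst z + b * snd z + c) \<partial>mehler_avg s s')
      = (\<integral>u. (\<integral>z. cos (a * fst z + b * snd z + c) \<partial>mehler (s + (s' - s) * u)) \<partial>unif)"
      by (rule integral_mehler_avg[where K = 1]) auto
    also have "\<dots> = (\<integral>u. cos c * exp (- (a\<^sup>2 + b\<^sup>2) / 2) \<partial>unif)"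
    proof (rule integral_cong_AE)
      show "AE u in unif. (\<integral>z. cos (a * fst z + b * snd z + c) \<partial>mehler (s + (s' - s) * u)) = cos c * exp (- (a\<^sup>2 + b\<^sup>2) / 2)"
        using AE_unif
      proof eventually_elim
        case (elim u)
        then have "\<bar>s + (s' - s) * u\<bar> \<le> 1" using integral_mehler_avg_bounds[OF s, of u] by auto
        from integral_mehler_cos[OF this, of a b c] show ?case using ab
          by (auto simp: mult.assoc mult.commute mult.left_commute)
      qed
      show "(\<lambda>u. \<integral>z. cos (a * fst z + b * snd z + c) \<partial>mehler (s + (s' - s) * u)) \<in> borel_measurable unif"
        by (rule borel_measurable_integrable, rule integrable_mehler_avg[where K = 1]) auto
    qed auto
    finally show ?thesis using unif.prob_space by simp
  qed
  have "distr (mehler_avg s s') borel fst = gauss" 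
  proof (rule gauss_unique)
    show "prob_space (distr (mehler_avg s s') borel fst)" by (rule prob_space_distr) simp
    show "(\<integral>x. cos (a * x + b) \<partial>distr (mehler_avg s s') borel fst) = cos b * exp (- a\<^sup>2 / 2)" for a b
      using *[of a 0 b] by (subst integral_distr) auto
  qed simp
  moreover have "distr (mehler_avg s s') borel snd = gauss" 
  proof (rule gauss_unique)
    show "prob_space (distr (mehler_avg s s') borel snd)" by (rule prob_space_distr) simp
    show "(\<integral>x. cos (a * x + b) \<partial>distr (mehler_avg s s') borel snd) = cos b * exp (- a\<^sup>2 / 2)" for a b
      using *[of 0 a b] by (subst integral_distr) auto
  qed simp
  ultimately show ?thesis using prob_space_axioms by (simp add: coupling_def)
qed

lemma hypercontractive_mehler_avg:
  assumes s: "0 \<le> s" "s \<le> s'" "s' \<le> 1" shows "hypercontractive (1 + s') gauss (mehler_avg s s')"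
  unfolding hypercontractive_def
proof (intro allI impI)
  fix f g :: "real \<Rightarrow> real" and K
  assume f[measurable]: "f \<in> borel_measurable borel" and g[measurable]: "g \<in> borel_measurable borel"
    and fb: "\<forall>x. 0 \<le> f x \<and> f x \<le> K" and gb: "\<forall>x. 0 \<le> g x \<and> g x \<le> K"
  let ?R = "(\<integral>x. f x powr (1 + s') \<partial>gauss) powr (1 / (1 + s')) * (\<integral>x. g x powr (1 + s') \<partial>gauss) powr (1 / (1 + s'))"
  have K0: "0 \<le> K" using fb order_trans by blast
  have K: "\<bar>f (fst z) * g (snd z)\<bar> \<le> K * K" for z
    using fb gb K0 by (simp add: abs_mult mult_mono)
  have "(\<integral>z. f (fst z) * g (snd z) \<partial>mehler_avg s s') = (\<integral>u. (\<integral>z. f (fst z) * g (snd z) \<partial>mehler (s + (s' - s) * u)) \<partial>unif)"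
    by (rule integral_mehler_avg[OF _ K]) auto
  also have "\<dots> \<le> (\<integral>u. ?R \<partial>unif)"
  proof (rule integral_mono_AE)
    show "integrable unif (\<lambda>u. \<integral>z. f (fst z) * g (snd z) \<partial>mehler (s + (s' - s) * u))"
      by (rule integrable_mehler_avg[OF _ K]) auto
    show "AE u in unif. (\<integral>z. f (fst z) * g (snd z) \<partial>mehler (s + (s' - s) * u)) \<le> ?R"
      using AE_unif
    proof eventually_elim
      case (elim u)
      then have "hypercontractive (1 + s') gauss (mehler (s + (s' - s) * u))"
        using integral_mehler_avg_bounds[OF s, of u] s by (intro hypercontractive_mehler) auto
      then show ?case using f g fb gb unfolding hypercontractive_def by blast
    qed
  qed auto
  finally show "(\<integral>z. f (fst z) * g (snd z) \<partial>mehler_avg s s') \<le> ?R" using unif.prob_space by simp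
qed

text \<open>The fundamental theorem of calculus for the correlation.\<close>

lemma mehler_increment_trig:
  assumes F: "trig_deriv F f" and G: "trig_deriv G g" and s: "0 \<le> s" "s \<le> s'" "s' \<le> 1"
  shows "(\<integral>z. F (fst z) * G (snd z) \<partial>mehler s') - (\<integral>z. F (fst z) * G (snd z) \<partial>mehler s)
    = (s' - s) * (\<integral>z. f (fst z) * g (snd z) \<partial>mehler_avg s s')"
proof -
  have t: "trig f" "trig g" using F G trig_deriv_trig by auto
  obtain K L where K: "\<And>x. \<bar>f x\<bar> \<le> K" "\<And>x. \<bar>g x\<bar> \<le> L" using t trig_bounded by meson
  have [measurable]: "f \<in> borel_measurable borel" "g \<in> borel_measurable borel" using t by (auto intro: trig_measurable)
  have "0 \<le> K" using K(1)[of 0] by linarith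
  then have KL: "\<bar>f (fst z) * g (snd z)\<bar> \<le> K * L" for z unfolding abs_mult by (intro mult_mono K) auto
  define D where "D s = (\<integral>z. F (fst z) * G (snd z) \<partial>mehler s)" for s
  define E where "E s = (\<integral>z. f (fst z) * g (snd z) \<partial>mehler s)" for s
  have contE: "continuous_on {0..1} E"
    unfolding E_def by (rule mehler_form_continuous[OF t])
  define r where "r u = s + (s' - s) * u" for u
  have r: "r u \<in> {0..1}" if "u \<in> {0..1}" for u
    using integral_mehler_avg_bounds[OF s, of u] that by (auto simp: r_def)
  have "(s' - s) * (\<integral>z. f (fst z) * g (snd z) \<partial>mehler_avg s s') = (s' - s) * (\<integral>u. E (r u) \<partial>unif)"
    unfolding E_def r_def by (subst integral_mehler_avg[OF _ KL]) auto
  also have "(\<integral>u. E (r u) \<partial>unif) = (\<integral>u. indicator {0..1} u *\<^sub>R E (r u) \<partial>lborel)"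
    using borel_measurable_integrable[OF integrable_mehler_avg[OF _ KL, where s = s and s' = s']]
    by (intro integral_unif) (simp add: E_def r_def)
  also have "(s' - s) * \<dots> = (\<integral>u. indicator {0..1} u *\<^sub>R ((s' - s) * E (r u)) \<partial>lborel)"
    unfolding Bochner_Integration.integral_mult_right_zero[symmetric]
    by (intro Bochner_Integration.integral_cong) auto
  also have "\<dots> = D (r 1) - D (r 0)"
  proof (rule integral_FTC_atLeastAtMost)
    show "continuous_on {0..1} (\<lambda>u. (s' - s) * E (r u))"
    proof (intro continuous_on_mult continuous_on_const)
      have "continuous_on {0..1} r" unfolding r_def by (intro continuous_intros)
      moreover have "r ` {0..1} \<subseteq> {0..1}" using r by blast
      ultimately show "continuous_on {0..1} (\<lambda>u. E (r u))"
        by (rule continuous_on_compose2[OF contE])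
    qed
    fix u :: real assume "0 \<le> u" "u \<le> 1"
    then have u: "u \<in> {0..1}" by auto
    have "(D has_real_derivative E (r u)) (at (r u) within r ` {0..1})"
      unfolding D_def E_def
      by (rule DERIV_subset[OF mehler_form_derivative[OF F G r[OF u]]]) (use r in blast)
    moreover have "(r has_real_derivative (s' - s)) (at u within {0..1})"
      unfolding r_def by (auto intro!: derivative_eq_intros)
    ultimately have "((\<lambda>u. D (r u)) has_real_derivative E (r u) * (s' - s)) (at u within {0..1})"
      by (rule DERIV_image_chain[unfolded o_def])
    then show "((\<lambda>u. D (r u)) has_vector_derivative (s' - s) * E (r u)) (at u within {0..1})"
      by (simp add: has_real_derivative_iff_has_vector_derivative mult.commute)
  qed simp
  finally show ?thesis by (simp add: D_def r_def)
qed

section \<open>Trigonometric polynomials are dense in the Gaussian space\<close>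

lemma L2_add: "f \<in> L2 M \<Longrightarrow> g \<in> L2 M \<Longrightarrow> (\<lambda>x. f x + g x) \<in> L2 M"
proof -
  assume "f \<in> L2 M" "g \<in> L2 M"
  then have [measurable]: "f \<in> borel_measurable M" "g \<in> borel_measurable M"
    and i: "integrable M (\<lambda>x. (f x)\<^sup>2)" "integrable M (\<lambda>x. (g x)\<^sup>2)" by (auto simp: L2_def)
  have "integrable M (\<lambda>x. (f x)\<^sup>2 + (g x)\<^sup>2 + 2 * (f x * g x))"
    by (intro Bochner_Integration.integrable_add integrable_mult_right i integrable_mult_L2) auto
  then show ?thesis by (simp add: L2_def power2_sum mult.assoc)
qed

lemma L2_cmult: "f \<in> L2 M \<Longrightarrow> (\<lambda>x. c * f x) \<in> L2 M"
  by (auto simp: L2_def power_mult_distrib)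

lemma L2_diff: "f \<in> L2 M \<Longrightarrow> g \<in> L2 M \<Longrightarrow> (\<lambda>x. f x - g x) \<in> L2 M"
  using L2_add[OF _ L2_cmult[of g M "- 1"], of f] by simp

lemma Cauchy_Schwarz_L2:
  assumes "u \<in> L2 M" "v \<in> L2 M"
  shows "\<bar>\<integral>x. u x * v x \<partial>M\<bar> \<le> sqrt (\<integral>x. (u x)\<^sup>2 \<partial>M) * sqrt (\<integral>x. (v x)\<^sup>2 \<partial>M)"
proof -
  define A B C where "A = (\<integral>x. (u x)\<^sup>2 \<partial>M)" and "B = (\<integral>x. u x * v x \<partial>M)" and "C = (\<integral>x. (v x)\<^sup>2 \<partial>M)"
  have [measurable]: "u \<in> borel_measurable M" "v \<in> borel_measurable M"
    and i: "integrable M (\<lambda>x. (u x)\<^sup>2)" "integrable M (\<lambda>x. (v x)\<^sup>2)" using assms by (auto simp: L2_def)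
  have iuv: "integrable M (\<lambda>x. u x * v x)" by (intro integrable_mult_L2 i) auto
  have q: "0 \<le> A - 2 * t * B + t\<^sup>2 * C" for t
  proof -
    have "0 \<le> (\<integral>x. (u x - t * v x)\<^sup>2 \<partial>M)" by (rule Bochner_Integration.integral_nonneg) auto
    also have "\<dots> = (\<integral>x. (u x)\<^sup>2 - (2 * t) * (u x * v x) + t\<^sup>2 * (v x)\<^sup>2 \<partial>M)"
      by (intro Bochner_Integration.integral_cong) (auto simp: power2_eq_square algebra_simps)
    also have "\<dots> = A - 2 * t * B + t\<^sup>2 * C" using i iuv by (simp add: A_def B_def C_def)
    finally show ?thesis .
  qed
  have AC: "0 \<le> A" "0 \<le> C" unfolding A_def C_def by (auto intro: Bochner_Integration.integral_nonneg)
  have "B\<^sup>2 \<le> A * C"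
  proof (cases "C = 0")
    case True
    have "B = 0"
    proof (rule ccontr)
      assume "B \<noteq> 0"
      then show False using q[of "(A + 1) / (2 * B)"] True by simp
    qed
    then show ?thesis using True by simp
  next
    case False
    then have "0 < C" using AC by simp
    have "A - 2 * (B / C) * B + (B / C)\<^sup>2 * C = A - B\<^sup>2 / C"
      using False by (simp add: power2_eq_square field_simps)
    then have "B\<^sup>2 / C \<le> A" using q[of "B / C"] by linarith
    then show ?thesis using \<open>0 < C\<close> by (simp add: pos_divide_le_eq)
  qed
  then have "\<bar>B\<bar> \<le> sqrt (A * C)" by (simp add: real_le_rsqrt)
  then show ?thesis by (simp add: A_def B_def C_def real_sqrt_mult)
qed

lemma coupling_marginals:
  assumes c: "coupling M c" and f: "f \<in> borel_measurable M"
  shows coupling_integral_fst: "(\<integral>z. f (fst z) \<partial>c) = (\<integral>x. f x \<partial>M :: real)"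
    and coupling_integral_snd: "(\<integral>z. f (snd z) \<partial>c) = (\<integral>x. f x \<partial>M)"
    and coupling_measurable_fst': "(\<lambda>z. f (fst z)) \<in> borel_measurable c"
    and coupling_measurable_snd': "(\<lambda>z. f (snd z)) \<in> borel_measurable c"
    and coupling_integrable: "integrable M f \<Longrightarrow> integrable c (\<lambda>z. f (fst z))"
      "integrable M f \<Longrightarrow> integrable c (\<lambda>z. f (snd z))"
proof -
  have d: "distr c borel fst = M" "distr c borel snd = M" using c by (auto simp: coupling_def)
  have f': "f \<in> borel_measurable borel" using f coupling_marginal_sets[OF c] by (simp cong: measurable_cong_sets)
  note m = coupling_measurable_fst[OF c] coupling_measurable_snd[OF c]
  show "(\<integral>z. f (fst z) \<partial>c) = (\<integral>x. f x \<partial>M)" using integral_distr[OF m(1) f'] d by simp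
  show "(\<integral>z. f (snd z) \<partial>c) = (\<integral>x. f x \<partial>M)" using integral_distr[OF m(2) f'] d by simp
  show "(\<lambda>z. f (fst z)) \<in> borel_measurable c" "(\<lambda>z. f (snd z)) \<in> borel_measurable c"
    using measurable_compose[OF m(1) f'] measurable_compose[OF m(2) f'] by auto
  show "integrable M f \<Longrightarrow> integrable c (\<lambda>z. f (fst z))" using integrable_distr_eq[OF m(1) f'] d by simp
  show "integrable M f \<Longrightarrow> integrable c (\<lambda>z. f (snd z))" using integrable_distr_eq[OF m(2) f'] d by simp
qed

lemma coupling_L2:
  assumes c: "coupling M c" and f: "f \<in> L2 M"
  shows "(\<lambda>z. f (fst z)) \<in> L2 c" "(\<lambda>z. f (snd z)) \<in> L2 c"
  using f coupling_marginals[OF c, of f] coupling_marginals[OF c, of "\<lambda>x. (f x)\<^sup>2"] by (auto simp: L2_def)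

lemma coupling_product_integrable:
  assumes c: "coupling M c" and f: "f \<in> L2 M" and g: "g \<in> L2 M"
  shows "integrable c (\<lambda>z. f (fst z) * g (snd z))"
  using coupling_L2[OF c f] coupling_L2[OF c g] by (intro integrable_mult_L2) (auto simp: L2_def)

lemma coupling_Cauchy_Schwarz:
  assumes c: "coupling M c" and f: "f \<in> L2 M" and g: "g \<in> L2 M"
  shows "\<bar>\<integral>z. f (fst z) * g (snd z) \<partial>c\<bar> \<le> sqrt (\<integral>x. (f x)\<^sup>2 \<partial>M) * sqrt (\<integral>x. (g x)\<^sup>2 \<partial>M)"
proof -
  have [measurable]: "f \<in> borel_measurable M" "g \<in> borel_measurable M" using f g by (auto simp: L2_def)
  have "(\<integral>z. (f (fst z))\<^sup>2 \<partial>c) = (\<integral>x. (f x)\<^sup>2 \<partial>M)"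
    by (rule coupling_integral_fst[OF c]) measurable
  moreover have "(\<integral>z. (g (snd z))\<^sup>2 \<partial>c) = (\<integral>x. (g x)\<^sup>2 \<partial>M)"
    by (rule coupling_integral_snd[OF c]) measurable
  ultimately show ?thesis
    using Cauchy_Schwarz_L2[OF coupling_L2(1)[OF c f] coupling_L2(2)[OF c g]] by simp
qed

text \<open>The form of a coupling is jointly continuous in \<open>L\<^sup>2\<close>, by Cauchy-Schwarz and equality of the
  marginals.\<close>

lemma coupling_form_tendsto:
  assumes c: "coupling M c" and f: "f \<in> L2 M" "\<And>n. F n \<in> L2 M" and g: "g \<in> L2 M" "\<And>n. G n \<in> L2 M"
    and lf: "(\<lambda>n. \<integral>x. (F n x - f x)\<^sup>2 \<partial>M) \<longlonglongrightarrow> 0" and lg: "(\<lambda>n. \<integral>x. (G n x - g x)\<^sup>2 \<partial>M) \<longlonglongrightarrow> 0"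
  shows "(\<lambda>n. \<integral>z. F n (fst z) * G n (snd z) \<partial>c) \<longlonglongrightarrow> (\<integral>z. f (fst z) * g (snd z) \<partial>c)"
proof -
  define a where "a n = sqrt (\<integral>x. (F n x - f x)\<^sup>2 \<partial>M)" for n
  define b where "b n = sqrt (\<integral>x. (G n x - g x)\<^sup>2 \<partial>M)" for n
  have a: "a \<longlonglongrightarrow> 0" unfolding a_def using tendsto_real_sqrt[OF lf] by simp
  have b: "b \<longlonglongrightarrow> 0" unfolding b_def using tendsto_real_sqrt[OF lg] by simp
  have df: "(\<lambda>x. F n x - f x) \<in> L2 M" and dg: "(\<lambda>x. G n x - g x) \<in> L2 M" for n using f g by (auto intro: L2_diff)
  have bound: "\<bar>(\<integral>z. F n (fst z) * G n (snd z) \<partial>c) - (\<integral>z. f (fst z) * g (snd z) \<partial>c)\<bar>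
    \<le> a n * sqrt (\<integral>x. (g x)\<^sup>2 \<partial>M) + a n * b n + sqrt (\<integral>x. (f x)\<^sup>2 \<partial>M) * b n" for n
  proof -
    note i = coupling_product_integrable[OF c]
    have "(\<integral>z. F n (fst z) * G n (snd z) \<partial>c) - (\<integral>z. f (fst z) * g (snd z) \<partial>c)
      = (\<integral>z. F n (fst z) * G n (snd z) - f (fst z) * g (snd z) \<partial>c)"
      by (rule Bochner_Integration.integral_diff[symmetric]) (intro i f g)+
    also have "\<dots> = (\<integral>z. (F n (fst z) - f (fst z)) * g (snd z) + (F n (fst z) - f (fst z)) * (G n (snd z) - g (snd z))
        + f (fst z) * (G n (snd z) - g (snd z)) \<partial>c)"
      by (intro Bochner_Integration.integral_cong) (auto simp: algebra_simps)
    also have "\<dots> = (\<integral>z. (F n (fst z) - f (fst z)) * g (snd z) \<partial>c)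
       + (\<integral>z. (F n (fst z) - f (fst z)) * (G n (snd z) - g (snd z)) \<partial>c) + (\<integral>z. f (fst z) * (G n (snd z) - g (snd z)) \<partial>c)"
      using i[OF df g(1)] i[OF df dg] i[OF f(1) dg] by simp
    finally show ?thesis
      using coupling_Cauchy_Schwarz[OF c df g(1), of n] coupling_Cauchy_Schwarz[OF c df dg, of n n]
        coupling_Cauchy_Schwarz[OF c f(1) dg, of n] unfolding a_def b_def by linarith
  qed
  have "(\<lambda>n. a n * sqrt (\<integral>x. (g x)\<^sup>2 \<partial>M) + a n * b n + sqrt (\<integral>x. (f x)\<^sup>2 \<partial>M) * b n)
    \<longlonglongrightarrow> 0 * sqrt (\<integral>x. (g x)\<^sup>2 \<partial>M) + 0 * 0 + sqrt (\<integral>x. (f x)\<^sup>2 \<partial>M) * 0"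
    by (intro tendsto_intros a b)
  then have "(\<lambda>n. a n * sqrt (\<integral>x. (g x)\<^sup>2 \<partial>M) + a n * b n + sqrt (\<integral>x. (f x)\<^sup>2 \<partial>M) * b n) \<longlonglongrightarrow> 0" by simp
  then have "(\<lambda>n. (\<integral>z. F n (fst z) * G n (snd z) \<partial>c) - (\<integral>z. f (fst z) * g (snd z) \<partial>c)) \<longlonglongrightarrow> 0"
    by (rule Lim_null_comparison[rotated]) (use bound in auto)
  then show ?thesis by (simp add: LIM_zero_iff)
qed

lemma gauss_bounded_tendsto_L2:
  fixes F :: "nat \<Rightarrow> real \<Rightarrow> real"
  assumes [measurable]: "\<And>n. F n \<in> borel_measurable borel" "f \<in> borel_measurable borel"
    and b: "\<And>n x. \<bar>F n x\<bar> \<le> K" "\<And>x. \<bar>f x\<bar> \<le> K" and lim: "AE x in gauss. (\<lambda>n. F n x) \<longlonglongrightarrow> f x"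
  shows "(\<lambda>n. \<integral>x. (F n x - f x)\<^sup>2 \<partial>gauss) \<longlonglongrightarrow> 0"
proof -
  have "(\<lambda>n. \<integral>x. (F n x - f x)\<^sup>2 \<partial>gauss) \<longlonglongrightarrow> (\<integral>x. 0 \<partial>gauss)"
  proof (rule integral_dominated_convergence[where w = "\<lambda>_. (2 * K)\<^sup>2"])
    show "AE x in gauss. (\<lambda>n. (F n x - f x)\<^sup>2) \<longlonglongrightarrow> 0"
      using lim by eventually_elim (auto intro!: tendsto_eq_intros)
    show "AE x in gauss. norm ((F n x - f x)\<^sup>2) \<le> (2 * K)\<^sup>2" for n
    proof (rule AE_I2)
      fix x
      have "\<bar>F n x - f x\<bar> \<le> 2 * K" using b(1)[of n x] b(2)[of x] by linarith
      then show "norm ((F n x - f x)\<^sup>2) \<le> (2 * K)\<^sup>2" using power_mono[of "\<bar>F n x - f x\<bar>" "2 * K" 2] by simp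
    qed
  qed auto
  then show ?thesis by simp
qed

definition trig_approximable :: "(real \<Rightarrow> real) \<Rightarrow> bool" where
  "trig_approximable f \<longleftrightarrow> (\<forall>e>0. \<exists>T t. trig_deriv T t \<and> (\<integral>x. (t x - f x)\<^sup>2 \<partial>gauss) < e)"

lemma trig_L2: "trig t \<Longrightarrow> t \<in> L2 gauss"
  using trig_bounded[of t] trig_measurable[of t] by (auto intro!: gauss.bounded_L2)

lemma integral_power2_triangle:
  assumes "f \<in> L2 M" "g \<in> L2 M" "h \<in> L2 M"
  shows "(\<integral>x. (f x - h x)\<^sup>2 \<partial>M) \<le> 2 * (\<integral>x. (f x - g x)\<^sup>2 \<partial>M) + 2 * (\<integral>x. (g x - h x)\<^sup>2 \<partial>M)"
proof -
  have i: "integrable M (\<lambda>x. (f x - h x)\<^sup>2)" "integrable M (\<lambda>x. (f x - g x)\<^sup>2)" "integrable M (\<lambda>x. (g x - h x)\<^sup>2)"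
    using L2_diff[OF assms(1,2)] L2_diff[OF assms(1,3)] L2_diff[OF assms(2,3)] by (auto simp: L2_def)
  have "(a - c)\<^sup>2 \<le> 2 * (a - b)\<^sup>2 + 2 * (b - c)\<^sup>2" for a b c :: real
  proof -
    have "2 * (a - b)\<^sup>2 + 2 * (b - c)\<^sup>2 - (a - c)\<^sup>2 = (a - 2 * b + c)\<^sup>2" by (simp add: power2_eq_square algebra_simps)
    then show ?thesis by (metis diff_ge_0_iff_ge zero_le_power2)
  qed
  then have "(\<integral>x. (f x - h x)\<^sup>2 \<partial>M) \<le> (\<integral>x. 2 * (f x - g x)\<^sup>2 + 2 * (g x - h x)\<^sup>2 \<partial>M)"
    by (intro integral_mono i Bochner_Integration.integrable_add integrable_mult_right) auto
  also have "\<dots> = 2 * (\<integral>x. (f x - g x)\<^sup>2 \<partial>M) + 2 * (\<integral>x. (g x - h x)\<^sup>2 \<partial>M)" using i by simp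
  finally show ?thesis .
qed

lemma trig_approximable_limit:
  assumes f: "f \<in> L2 gauss" and F: "\<And>n. F n \<in> L2 gauss" "\<And>n. trig_approximable (F n)"
    and lim: "(\<lambda>n. \<integral>x. (F n x - f x)\<^sup>2 \<partial>gauss) \<longlonglongrightarrow> 0"
  shows "trig_approximable f"
  unfolding trig_approximable_def
proof (intro allI impI)
  fix e :: real assume e: "0 < e"
  have "\<forall>\<^sub>F n in sequentially. (\<integral>x. (F n x - f x)\<^sup>2 \<partial>gauss) < e / 4"
    using order_tendstoD(2)[OF lim, of "e / 4"] e by simp
  then obtain n where n: "(\<integral>x. (F n x - f x)\<^sup>2 \<partial>gauss) < e / 4"
    using eventually_sequentially by auto
  obtain T t where t: "trig_deriv T t" "(\<integral>x. (t x - F n x)\<^sup>2 \<partial>gauss) < e / 4"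
    using F(2)[of n] e unfolding trig_approximable_def by (metis divide_pos_pos zero_less_numeral)
  have "t \<in> L2 gauss" using t trig_deriv_trig trig_L2 by blast
  then have "(\<integral>x. (t x - f x)\<^sup>2 \<partial>gauss) \<le> 2 * (\<integral>x. (t x - F n x)\<^sup>2 \<partial>gauss) + 2 * (\<integral>x. (F n x - f x)\<^sup>2 \<partial>gauss)"
    by (rule integral_power2_triangle[OF _ F(1) f])
  then show "\<exists>T t. trig_deriv T t \<and> (\<integral>x. (t x - f x)\<^sup>2 \<partial>gauss) < e" using t n by (intro exI[of _ T] exI[of _ t]) auto
qed

text \<open>A constant has no trigonometric primitive, but \<open>cos (x / (m + 1) + b)\<close> has one and tends to
  \<open>cos b\<close> boundedly.\<close>

lemma trig_deriv_dense_trig: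
  "trig t \<Longrightarrow> \<exists>T u K. (\<forall>m::nat. trig_deriv (T m) (u m)) \<and> (\<forall>m x. \<bar>u m x\<bar> \<le> K) \<and> (\<forall>x. (\<lambda>m. u m x) \<longlonglongrightarrow> t x)"
proof (induction rule: trig.induct)
  case (trig_cos c a b)
  have bd: "\<bar>c * cos y\<bar> \<le> \<bar>c\<bar>" for y
    using mult_left_mono[OF abs_cos_le_one[of y], of "\<bar>c\<bar>"] by (simp add: abs_mult)
  have td: "trig_deriv (\<lambda>x. (c / a) * cos (a * x + (b - pi / 2))) (\<lambda>x. c * cos (a * x + b))" if "a \<noteq> 0" for a
    using trig_deriv_cos[of "c / a" a "b - pi / 2"] that by simp
  show ?case
  proof (cases "a = 0")
    case False
    show ?thesis
      by (rule exI[of _ "\<lambda>m x. (c / a) * cos (a * x + (b - pi / 2))"], rule exI[of _ "\<lambda>m x. c * cos (a * x + b)"], rule exI[of _ "\<bar>c\<bar>"])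
        (use td[OF False] bd in auto)
  next
    case True
    (* Frequencies that tend to 0 without vanishing. *)
    define a' where "a' m = 1 / real (Suc m)" for m
    have "a' \<longlonglongrightarrow> 0" unfolding a'_def by (rule lim_const_over_n[THEN LIMSEQ_Suc])
    then have "(\<lambda>m. c * cos (a' m * x + b)) \<longlonglongrightarrow> c * cos (0 * x + b)" for x by (intro tendsto_intros)
    moreover have "a' m \<noteq> 0" for m by (simp add: a'_def)
    ultimately show ?thesis
      by (intro exI[of _ "\<lambda>m x. (c / a' m) * cos (a' m * x + (b - pi / 2))"] exI[of _ "\<lambda>m x. c * cos (a' m * x + b)"] exI[of _ "\<bar>c\<bar>"])
        (use td bd True in auto)
  qed
next
  case (trig_add f g)
  then obtain T u K T' u' K' where *: "\<And>m::nat. trig_deriv (T m) (u m)" "\<And>m x. \<bar>u m x\<bar> \<le> K" "\<And>x. (\<lambda>m. u m x) \<longlonglongrightarrow> f x"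
    "\<And>m::nat. trig_deriv (T' m) (u' m)" "\<And>m x. \<bar>u' m x\<bar> \<le> K'" "\<And>x. (\<lambda>m. u' m x) \<longlonglongrightarrow> g x" by blast
  have "\<bar>u m x + u' m x\<bar> \<le> K + K'" for m x using *(2)[of m x] *(5)[of m x] by linarith
  then show ?case
    using * by (intro exI[of _ "\<lambda>m x. T m x + T' m x"] exI[of _ "\<lambda>m x. u m x + u' m x"] exI[of _ "K + K'"])
      (auto intro: trig_deriv_add tendsto_add)
qed

lemma trig_approximable_deriv:
  assumes "trig_deriv T t" shows "trig_approximable t"
  unfolding trig_approximable_def
proof (intro allI impI)
  fix e :: real assume "0 < e"
  then have "(\<integral>x. (t x - t x)\<^sup>2 \<partial>gauss) < e" by simp
  with assms show "\<exists>T u. trig_deriv T u \<and> (\<integral>x. (u x - t x)\<^sup>2 \<partial>gauss) < e" by blast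
qed

lemma trig_approximable_trig:
  assumes "trig t" shows "trig_approximable t"
proof -
  obtain T u K where *: "\<And>m::nat. trig_deriv (T m) (u m)" "\<And>m x. \<bar>u m x\<bar> \<le> K" "\<And>x. (\<lambda>m. u m x) \<longlonglongrightarrow> t x"
    using trig_deriv_dense_trig[OF assms] by blast
  have tK: "\<bar>t x\<bar> \<le> K" for x
    by (rule LIMSEQ_le_const2[OF tendsto_rabs[OF *(3)]]) (use *(2) in auto)
  show ?thesis
  proof (rule trig_approximable_limit[where F = u])
    show "u n \<in> L2 gauss" "trig_approximable (u n)" for n
      using *(1)[of n] trig_deriv_trig trig_L2 trig_approximable_deriv by blast+
    show "(\<lambda>n. \<integral>x. (u n x - t x)\<^sup>2 \<partial>gauss) \<longlonglongrightarrow> 0"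
    proof (rule gauss_bounded_tendsto_L2[where K = K])
      show "u n \<in> borel_measurable borel" for n
        using trig_measurable trig_deriv_trig[OF *(1)[of n]] by blast
      show "t \<in> borel_measurable borel" by (rule trig_measurable[OF assms])
      show "AE x in gauss. (\<lambda>n. u n x) \<longlonglongrightarrow> t x" using *(3) by simp
    qed (fact *(2) tK)+
  qed (rule trig_L2[OF assms])
qed

lemma trig_approximable_bounded:
  assumes [measurable]: "f \<in> borel_measurable borel" and K: "\<And>x. \<bar>f x\<bar> \<le> K"
  shows "trig_approximable f"
proof -
  have K': "- K \<le> f x" "f x \<le> K" for x using K[of x] by linarith+
  obtain F where F: "\<And>n. continuous_on {-1..1} (F n)" "\<And>n y. - K \<le> F n y" "\<And>n y. F n y \<le> K"
    "AE x in lborel. (\<lambda>n. F n (sin (x / real (Suc n)))) \<longlonglongrightarrow> f x"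
    using periodic_approximation[OF assms(1) K'] by blast
  have "\<forall>n. \<exists>t. trig t \<and> (\<forall>x. \<bar>F n (sin (x / real (Suc n))) - t x\<bar> < 1 / real (Suc n))"
    by (intro allI trig_dense_periodic F(1)) simp
  then obtain t where t: "\<And>n. trig (t n)" "\<And>n x. \<bar>F n (sin (x / real (Suc n))) - t n x\<bar> < 1 / real (Suc n)"
    by metis
  have tK: "\<bar>t n x\<bar> \<le> K + 1" for n x
  proof -
    have "1 / real (Suc n) \<le> 1" by simp
    then show ?thesis using t(2)[of n x] F(2)[of n "sin (x / real (Suc n))"] F(3)[of n "sin (x / real (Suc n))"] by linarith
  qed
  show ?thesis
  proof (rule trig_approximable_limit[where F = t])
    show "(\<lambda>n. \<integral>x. (t n x - f x)\<^sup>2 \<partial>gauss) \<longlonglongrightarrow> 0"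
    proof (rule gauss_bounded_tendsto_L2[where K = "K + 1"])
      show "\<bar>f x\<bar> \<le> K + 1" for x using K[of x] by linarith
      show "AE x in gauss. (\<lambda>n. t n x) \<longlonglongrightarrow> f x"
        using AE_gauss[OF F(4)]
      proof eventually_elim
        case (elim x)
        have "(\<lambda>n. F n (sin (x / real (Suc n))) - t n x) \<longlonglongrightarrow> 0"
        proof (rule Lim_null_comparison)
          show "\<forall>\<^sub>F n in sequentially. norm (F n (sin (x / real (Suc n))) - t n x) \<le> 1 / real (Suc n)"
            using t(2)[THEN less_imp_le] by (intro always_eventually) auto
          show "(\<lambda>n. 1 / real (Suc n)) \<longlonglongrightarrow> 0" by (rule lim_const_over_n[THEN LIMSEQ_Suc])
        qed
        from tendsto_diff[OF elim this] show ?case by simp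
      qed
    qed (use t tK in \<open>auto intro: trig_measurable\<close>)
  qed (use t trig_L2 trig_approximable_trig K in \<open>auto intro!: gauss.bounded_L2\<close>)
qed

lemma trig_approximable_L2:
  assumes f: "f \<in> L2 gauss" shows "trig_approximable f"
proof -
  have [measurable]: "f \<in> borel_measurable borel" and i: "integrable gauss (\<lambda>x. (f x)\<^sup>2)"
    using f by (auto simp: L2_def)
  define F where "F n x = max (- real n) (min (real n) (f x))" for n x
  have [measurable]: "F n \<in> borel_measurable borel" for n unfolding F_def by measurable
  have Fn: "\<bar>F n x\<bar> \<le> real n" for n x by (auto simp: F_def)
  show ?thesis
  proof (rule trig_approximable_limit[OF f, where F = F])
    show "F n \<in> L2 gauss" for n using Fn[of n] by (intro gauss.bounded_L2) auto
    show "trig_approximable (F n)" for n using Fn[of n] by (intro trig_approximable_bounded) auto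
    have "(\<lambda>n. \<integral>x. (F n x - f x)\<^sup>2 \<partial>gauss) \<longlonglongrightarrow> (\<integral>x. 0 \<partial>gauss)"
    proof (rule integral_dominated_convergence[OF _ _ i])
      show "AE x in gauss. (\<lambda>n. (F n x - f x)\<^sup>2) \<longlonglongrightarrow> 0"
      proof (rule AE_I2)
        fix x
        obtain m where "\<bar>f x\<bar> \<le> real m" using real_arch_simple by blast
        then have "\<forall>\<^sub>F n in sequentially. (F n x - f x)\<^sup>2 = 0"
          by (auto simp: F_def eventually_sequentially intro!: exI[of _ m])
        then show "(\<lambda>n. (F n x - f x)\<^sup>2) \<longlonglongrightarrow> 0" by (rule tendsto_eventually)
      qed
      show "AE x in gauss. norm ((F n x - f x)\<^sup>2) \<le> (f x)\<^sup>2" for n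
      proof (rule AE_I2)
        fix x
        have "\<bar>F n x - f x\<bar> \<le> \<bar>f x\<bar>" by (auto simp: F_def)
        then show "norm ((F n x - f x)\<^sup>2) \<le> (f x)\<^sup>2" by (simp add: abs_le_square_iff)
      qed
    qed auto
    then show "(\<lambda>n. \<integral>x. (F n x - f x)\<^sup>2 \<partial>gauss) \<longlonglongrightarrow> 0" by simp
  qed
qed

lemma trig_deriv_dense_L2:
  assumes "f \<in> L2 gauss"
  obtains T t where "\<And>n::nat. trig_deriv (T n) (t n)" "(\<lambda>n. \<integral>x. (t n x - f x)\<^sup>2 \<partial>gauss) \<longlonglongrightarrow> 0"
proof -
  have "\<forall>n. \<exists>p. trig_deriv (fst p) (snd p) \<and> (\<integral>x. (snd p x - f x)\<^sup>2 \<partial>gauss) < 1 / real (Suc n)"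
    using trig_approximable_L2[OF assms] unfolding trig_approximable_def by simp
  then obtain p where p: "\<And>n. trig_deriv (fst (p n)) (snd (p n))" "\<And>n. (\<integral>x. (snd (p n) x - f x)\<^sup>2 \<partial>gauss) < 1 / real (Suc n)"
    by metis
  have "(\<lambda>n. \<integral>x. (snd (p n) x - f x)\<^sup>2 \<partial>gauss) \<longlonglongrightarrow> 0"
  proof (rule Lim_null_comparison)
    show "\<forall>\<^sub>F n in sequentially. norm (\<integral>x. (snd (p n) x - f x)\<^sup>2 \<partial>gauss) \<le> 1 / real (Suc n)"
      using p(2)[THEN less_imp_le] by (intro always_eventually) auto
    show "(\<lambda>n. 1 / real (Suc n)) \<longlonglongrightarrow> 0" by (rule lim_const_over_n[THEN LIMSEQ_Suc])
  qed
  then show ?thesis using that[of "\<lambda>n. fst (p n)" "\<lambda>n. snd (p n)"] p by auto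
qed

section \<open>Primitives in the Gaussian space\<close>

text \<open>The signed indicator of the interval between \<open>0\<close> and \<open>x\<close>, so that integration against it
  gives the primitive vanishing at \<open>0\<close>.\<close>

definition ramp :: "real \<Rightarrow> real \<Rightarrow> real" where
  "ramp x u = (if 0 \<le> u \<and> u \<le> x then 1 else 0) - (if x \<le> u \<and> u \<le> 0 then 1 else 0)"

definition primitive :: "(real \<Rightarrow> real) \<Rightarrow> real \<Rightarrow> real" where
  "primitive k x = (\<integral>u. ramp x u * k u \<partial>lborel)"

lemma ramp_measurable [measurable (raw)]:
  assumes [measurable]: "f \<in> borel_measurable M" "g \<in> borel_measurable M"
  shows "(\<lambda>z. ramp (f z) (g z)) \<in> borel_measurable M"
  unfolding ramp_def by measurable

lemma ramp_pos: "0 < x \<Longrightarrow> ramp x u = indicator {0..x} u"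
  and ramp_neg: "x < 0 \<Longrightarrow> ramp x u = - indicator {x..0} u"
  and ramp_zero: "ramp 0 u = 0"
  by (auto simp: ramp_def indicator_def)

lemma abs_ramp_le: "\<bar>ramp x u\<bar> \<le> indicator {- \<bar>x\<bar>..\<bar>x\<bar>} u"
  by (auto simp: ramp_def indicator_def)

lemma ramp_sq: "ramp x u * ramp x u = \<bar>ramp x u\<bar>" "ramp x u * \<bar>ramp x u\<bar> = ramp x u" "\<bar>ramp x u\<bar> * \<bar>ramp x u\<bar> = \<bar>ramp x u\<bar>"
  by (auto simp: ramp_def)

lemma integral_abs_ramp: "(\<integral>u. \<bar>ramp x u\<bar> \<partial>lborel) = \<bar>x\<bar>" "integrable lborel (\<lambda>u. \<bar>ramp x u\<bar>)"
proof -
  consider "x > 0" | "x = 0" | "x < 0" by linarith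
  then have "has_bochner_integral lborel (\<lambda>u. \<bar>ramp x u\<bar>) \<bar>x\<bar>"
  proof cases
    case 1
    then show ?thesis using has_bochner_integral_real_indicator[of "{0..x}" lborel] by (simp add: ramp_pos)
  next
    case 2
    then show ?thesis by (simp add: ramp_zero has_bochner_integral_zero)
  next
    case 3
    then show ?thesis using has_bochner_integral_real_indicator[of "{x..0}" lborel] by (simp add: ramp_neg)
  qed
  then show "(\<integral>u. \<bar>ramp x u\<bar> \<partial>lborel) = \<bar>x\<bar>" "integrable lborel (\<lambda>u. \<bar>ramp x u\<bar>)"
    by (auto simp: has_bochner_integral_iff)
qed

lemma gauss_L2_weighted:
  assumes "k \<in> L2 gauss"
  shows "integrable lborel (\<lambda>u. std_normal_density u * (k u)\<^sup>2)"
    "(\<integral>u. std_normal_density u * (k u)\<^sup>2 \<partial>lborel) = (\<integral>u. (k u)\<^sup>2 \<partial>gauss)"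
proof -
  have [measurable]: "k \<in> borel_measurable borel" using assms by (auto simp: L2_def)
  have "integrable gauss (\<lambda>u. (k u)\<^sup>2)" using assms by (auto simp: L2_def)
  then show "integrable lborel (\<lambda>u. std_normal_density u * (k u)\<^sup>2)"
    unfolding gauss_def by (subst (asm) integrable_density) auto
  show "(\<integral>u. std_normal_density u * (k u)\<^sup>2 \<partial>lborel) = (\<integral>u. (k u)\<^sup>2 \<partial>gauss)"
    unfolding gauss_def by (subst integral_density) auto
qed

lemma gauss_L2_locally_sq_integrable:
  assumes k: "k \<in> L2 gauss" shows "integrable lborel (\<lambda>u. indicator {-R..R} u * (k u)\<^sup>2)"
proof (cases "0 \<le> R")
  case R: True
  have [measurable]: "k \<in> borel_measurable borel" using k by (auto simp: L2_def)
  define c where "c = std_normal_density R"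
  have c: "0 < c" by (simp add: c_def normal_density_pos)
  have le: "c \<le> std_normal_density u" if "u \<in> {-R..R}" for u
  proof -
    have "u\<^sup>2 \<le> R\<^sup>2" using that R by (intro power2_le_iff_abs_le[THEN iffD2]) auto
    then show ?thesis unfolding c_def std_normal_density_def by (intro mult_left_mono) auto
  qed
  show ?thesis
  proof (rule Bochner_Integration.integrable_bound)
    show "integrable lborel (\<lambda>u. (1 / c) * (std_normal_density u * (k u)\<^sup>2))"
      by (intro integrable_mult_right gauss_L2_weighted k)
    show "AE u in lborel. norm (indicator {-R..R} u * (k u)\<^sup>2) \<le> norm (1 / c * (std_normal_density u * (k u)\<^sup>2))"
    proof (intro AE_I2)
      fix u
      have "indicator {-R..R} u * (k u)\<^sup>2 \<le> 1 / c * (std_normal_density u * (k u)\<^sup>2)"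
      proof (cases "u \<in> {-R..R}")
        case True
        have "c * (k u)\<^sup>2 \<le> std_normal_density u * (k u)\<^sup>2" by (intro mult_right_mono le True) auto
        then show ?thesis using c True by (simp add: field_simps)
      qed (use c in \<open>simp add: normal_density_nonneg\<close>)
      then show "norm (indicator {-R..R} u * (k u)\<^sup>2) \<le> norm (1 / c * (std_normal_density u * (k u)\<^sup>2))"
        using c by (simp add: abs_mult normal_density_nonneg)
    qed
  qed measurable
qed simp

lemma ramp_sq_integrable:
  assumes k: "k \<in> L2 gauss" shows "integrable lborel (\<lambda>u. \<bar>ramp x u\<bar> * (k u)\<^sup>2)"
proof (rule Bochner_Integration.integrable_bound[OF gauss_L2_locally_sq_integrable[OF k, of "\<bar>x\<bar>"]])
  have [measurable]: "k \<in> borel_measurable borel" using k by (auto simp: L2_def)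
  show "(\<lambda>u. \<bar>ramp x u\<bar> * (k u)\<^sup>2) \<in> borel_measurable lborel" by measurable
  show "AE u in lborel. norm (\<bar>ramp x u\<bar> * (k u)\<^sup>2) \<le> norm (indicator {- \<bar>x\<bar>..\<bar>x\<bar>} u * (k u)\<^sup>2)"
    using abs_ramp_le[of x] by (intro AE_I2) (auto simp: abs_mult intro!: mult_right_mono)
qed

lemma ramp_L2:
  assumes k: "k \<in> L2 gauss"
  shows "(\<lambda>u. ramp x u) \<in> L2 lborel" "(\<lambda>u. \<bar>ramp x u\<bar> * k u) \<in> L2 lborel"
proof -
  have [measurable]: "k \<in> borel_measurable borel" using k by (auto simp: L2_def)
  show "(\<lambda>u. ramp x u) \<in> L2 lborel"
    using integral_abs_ramp(2)[of x] by (simp add: L2_def power2_eq_square ramp_sq)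
  have "(\<bar>ramp x u\<bar> * k u)\<^sup>2 = \<bar>ramp x u\<bar> * (k u)\<^sup>2" for u
    by (auto simp: ramp_def power_mult_distrib)
  then show "(\<lambda>u. \<bar>ramp x u\<bar> * k u) \<in> L2 lborel"
    using ramp_sq_integrable[OF k, of x] by (simp add: L2_def)
qed

lemma ramp_integrable:
  assumes k: "k \<in> L2 gauss" shows "integrable lborel (\<lambda>u. ramp x u * k u)"
proof -
  have "integrable lborel (\<lambda>u. ramp x u * (\<bar>ramp x u\<bar> * k u))"
    using ramp_L2[OF k, of x] by (intro integrable_mult_L2) (auto simp: L2_def)
  then show ?thesis by (simp add: mult.assoc[symmetric] ramp_sq)
qed

lemma primitive_measurable [measurable]:
  assumes [measurable]: "k \<in> borel_measurable borel" shows "primitive k \<in> borel_measurable borel"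
  unfolding primitive_def by measurable

lemma primitive_diff:
  assumes "f \<in> L2 gauss" "g \<in> L2 gauss"
  shows "primitive (\<lambda>u. f u - g u) x = primitive f x - primitive g x"
  unfolding primitive_def
  using Bochner_Integration.integral_diff[OF ramp_integrable[OF assms(1), of x] ramp_integrable[OF assms(2), of x]]
  by (simp add: right_diff_distrib)

lemma primitive_sq_le:
  assumes k: "k \<in> L2 gauss" shows "(primitive k x)\<^sup>2 \<le> \<bar>x\<bar> * (\<integral>u. \<bar>ramp x u\<bar> * (k u)\<^sup>2 \<partial>lborel)"
proof -
  have s: "(\<bar>ramp x u\<bar> * k u)\<^sup>2 = \<bar>ramp x u\<bar> * (k u)\<^sup>2" "(ramp x u)\<^sup>2 = \<bar>ramp x u\<bar>" for u
    by (auto simp: ramp_def power_mult_distrib)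
  have "\<bar>primitive k x\<bar> \<le> sqrt (\<integral>u. \<bar>ramp x u\<bar> \<partial>lborel) * sqrt (\<integral>u. \<bar>ramp x u\<bar> * (k u)\<^sup>2 \<partial>lborel)"
    using Cauchy_Schwarz_L2[OF ramp_L2[OF k], of x x] unfolding primitive_def s
    by (simp add: mult.assoc[symmetric] ramp_sq)
  then have "\<bar>primitive k x\<bar>\<^sup>2 \<le> (sqrt \<bar>x\<bar> * sqrt (\<integral>u. \<bar>ramp x u\<bar> * (k u)\<^sup>2 \<partial>lborel))\<^sup>2"
    unfolding integral_abs_ramp by (rule power_mono) simp
  also have "\<dots> = \<bar>x\<bar> * (\<integral>u. \<bar>ramp x u\<bar> * (k u)\<^sup>2 \<partial>lborel)"
    by (simp add: power_mult_distrib real_sqrt_pow2 Bochner_Integration.integral_nonneg)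
  finally show ?thesis by simp
qed

text \<open>The integrand is minus the derivative of the density.\<close>

lemma nn_integral_gauss_tail:
  assumes "u > 0"
  shows "(\<integral>\<^sup>+x. ennreal (x * std_normal_density x) * indicator {u..} x \<partial>lborel) = ennreal (std_normal_density u)"
proof -
  have "(\<integral>\<^sup>+x. ennreal (x * std_normal_density x) * indicator {u..} x \<partial>lborel) = ennreal (0 - (- std_normal_density u))"
  proof (rule nn_integral_FTC_atLeast)
    show "(\<lambda>x. x * std_normal_density x) \<in> borel_measurable borel" by measurable
    show "((\<lambda>x. - std_normal_density x) has_real_derivative x * std_normal_density x) (at x)" for x
    proof -
      have "((\<lambda>x. - (c * exp (- x\<^sup>2 / 2))) has_real_derivative x * (c * exp (- x\<^sup>2 / 2))) (at x)" for c :: real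
        by (auto intro!: derivative_eq_intros)
      then show ?thesis unfolding std_normal_density_def .
    qed
    show "0 \<le> x * std_normal_density x" if "u \<le> x" for x using that assms by simp
    show "((\<lambda>x. - std_normal_density x) \<longlongrightarrow> 0) at_top"
      unfolding std_normal_density_def by real_asymp
  qed
  then show ?thesis by simp
qed

lemma nn_integral_gauss_ramp:
  assumes "u \<noteq> 0"
  shows "(\<integral>\<^sup>+x. ennreal (std_normal_density x * \<bar>x\<bar> * \<bar>ramp x u\<bar>) \<partial>lborel) = ennreal (std_normal_density u)"
proof (cases "u > 0")
  case True
  have "(\<integral>\<^sup>+x. ennreal (std_normal_density x * \<bar>x\<bar> * \<bar>ramp x u\<bar>) \<partial>lborel)
    = (\<integral>\<^sup>+x. ennreal (x * std_normal_density x) * indicator {u..} x \<partial>lborel)"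
    using True by (intro nn_integral_cong) (auto simp: ramp_def indicator_def mult.commute)
  then show ?thesis using nn_integral_gauss_tail[OF True] by simp
next
  case False
  then have u: "- u > 0" using assms by simp
  have "(\<integral>\<^sup>+x. ennreal (std_normal_density x * \<bar>x\<bar> * \<bar>ramp x u\<bar>) \<partial>lborel)
    = (\<integral>\<^sup>+x. ennreal (std_normal_density (0 + (-1) * x) * \<bar>0 + (-1) * x\<bar> * \<bar>ramp (0 + (-1) * x) u\<bar>) \<partial>lborel)"
    by (subst nn_integral_real_affine[where c = "-1" and t = 0]) auto
  also have "\<dots> = (\<integral>\<^sup>+x. ennreal (x * std_normal_density x) * indicator {-u..} x \<partial>lborel)"
    using u by (intro nn_integral_cong) (auto simp: ramp_def indicator_def std_normal_density_def)
  also have "\<dots> = ennreal (std_normal_density u)"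
    using nn_integral_gauss_tail[OF u] by (simp add: std_normal_density_def)
  finally show ?thesis .
qed

text \<open>An inequality of Hardy's type with constant one. Cauchy-Schwarz gives
  \<open>(primitive k x)\<^sup>2 \<le> \<bar>x\<bar> * \<integral>\<bar>ramp x u\<bar> * (k u)\<^sup>2\<close>; exchanging the integrals leaves the tail integral
  of \<open>\<bar>x\<bar>\<close> beyond \<open>u\<close>, which is the density at \<open>u\<close>.\<close>

lemma primitive_L2:
  assumes k: "k \<in> L2 gauss"
  shows "primitive k \<in> L2 gauss" "(\<integral>x. (primitive k x)\<^sup>2 \<partial>gauss) \<le> (\<integral>x. (k x)\<^sup>2 \<partial>gauss)"
proof -
  have [measurable]: "k \<in> borel_measurable borel" using k by (auto simp: L2_def)
  have *: "ennreal (std_normal_density x * (primitive k x)\<^sup>2)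
      \<le> (\<integral>\<^sup>+u. ennreal (std_normal_density x * \<bar>x\<bar> * \<bar>ramp x u\<bar>) * ennreal ((k u)\<^sup>2) \<partial>lborel)" for x
  proof -
    have "std_normal_density x * (primitive k x)\<^sup>2 \<le> std_normal_density x * (\<bar>x\<bar> * (\<integral>u. \<bar>ramp x u\<bar> * (k u)\<^sup>2 \<partial>lborel))"
      by (intro mult_left_mono primitive_sq_le k) (simp add: normal_density_nonneg)
    also have "\<dots> = (\<integral>u. std_normal_density x * \<bar>x\<bar> * \<bar>ramp x u\<bar> * (k u)\<^sup>2 \<partial>lborel)"
      by (simp add: mult.assoc)
    finally have "ennreal (std_normal_density x * (primitive k x)\<^sup>2)
      \<le> ennreal (\<integral>u. std_normal_density x * \<bar>x\<bar> * \<bar>ramp x u\<bar> * (k u)\<^sup>2 \<partial>lborel)" by (rule ennreal_leI)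
    also have "\<dots> = (\<integral>\<^sup>+u. ennreal (std_normal_density x * \<bar>x\<bar> * \<bar>ramp x u\<bar> * (k u)\<^sup>2) \<partial>lborel)"
    proof (rule nn_integral_eq_integral[symmetric])
      show "integrable lborel (\<lambda>u. std_normal_density x * \<bar>x\<bar> * \<bar>ramp x u\<bar> * (k u)\<^sup>2)"
        using ramp_sq_integrable[OF k, of x] by (simp add: mult.assoc)
    qed (simp add: normal_density_nonneg)
    also have "\<dots> = (\<integral>\<^sup>+u. ennreal (std_normal_density x * \<bar>x\<bar> * \<bar>ramp x u\<bar>) * ennreal ((k u)\<^sup>2) \<partial>lborel)"
      by (intro nn_integral_cong ennreal_mult) (auto simp: normal_density_nonneg)
    finally show ?thesis .
  qed
  have "(\<integral>\<^sup>+x. ennreal ((primitive k x)\<^sup>2) \<partial>gauss) = (\<integral>\<^sup>+x. ennreal (std_normal_density x * (primitive k x)\<^sup>2) \<partial>lborel)"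
    unfolding gauss_def by (subst nn_integral_density) (auto simp: ennreal_mult normal_density_nonneg)
  also have "\<dots> \<le> (\<integral>\<^sup>+x. (\<integral>\<^sup>+u. ennreal (std_normal_density x * \<bar>x\<bar> * \<bar>ramp x u\<bar>) * ennreal ((k u)\<^sup>2) \<partial>lborel) \<partial>lborel)"
    by (intro nn_integral_mono *)
  also have "\<dots> = (\<integral>\<^sup>+u. (\<integral>\<^sup>+x. ennreal (std_normal_density x * \<bar>x\<bar> * \<bar>ramp x u\<bar>) * ennreal ((k u)\<^sup>2) \<partial>lborel) \<partial>lborel)"
    by (rule lborel_pair.Fubini') measurable
  also have "\<dots> = (\<integral>\<^sup>+u. ennreal (std_normal_density u) * ennreal ((k u)\<^sup>2) \<partial>lborel)"
  proof (rule nn_integral_cong_AE)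
    have "AE u in lborel. u \<noteq> (0::real)" by (rule AE_lborel_singleton)
    then show "AE u in lborel. (\<integral>\<^sup>+x. ennreal (std_normal_density x * \<bar>x\<bar> * \<bar>ramp x u\<bar>) * ennreal ((k u)\<^sup>2) \<partial>lborel)
        = ennreal (std_normal_density u) * ennreal ((k u)\<^sup>2)"
      by eventually_elim (simp add: nn_integral_multc nn_integral_gauss_ramp)
  qed
  also have "\<dots> = (\<integral>\<^sup>+u. ennreal ((k u)\<^sup>2) \<partial>gauss)"
    unfolding gauss_def by (subst nn_integral_density) auto
  also have "\<dots> = ennreal (\<integral>u. (k u)\<^sup>2 \<partial>gauss)"
    using k by (intro nn_integral_eq_integral) (auto simp: L2_def)
  finally have le: "(\<integral>\<^sup>+x. ennreal ((primitive k x)\<^sup>2) \<partial>gauss) \<le> ennreal (\<integral>u. (k u)\<^sup>2 \<partial>gauss)" .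
  have [measurable]: "primitive k \<in> borel_measurable gauss" by measurable
  have i: "integrable gauss (\<lambda>x. (primitive k x)\<^sup>2)"
    by (rule integrableI_bounded) (use le in \<open>auto intro: le_less_trans\<close>)
  then show "primitive k \<in> L2 gauss" by (simp add: L2_def)
  have "ennreal (\<integral>x. (primitive k x)\<^sup>2 \<partial>gauss) \<le> ennreal (\<integral>u. (k u)\<^sup>2 \<partial>gauss)"
    using le nn_integral_eq_integral[OF i] by simp
  then show "(\<integral>x. (primitive k x)\<^sup>2 \<partial>gauss) \<le> (\<integral>x. (k x)\<^sup>2 \<partial>gauss)"
    by (subst (asm) ennreal_le_iff) (auto intro: Bochner_Integration.integral_nonneg)
qed

lemma primitive_trig:
  assumes "trig_deriv T t" shows "primitive t x = T x - T 0"
proof -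
  have d: "(T has_vector_derivative t y) (at y within A)" for y A
    using has_field_derivative_at_within[OF trig_deriv_DERIV[OF assms, of y], of A]
    by (simp add: has_real_derivative_iff_has_vector_derivative)
  have c: "continuous_on A t" for A using trig_deriv_trig[OF assms] trig_continuous by blast
  consider "x > 0" | "x = 0" | "x < 0" by linarith
  then show ?thesis
  proof cases
    case 1
    then show ?thesis using integral_FTC_atLeastAtMost[of 0 x T t, OF _ d c] by (simp add: primitive_def ramp_pos)
  next
    case 2
    then show ?thesis by (simp add: primitive_def ramp_zero)
  next
    case 3
    then show ?thesis using integral_FTC_atLeastAtMost[of x 0 T t, OF _ d c] by (simp add: primitive_def ramp_neg)
  qed
qed

text \<open>Absolute continuity with both the function and its derivative square integrable for the
  Gaussian measure.\<close>

definition has_gauss_deriv :: "(real \<Rightarrow> real) \<Rightarrow> (real \<Rightarrow> real) \<Rightarrow> bool" where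
  "has_gauss_deriv f h \<longleftrightarrow> f \<in> L2 gauss \<and> h \<in> L2 gauss \<and> (\<exists>c. AE x in lborel. f x = c + primitive h x)"

lemma has_gauss_deriv_approx:
  assumes "has_gauss_deriv f h"
  obtains T t where "\<And>n::nat. trig_deriv (T n) (t n)" "(\<lambda>n. \<integral>x. (t n x - h x)\<^sup>2 \<partial>gauss) \<longlonglongrightarrow> 0"
    "(\<lambda>n. \<integral>x. (T n x - f x)\<^sup>2 \<partial>gauss) \<longlonglongrightarrow> 0"
proof -
  obtain c where f: "f \<in> L2 gauss" and h: "h \<in> L2 gauss" and c: "AE x in lborel. f x = c + primitive h x"
    using assms by (auto simp: has_gauss_deriv_def)
  have [measurable]: "f \<in> borel_measurable borel" "h \<in> borel_measurable borel" using f h by (auto simp: L2_def)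
  obtain T t where t: "\<And>n::nat. trig_deriv (T n) (t n)" and lim: "(\<lambda>n. \<integral>x. (t n x - h x)\<^sup>2 \<partial>gauss) \<longlonglongrightarrow> 0"
    using trig_deriv_dense_L2[OF h] by blast
  define T' where "T' n x = T n x + (c - T n 0)" for n x
  have t': "trig_deriv (T' n) (t n)" for n unfolding T'_def by (rule trig_deriv_add_const[OF t])
  have tL: "t n \<in> L2 gauss" for n using t[of n] trig_deriv_trig trig_L2 by blast
  have [measurable]: "T' n \<in> borel_measurable borel" "t n \<in> borel_measurable borel" for n
    using t'[of n] trig_deriv_trig trig_measurable by blast+
  have le: "(\<integral>x. (T' n x - f x)\<^sup>2 \<partial>gauss) \<le> (\<integral>x. (t n x - h x)\<^sup>2 \<partial>gauss)" for n
  proof -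
    have "(\<integral>x. (T' n x - f x)\<^sup>2 \<partial>gauss) = (\<integral>x. (primitive (\<lambda>u. t n u - h u) x)\<^sup>2 \<partial>gauss)"
    proof (rule integral_cong_AE)
      show "AE x in gauss. (T' n x - f x)\<^sup>2 = (primitive (\<lambda>u. t n u - h u) x)\<^sup>2"
        using AE_gauss[OF c]
        by eventually_elim (simp add: primitive_diff[OF tL h] primitive_trig[OF t] T'_def algebra_simps)
    qed measurable
    also have "\<dots> \<le> (\<integral>x. (t n x - h x)\<^sup>2 \<partial>gauss)" by (rule primitive_L2(2)[OF L2_diff[OF tL h]])
    finally show ?thesis .
  qed
  have "(\<lambda>n. \<integral>x. (T' n x - f x)\<^sup>2 \<partial>gauss) \<longlonglongrightarrow> 0"
    by (rule Lim_null_comparison[OF _ lim]) (use le in \<open>auto intro!: always_eventually\<close>)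
  then show ?thesis using that[of T' t] t' lim by blast
qed

text \<open>Derivatives are approximated by trigonometric polynomials in \<open>L\<^sup>2\<close>, and the
  inequality for primitives makes the functions converge as well.\<close>

theorem mehler_increment:
  assumes f: "has_gauss_deriv f h" and g: "has_gauss_deriv g k" and s: "0 \<le> s" "s \<le> s'" "s' \<le> 1"
  shows "(\<integral>z. f (fst z) * g (snd z) \<partial>mehler s') - (\<integral>z. f (fst z) * g (snd z) \<partial>mehler s)
    = (s' - s) * (\<integral>z. h (fst z) * k (snd z) \<partial>mehler_avg s s')"
proof -
  obtain T t where T: "\<And>n::nat. trig_deriv (T n) (t n)" "(\<lambda>n. \<integral>x. (t n x - h x)\<^sup>2 \<partial>gauss) \<longlonglongrightarrow> 0"
    "(\<lambda>n. \<integral>x. (T n x - f x)\<^sup>2 \<partial>gauss) \<longlonglongrightarrow> 0" using has_gauss_deriv_approx[OF f] by blast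
  obtain U u where U: "\<And>n::nat. trig_deriv (U n) (u n)" "(\<lambda>n. \<integral>x. (u n x - k x)\<^sup>2 \<partial>gauss) \<longlonglongrightarrow> 0"
    "(\<lambda>n. \<integral>x. (U n x - g x)\<^sup>2 \<partial>gauss) \<longlonglongrightarrow> 0" using has_gauss_deriv_approx[OF g] by blast
  have L: "T n \<in> L2 gauss" "t n \<in> L2 gauss" "U n \<in> L2 gauss" "u n \<in> L2 gauss" for n
    using T(1)[of n] U(1)[of n] trig_deriv_trig trig_L2 by blast+
  have fh: "f \<in> L2 gauss" "h \<in> L2 gauss" "g \<in> L2 gauss" "k \<in> L2 gauss"
    using f g by (auto simp: has_gauss_deriv_def)
  have c: "coupling gauss (mehler s')" "coupling gauss (mehler s)" "coupling gauss (mehler_avg s s')"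
    using s by (auto intro: coupling_mehler coupling_mehler_avg)
  have "(\<lambda>n. (\<integral>z. T n (fst z) * U n (snd z) \<partial>mehler s') - (\<integral>z. T n (fst z) * U n (snd z) \<partial>mehler s))
    \<longlonglongrightarrow> (\<integral>z. f (fst z) * g (snd z) \<partial>mehler s') - (\<integral>z. f (fst z) * g (snd z) \<partial>mehler s)"
    by (intro tendsto_diff coupling_form_tendsto[OF c(1) fh(1) L(1) fh(3) L(3)] coupling_form_tendsto[OF c(2) fh(1) L(1) fh(3) L(3)] T U)
  moreover have "(\<lambda>n. (s' - s) * (\<integral>z. t n (fst z) * u n (snd z) \<partial>mehler_avg s s'))
    \<longlonglongrightarrow> (s' - s) * (\<integral>z. h (fst z) * k (snd z) \<partial>mehler_avg s s')"
    by (intro tendsto_mult tendsto_const coupling_form_tendsto[OF c(3) fh(2) L(2) fh(4) L(4)] T U)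
  ultimately show ?thesis
    using mehler_increment_trig[OF T(1) U(1) s] by (simp add: LIMSEQ_unique)
qed

section \<open>Smooth test functions\<close>

definition smooth :: "(real \<Rightarrow> real) \<Rightarrow> bool" where
  "smooth g \<longleftrightarrow> (\<forall>n t. (deriv ^^ n) g differentiable (at t))"

text \<open>Smoothness by coinduction: it is enough to find a class of functions that contains the
  derivatives of its members.\<close>

lemma smooth_coinduct:
  assumes P: "P g" and step: "\<And>g. P g \<Longrightarrow> \<exists>g'. P g' \<and> (\<forall>t. (g has_real_derivative g' t) (at t))"
  shows "smooth g"
proof -
  have "P ((deriv ^^ n) g)" for n
  proof (induction n)
    case 0 then show ?case using P by simp
  next
    case (Suc n)
    then obtain g' where g': "P g'" "\<And>t. ((deriv ^^ n) g has_real_derivative g' t) (at t)" using step by blast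
    then have "deriv ((deriv ^^ n) g) = g'" by (intro ext DERIV_imp_deriv)
    then show ?case using g' by simp
  qed
  then show ?thesis unfolding smooth_def real_differentiable_def using step by blast
qed

lemma smooth_antiderivative:
  assumes "smooth g" and G: "\<And>t. (G has_real_derivative g t) (at t)" shows "smooth G"
  unfolding smooth_def
proof (intro allI)
  fix n t
  have "deriv G = g" by (intro ext DERIV_imp_deriv G)
  then show "(deriv ^^ n) G differentiable (at t)"
    using assms G by (cases n) (auto simp: smooth_def real_differentiable_def funpow_Suc_right simp del: funpow.simps(2))
qed

text \<open>The classical flat functions at \<open>0\<close>. With a polynomial factor in \<open>1 / x\<close> they form a class that is closed
  under differentiation.\<close>

definition flat :: "real poly \<Rightarrow> real \<Rightarrow> real" where
  "flat p x = (if 0 < x then poly p (1 / x) * exp (- (1 / x)) else 0)"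

lemma poly_exp_tendsto_0: "((\<lambda>y. poly p y * exp (- y)) \<longlongrightarrow> (0::real)) at_top"
proof -
  have "((\<lambda>y. \<Sum>i\<le>degree p. coeff p i * (y ^ i / exp y)) \<longlongrightarrow> (\<Sum>i\<le>degree p. coeff p i * 0)) at_top"
    by (intro tendsto_intros tendsto_power_div_exp_0)
  moreover have "poly p y * exp (- y) = (\<Sum>i\<le>degree p. coeff p i * (y ^ i / exp y))" for y
    by (simp add: poly_altdef sum_distrib_right exp_minus divide_inverse mult.assoc)
  ultimately show ?thesis by simp
qed

lemma flat_DERIV: "(flat p has_real_derivative flat ([:0, 0, 1:] * (p - pderiv p)) x) (at x)"
proof -
  consider "x > 0" | "x < 0" | "x = 0" by linarith
  then show ?thesis
  proof cases
    case 1
    have "((\<lambda>x. poly p (1 / x) * exp (- (1 / x))) has_real_derivative poly ([:0, 0, 1:] * (p - pderiv p)) (1 / x) * exp (- (1 / x))) (at x)"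
      using 1 by (auto intro!: derivative_eq_intros poly_DERIV[THEN DERIV_chain2] simp: field_simps power2_eq_square)
    then have "(flat p has_real_derivative poly ([:0, 0, 1:] * (p - pderiv p)) (1 / x) * exp (- (1 / x))) (at x)"
      by (rule has_field_derivative_transform_within_open[where S = "{0<..}"]) (use 1 in \<open>auto simp: flat_def\<close>)
    then show ?thesis using 1 by (simp add: flat_def)
  next
    case 2
    have "((\<lambda>x. 0) has_real_derivative 0) (at x)" by simp
    then have "(flat p has_real_derivative 0) (at x)"
      by (rule has_field_derivative_transform_within_open[where S = "{..<0}"]) (use 2 in \<open>auto simp: flat_def\<close>)
    then show ?thesis using 2 by (simp add: flat_def)
  next
    case 3
    have "((\<lambda>h. flat p h / h) \<longlongrightarrow> 0) (at_right 0)"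
    proof -
      have "((\<lambda>y. poly ([:0, 1:] * p) y * exp (- y)) \<longlongrightarrow> 0) at_top" by (rule poly_exp_tendsto_0)
      then have "((\<lambda>h. poly ([:0, 1:] * p) (inverse h) * exp (- inverse h)) \<longlongrightarrow> 0) (at_right (0::real))"
        by (rule filterlim_compose[OF _ filterlim_inverse_at_top_right])
      then show ?thesis
        by (rule Lim_transform_eventually) (auto simp: flat_def field_simps eventually_at_filter)
    qed
    moreover have "((\<lambda>h. flat p h / h) \<longlongrightarrow> 0) (at_left 0)"
      by (rule Lim_transform_eventually[OF tendsto_const]) (auto simp: flat_def eventually_at_filter)
    ultimately have "((\<lambda>h. flat p h / h) \<longlongrightarrow> 0) (at 0)" by (rule filterlim_split_at[rotated])
    then have "(flat p has_real_derivative 0) (at 0)" by (simp add: DERIV_def flat_def)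
    then show ?thesis using 3 by (simp add: flat_def)
  qed
qed

inductive smooth_class :: "(real \<Rightarrow> real) \<Rightarrow> bool" where
  sc_flat: "smooth_class (flat p)"
| sc_const: "smooth_class (\<lambda>x. c)"
| sc_affine: "smooth_class f \<Longrightarrow> smooth_class (\<lambda>x. f (a * x + b))"
| sc_add: "smooth_class f \<Longrightarrow> smooth_class g \<Longrightarrow> smooth_class (\<lambda>x. f x + g x)"
| sc_mult: "smooth_class f \<Longrightarrow> smooth_class g \<Longrightarrow> smooth_class (\<lambda>x. f x * g x)"
| sc_inverse: "smooth_class f \<Longrightarrow> (\<And>x. f x \<noteq> 0) \<Longrightarrow> smooth_class (\<lambda>x. inverse (f x))"

lemma smooth_class_DERIV:
  "smooth_class f \<Longrightarrow> \<exists>f'. smooth_class f' \<and> (\<forall>t. (f has_real_derivative f' t) (at t))"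
proof (induction rule: smooth_class.induct)
  case (sc_flat p) then show ?case using flat_DERIV smooth_class.sc_flat by blast
next
  case (sc_const c) then show ?case by (intro exI[of _ "\<lambda>x. 0"]) (auto intro: smooth_class.sc_const)
next
  case (sc_affine f a b)
  then obtain f' where f': "smooth_class f'" "\<And>t. (f has_real_derivative f' t) (at t)" by blast
  have "((\<lambda>x. f (a * x + b)) has_real_derivative a * f' (a * t + b)) (at t)" for t
  proof -
    have "((\<lambda>x. a * x + b) has_real_derivative a) (at t)" by (auto intro!: derivative_eq_intros)
    from DERIV_chain2[OF f'(2) this] show ?thesis by (simp add: mult.commute)
  qed
  then show ?case using f' by (intro exI[of _ "\<lambda>t. a * f' (a * t + b)"]) (auto intro: smooth_class.intros)
next
  case (sc_add f g)
  then obtain f' g' where "smooth_class f'" "\<And>t. (f has_real_derivative f' t) (at t)"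
    "smooth_class g'" "\<And>t. (g has_real_derivative g' t) (at t)" by blast
  then show ?case by (intro exI[of _ "\<lambda>t. f' t + g' t"]) (auto intro: smooth_class.intros DERIV_add)
next
  case (sc_mult f g)
  then obtain f' g' where *: "smooth_class f'" "\<And>t. (f has_real_derivative f' t) (at t)"
    "smooth_class g'" "\<And>t. (g has_real_derivative g' t) (at t)" by blast
  then show ?case using sc_mult.hyps
    by (intro exI[of _ "\<lambda>t. f' t * g t + g' t * f t"]) (auto intro: smooth_class.intros DERIV_mult)
next
  case (sc_inverse f)
  then obtain f' where f': "smooth_class f'" "\<And>t. (f has_real_derivative f' t) (at t)" by blast
  have "((\<lambda>x. inverse (f x)) has_real_derivative (- 1) * (inverse (f t) * f' t * inverse (f t))) (at t)" for t
    using DERIV_inverse'[OF f'(2)[of t] sc_inverse.hyps(2)[of t]] sc_inverse.hyps(2) by simp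
  moreover have "smooth_class (\<lambda>t. (- 1) * (inverse (f t) * f' t * inverse (f t)))"
    by (intro smooth_class.intros f' sc_inverse.hyps)
  ultimately show ?case by blast
qed

lemma smooth_class_smooth: "smooth_class f \<Longrightarrow> smooth f"
  by (rule smooth_coinduct[where P = smooth_class]) (auto intro: smooth_class_DERIV)

lemma smooth_class_continuous: "smooth_class f \<Longrightarrow> continuous_on A f"
  using smooth_class_DERIV[of f] by (metis DERIV_isCont continuous_at_imp_continuous_on)

text \<open>A smooth transition from \<open>0\<close> (for \<open>t \<le> 0\<close>) to \<open>1\<close> (for \<open>1 \<le> t\<close>).\<close>

definition step :: "real \<Rightarrow> real" where
  "step t = flat 1 t * inverse (flat 1 t + flat 1 (1 - t))"

lemma flat_1: "0 \<le> flat 1 x" "0 < x \<Longrightarrow> 0 < flat 1 x" "x \<le> 0 \<Longrightarrow> flat 1 x = 0"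
  by (auto simp: flat_def)

lemma step_denom: "0 < flat 1 t + flat 1 (1 - t)"
  using flat_1(1)[of t] flat_1(1)[of "1 - t"] flat_1(2)[of t] flat_1(2)[of "1 - t"] by (cases "t > 0") (auto intro: add_pos_nonneg add_nonneg_pos)

lemma smooth_class_step: "smooth_class step"
proof -
  have "smooth_class (\<lambda>t. flat 1 t * inverse (flat 1 t + flat 1 ((-1) * t + 1)))"
    using step_denom by (intro smooth_class.intros) (auto simp: less_imp_neq[symmetric] order.strict_implies_not_eq)
  then show ?thesis by (simp add: step_def[abs_def])
qed

lemma step_bounds: "0 \<le> step t" "step t \<le> 1" "t \<le> 0 \<Longrightarrow> step t = 0" "1 \<le> t \<Longrightarrow> step t = 1"
proof -
  show "0 \<le> step t" using flat_1(1)[of t] step_denom[of t] by (simp add: step_def)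
  show "step t \<le> 1" using flat_1(1)[of "1 - t"] step_denom[of t] by (simp add: step_def field_simps)
  show "t \<le> 0 \<Longrightarrow> step t = 0" using flat_1(3)[of t] by (simp add: step_def)
  show "1 \<le> t \<Longrightarrow> step t = 1" using flat_1(3)[of "1 - t"] flat_1(2)[of t] by (simp add: step_def)
qed

lemma step_continuous: "continuous_on A step"
  by (rule smooth_class_continuous[OF smooth_class_step])

definition step_int :: "real \<Rightarrow> real" where
  "step_int t = (\<integral>u. indicator {0..t} u *\<^sub>R step u \<partial>lborel)"

lemma step_int_DERIV: "(step_int has_real_derivative step t) (at t)"
proof -
  define a where "a = min 0 t - 1"
  define b where "b = max 0 t + 1"
  have "((\<lambda>x. integral {a..x} step) has_real_derivative step t) (at t within {a..b})"
    by (rule integral_has_real_derivative[OF step_continuous]) (auto simp: a_def b_def)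
  then have "((\<lambda>x. integral {a..x} step) has_real_derivative step t) (at t)"
    by (subst (asm) at_within_Icc_at) (auto simp: a_def b_def)
  then show ?thesis
  proof (rule has_field_derivative_transform_within_open[where S = "{a<..<b}"])
    fix x assume x: "x \<in> {a<..<b}"
    have i: "set_integrable lborel {a..x} step"
      unfolding set_integrable_def by (rule borel_integrable_compact[unfolded real_scaleR_def]) (auto simp: step_continuous)
    have "integral {a..x} step = (\<integral>u. indicator {a..x} u *\<^sub>R step u \<partial>lborel)"
      using set_borel_integral_eq_integral(2)[OF i] by (simp add: set_lebesgue_integral_def)
    also have "\<dots> = step_int x"
      unfolding step_int_def using step_bounds(3)
      by (intro Bochner_Integration.integral_cong) (auto simp: indicator_def a_def)
    finally show "integral {a..x} step = step_int x" .
  qed (auto simp: a_def b_def)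
qed

lemma step_int_neg: "t \<le> 0 \<Longrightarrow> step_int t = 0"
proof -
  assume t: "t \<le> 0"
  have "indicator {0..t} u *\<^sub>R step u = 0" for u using t step_bounds(3)[of u] by (auto simp: indicator_def)
  then show "step_int t = 0" unfolding step_int_def by (simp only: Bochner_Integration.integral_zero)
qed

lemma step_int_diff: assumes "1 \<le> s" "1 \<le> t" shows "step_int t - step_int s = t - s"
proof -
  have "\<exists>c. \<forall>x\<in>{1..}. step_int x - x = c"
  proof (rule has_field_derivative_zero_constant)
    show "((\<lambda>x. step_int x - x) has_real_derivative 0) (at x within {1..})" if "x \<in> {1..}" for x
    proof -
      have "((\<lambda>x. step_int x - x) has_real_derivative step x - 1) (at x)"
        by (intro DERIV_diff step_int_DERIV DERIV_ident)
      then show ?thesis using step_bounds(4)[of x] that by (auto intro: has_field_derivative_at_within)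
    qed
  qed simp
  then obtain c where c: "\<And>x. 1 \<le> x \<Longrightarrow> step_int x - x = c" by auto
  show ?thesis using c[OF assms(1)] c[OF assms(2)] by linarith
qed

text \<open>For large \<open>n\<close> a smooth version of the indicator of the interval \<open>(a, b]\<close>; \<open>bump_int\<close> is its
  primitive. Both terms are written as affine arguments of \<open>step\<close> because the smooth class is closed
  under affine substitutions.\<close>

definition bump :: "real \<Rightarrow> real \<Rightarrow> real \<Rightarrow> real \<Rightarrow> real" where
  "bump n a b t = step (n * t + (- n * a)) + (-1) * step (n * t + (- n * b))"

definition bump_int :: "real \<Rightarrow> real \<Rightarrow> real \<Rightarrow> real \<Rightarrow> real" where
  "bump_int n a b t = (step_int (n * t + (- n * a)) - step_int (n * t + (- n * b))) / n"

text \<open>Test functions in the manner of du Bois-Reymond: the primitive of an approximate indicator minus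
  the multiple of a fixed bump that has the same integral, so that the support is compact.\<close>

definition test :: "nat \<Rightarrow> real \<Rightarrow> real \<Rightarrow> real \<Rightarrow> real" where
  "test n a b t = bump_int (real (Suc n)) a b t - (b - a) * bump_int 1 0 1 t"

definition test' :: "nat \<Rightarrow> real \<Rightarrow> real \<Rightarrow> real \<Rightarrow> real" where
  "test' n a b t = bump (real (Suc n)) a b t + (- (b - a)) * bump 1 0 1 t"

lemma bump_int_DERIV: "0 < n \<Longrightarrow> (bump_int n a b has_real_derivative bump n a b t) (at t)"
  unfolding bump_int_def[abs_def] bump_def
  by (rule derivative_eq_intros step_int_DERIV[THEN DERIV_chain2] refl | simp)+ (simp add: field_simps)

lemma test_DERIV: "(test n a b has_real_derivative test' n a b t) (at t)"
  unfolding test_def[abs_def] test'_def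
  by (rule derivative_eq_intros bump_int_DERIV refl | simp del: of_nat_Suc add: algebra_simps)+

lemma smooth_class_test': "smooth_class (test' n a b)"
  unfolding test'_def[abs_def] bump_def[abs_def] by (intro smooth_class.intros smooth_class_step)

lemma smooth_test: "smooth (test n a b)"
  by (rule smooth_antiderivative[OF smooth_class_smooth[OF smooth_class_test'] test_DERIV])

lemma bump_int_left: assumes "0 < n" "a \<le> b" "t \<le> a" shows "bump_int n a b t = 0" "bump n a b t = 0"
proof -
  have "n * t + (- n * a) \<le> 0" "n * t + (- n * b) \<le> 0"
    using assms mult_left_mono[of t a n] mult_left_mono[of t b n] by auto
  then show "bump_int n a b t = 0" "bump n a b t = 0"
    by (auto simp: bump_int_def bump_def step_int_neg step_bounds)
qed

lemma bump_int_right: assumes "1 \<le> n" "a \<le> b" "b + 1 \<le> t" shows "bump_int n a b t = b - a" "bump n a b t = 0"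
proof -
  have "1 * 1 \<le> n * (t - b)" using assms by (intro mult_mono) auto
  moreover have "n * (t - b) \<le> n * (t - a)" using assms by (intro mult_left_mono) auto
  ultimately have *: "1 \<le> n * t + (- n * a)" "1 \<le> n * t + (- n * b)" by (auto simp: algebra_simps)
  show "bump n a b t = 0" using * by (simp add: bump_def step_bounds(4))
  have "step_int (n * t + (- n * a)) - step_int (n * t + (- n * b)) = n * (b - a)"
    using step_int_diff[OF *(2) *(1)] by (simp add: algebra_simps)
  then show "bump_int n a b t = b - a" using assms by (simp add: bump_int_def)
qed

lemma test_support:
  assumes "a < b" and R: "\<bar>a\<bar> + \<bar>b\<bar> + 2 \<le> R" and t: "R \<le> \<bar>t\<bar>"
  shows "test n a b t = 0" "test' n a b t = 0"
proof -
  consider "t \<le> a \<and> t \<le> 0" | "b + 1 \<le> t \<and> 1 + 1 \<le> t" using assms by linarith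
  then have "test n a b t = 0 \<and> test' n a b t = 0"
    using bump_int_left[of "real (Suc n)" a b t] bump_int_left[of 1 0 1 t] bump_int_right[of "real (Suc n)" a b t] bump_int_right[of 1 0 1 t] assms(1)
    by cases (auto simp: test_def test'_def)
  then show "test n a b t = 0" "test' n a b t = 0" by auto
qed

lemma smooth_compact_support_test:
  assumes "a < b" shows "smooth_compact_support (test n a b)"
proof -
  define R where "R = \<bar>a\<bar> + \<bar>b\<bar> + 2"
  have "{t. test n a b t \<noteq> 0} \<subseteq> {-R..R}"
    using test_support(1)[OF assms, of R] by (auto simp: R_def abs_le_iff not_le) (smt (verit))+
  then have "closure {t. test n a b t \<noteq> 0} \<subseteq> {-R..R}" by (rule closure_minimal) simp
  then have "compact (closure {t. test n a b t \<noteq> 0})"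
    using compact_Int_closed[of "{-R..R}" "closure {t. test n a b t \<noteq> 0}"] by (simp add: Int_absorb1)
  then show ?thesis using smooth_test by (simp add: smooth_compact_support_def smooth_def)
qed


section \<open>From weak derivatives to primitives\<close>

lemma gauss_L2_locally_integrable:
  assumes k: "k \<in> L2 gauss" shows "integrable lborel (\<lambda>u. indicator {-R..R} u * k u)"
proof -
  have [measurable]: "k \<in> borel_measurable borel" using k by (auto simp: L2_def)
  have "integrable lborel (\<lambda>u. indicator {-R..R} u * (indicator {-R..R} u * k u))"
  proof (rule integrable_mult_L2)
    have "(indicator {-R..R} u * k u)\<^sup>2 = indicator {-R..R} u * (k u)\<^sup>2" for u
      by (auto simp: indicator_def)
    then show "integrable lborel (\<lambda>u. (indicator {-R..R} u * k u)\<^sup>2)"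
      using gauss_L2_locally_sq_integrable[OF k, of R] by simp
    have "(indicator {-R..R} u :: real)\<^sup>2 = indicator {-R..R} u" for u
      by (auto simp: indicator_def)
    moreover have "integrable lborel (indicator {-R..R} :: real \<Rightarrow> real)"
      by (rule integrable_real_indicator) (auto simp: emeasure_lborel_Icc_eq)
    ultimately show "integrable lborel (\<lambda>u. (indicator {-R..R} u :: real)\<^sup>2)" by simp
  qed measurable
  then show ?thesis by (simp add: mult.assoc[symmetric] indicator_inter_arith[symmetric])
qed

lemma gauss_L2_integrable_compact_support:
  fixes g :: "real \<Rightarrow> real"
  assumes k: "k \<in> L2 gauss" and [measurable]: "g \<in> borel_measurable borel" and K: "\<And>t. \<bar>g t\<bar> \<le> K"
    and supp: "\<And>t. R \<le> \<bar>t\<bar> \<Longrightarrow> g t = 0"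
  shows "integrable lborel (\<lambda>t. g t * k t)"
proof (rule Bochner_Integration.integrable_bound)
  have [measurable]: "k \<in> borel_measurable borel" using k by (auto simp: L2_def)
  show "integrable lborel (\<lambda>t. K * (indicator {-R..R} t * k t))"
    by (intro integrable_mult_right gauss_L2_locally_integrable k)
  show "(\<lambda>t. g t * k t) \<in> borel_measurable lborel" by measurable
  show "AE t in lborel. norm (g t * k t) \<le> norm (K * (indicator {-R..R} t * k t))"
  proof (rule AE_I2)
    fix t
    show "norm (g t * k t) \<le> norm (K * (indicator {-R..R} t * k t))"
    proof (cases "R \<le> \<bar>t\<bar>")
      case False
      then have "t \<in> {-R..R}" by auto
      then show ?thesis using mult_right_mono[OF order_trans[OF K abs_ge_self], of "\<bar>k t\<bar>" t] by (simp add: abs_mult)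
    qed (simp add: supp)
  qed
qed

text \<open>Fubini's theorem: the integral of \<open>g'\<close> over the half-line beyond \<open>u\<close> is \<open>- g u\<close>.\<close>

lemma integral_by_parts_primitive:
  assumes h: "h \<in> L2 gauss" and g: "\<And>t. (g has_real_derivative g' t) (at t)" and g': "continuous_on UNIV g'"
    and supp: "\<And>t. R \<le> \<bar>t\<bar> \<Longrightarrow> g t = 0" "\<And>t. R \<le> \<bar>t\<bar> \<Longrightarrow> g' t = 0"
  shows "(\<integral>t. g' t * primitive h t \<partial>lborel) = - (\<integral>t. g t * h t \<partial>lborel)"
proof -
  have [measurable]: "h \<in> borel_measurable borel" using h by (auto simp: L2_def)
  have [measurable]: "g' \<in> borel_measurable borel" by (rule borel_measurable_continuous_onI[OF g'])
  have "bounded (g' ` {-R..R})"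
    by (intro compact_imp_bounded compact_continuous_image continuous_on_subset[OF g']) auto
  then obtain K where "\<forall>t\<in>{-R..R}. \<bar>g' t\<bar> \<le> K" unfolding bounded_iff by auto
  then have K: "\<And>t. t \<in> {-R..R} \<Longrightarrow> \<bar>g' t\<bar> \<le> K" by blast
  define H where "H t u = g' t * (ramp t u * h u)" for t u
  have dom: "integrable (lborel \<Otimes>\<^sub>M lborel) (\<lambda>(t, u). (K * indicator {-R..R} t) * (indicator {-R..R} u * h u))"
  proof (rule lborel_pair.Fubini_integrable)
    show "(\<lambda>(t, u). (K * indicator {-R..R} t) * (indicator {-R..R} u * h u)) \<in> borel_measurable (lborel \<Otimes>\<^sub>M lborel)"
      by measurable
    show "AE t in lborel. integrable lborel (\<lambda>u. case (t, u) of (t, u) \<Rightarrow> (K * indicator {-R..R} t) * (indicator {-R..R} u * h u))"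
      using gauss_L2_locally_integrable[OF h, of R] by (intro AE_I2) simp
    have "integrable lborel (\<lambda>t. (indicator {-R..R} t :: real))"
      by (rule integrable_real_indicator) (auto simp: emeasure_lborel_Icc_eq)
    then have "integrable lborel (\<lambda>t. (\<bar>K\<bar> * (\<integral>u. norm (indicator {-R..R} u * h u) \<partial>lborel)) * indicator {-R..R} t)"
      by (rule integrable_mult_right)
    moreover have "(\<lambda>t. \<integral>u. norm (case (t, u) of (t, u) \<Rightarrow> (K * indicator {-R..R} t) * (indicator {-R..R} u * h u)) \<partial>lborel)
      = (\<lambda>t. (\<bar>K\<bar> * (\<integral>u. norm (indicator {-R..R} u * h u) \<partial>lborel)) * indicator {-R..R} t)"
    proof
      fix t
      have "norm (case (t, u) of (t, u) \<Rightarrow> (K * indicator {-R..R} t) * (indicator {-R..R} u * h u))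
        = (\<bar>K\<bar> * indicator {-R..R} t) * norm (indicator {-R..R} u * h u)" for u
        by (simp add: abs_mult)
      then have "(\<integral>u. norm (case (t, u) of (t, u) \<Rightarrow> (K * indicator {-R..R} t) * (indicator {-R..R} u * h u)) \<partial>lborel)
        = (\<bar>K\<bar> * indicator {-R..R} t) * (\<integral>u. norm (indicator {-R..R} u * h u) \<partial>lborel)"
        by (simp only: Bochner_Integration.integral_mult_right_zero)
      then show "(\<integral>u. norm (case (t, u) of (t, u) \<Rightarrow> (K * indicator {-R..R} t) * (indicator {-R..R} u * h u)) \<partial>lborel)
        = (\<bar>K\<bar> * (\<integral>u. norm (indicator {-R..R} u * h u) \<partial>lborel)) * indicator {-R..R} t"
        by simp
    qed
    ultimately show "integrable lborel (\<lambda>t. \<integral>u. norm (case (t, u) of (t, u) \<Rightarrow> (K * indicator {-R..R} t) * (indicator {-R..R} u * h u)) \<partial>lborel)"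
      by (simp only:)
  qed
  have int: "integrable (lborel \<Otimes>\<^sub>M lborel) (\<lambda>(t, u). H t u)"
  proof (rule Bochner_Integration.integrable_bound[OF dom])
    show "(\<lambda>(t, u). H t u) \<in> borel_measurable (lborel \<Otimes>\<^sub>M lborel)" unfolding H_def by measurable
    have "\<bar>H t u\<bar> \<le> \<bar>(K * indicator {-R..R} t) * (indicator {-R..R} u * h u)\<bar>" for t u
    proof (cases "R \<le> \<bar>t\<bar> \<or> ramp t u = 0")
      case True
      then show ?thesis by (auto simp: H_def supp)
    next
      case False
      then have tR: "t \<in> {-R..R}" by auto
      moreover have "u \<in> {-R..R}" using False by (auto simp: ramp_def split: if_splits)
      moreover have "\<bar>ramp t u\<bar> \<le> 1" by (simp add: ramp_def)
      moreover have "0 \<le> K" using K[OF tR] by linarith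
      ultimately have "\<bar>g' t\<bar> * (\<bar>ramp t u\<bar> * \<bar>h u\<bar>) \<le> K * (1 * \<bar>h u\<bar>)"
        by (intro mult_mono K) auto
      then show ?thesis using \<open>t \<in> {-R..R}\<close> \<open>u \<in> {-R..R}\<close> \<open>0 \<le> K\<close> by (simp add: H_def abs_mult)
    qed
    then show "AE z in lborel \<Otimes>\<^sub>M lborel. norm (case z of (t, u) \<Rightarrow> H t u)
      \<le> norm (case z of (t, u) \<Rightarrow> (K * indicator {-R..R} t) * (indicator {-R..R} u * h u))" by auto
  qed
  have inner: "(\<integral>t. g' t * ramp t u \<partial>lborel) = - g u" if "u \<noteq> 0" for u
  proof -
    have FTC: "(\<integral>t. indicator {a..b} t *\<^sub>R g' t \<partial>lborel) = g b - g a" if "a \<le> b" for a b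
      using that g by (intro integral_FTC_atLeastAtMost continuous_on_subset[OF g'])
        (auto simp: has_real_derivative_iff_has_vector_derivative[symmetric] intro: has_field_derivative_at_within)
    (* Beyond S the function g vanishes. *)
  define S where "S = \<bar>R\<bar> + \<bar>u\<bar>"
    have S: "R \<le> \<bar>S\<bar>" "R \<le> \<bar>- S\<bar>" "- S \<le> u" "u \<le> S" by (auto simp: S_def)
    show ?thesis
    proof (cases "u > 0")
      case True
      have "(\<integral>t. g' t * ramp t u \<partial>lborel) = (\<integral>t. indicator {u..S} t *\<^sub>R g' t \<partial>lborel)"
        using True supp(2) by (intro Bochner_Integration.integral_cong) (auto simp: ramp_def indicator_def S_def)
      then show ?thesis using FTC[OF S(4)] supp(1)[OF S(1)] by simp
    next
      case False
      then have "u < 0" using that by simp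
      then have "(\<integral>t. g' t * ramp t u \<partial>lborel) = (\<integral>t. - (indicator {-S..u} t *\<^sub>R g' t) \<partial>lborel)"
        using supp(2) by (intro Bochner_Integration.integral_cong) (auto simp: ramp_def indicator_def S_def)
      then show ?thesis using FTC[OF S(3)] supp(1)[OF S(2)] by simp
    qed
  qed
  have "(\<integral>t. g' t * primitive h t \<partial>lborel) = (\<integral>t. (\<integral>u. H t u \<partial>lborel) \<partial>lborel)"
    by (simp add: primitive_def H_def)
  also have "\<dots> = (\<integral>u. (\<integral>t. H t u \<partial>lborel) \<partial>lborel)"
    using lborel_pair.Fubini_integral[OF int] by simp
  also have "\<dots> = (\<integral>u. - (g u * h u) \<partial>lborel)"
  proof (rule integral_cong_AE)
    have "AE u in lborel. u \<noteq> (0::real)" by (rule AE_lborel_singleton)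
    then show "AE u in lborel. (\<integral>t. H t u \<partial>lborel) = - (g u * h u)"
    proof eventually_elim
      case (elim u)
      have "(\<integral>t. H t u \<partial>lborel) = (\<integral>t. g' t * ramp t u * h u \<partial>lborel)" by (simp add: H_def mult.assoc)
      then show ?case using inner[OF elim] by simp
    qed
    have "continuous_on UNIV g" using g by (auto intro!: continuous_at_imp_continuous_on DERIV_isCont)
    then have [measurable]: "g \<in> borel_measurable borel" by (rule borel_measurable_continuous_onI)
    show "(\<lambda>u. - (g u * h u)) \<in> borel_measurable lborel" by measurable
    show "(\<lambda>u. \<integral>t. H t u \<partial>lborel) \<in> borel_measurable lborel" unfolding H_def by measurable
  qed
  finally show ?thesis by simp
qed

text \<open>On a bounded interval the positive and the negative part are densities of finite measures that
  agree on half-lines, hence everywhere.\<close>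

lemma AE_zero_of_interval_integrals:
  fixes W :: "real \<Rightarrow> real"
  assumes [measurable]: "W \<in> borel_measurable borel" and loc: "\<And>R. integrable lborel (\<lambda>t. indicator {-R..R} t * W t)"
    and zero: "\<And>a b. a < b \<Longrightarrow> (\<integral>t. indicator {a<..b} t * W t \<partial>lborel) = 0"
  shows "AE t in lborel. W t = 0"
proof -
  have R: "AE t in lborel. t \<in> {- real m<..real m} \<longrightarrow> W t = 0" for m :: nat
  proof -
    define P where "P t = ennreal (indicator {- real m<..real m} t * max 0 (W t))" for t
    define N where "N t = ennreal (indicator {- real m<..real m} t * max 0 (- W t))" for t
    have [measurable]: "P \<in> borel_measurable borel" "N \<in> borel_measurable borel" unfolding P_def N_def by measurable
    define I where "I x t = (indicator {max x (- real m)<..real m} t :: real)" for x t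
    have iW: "integrable lborel (\<lambda>t. I x t * W t)" for x
      by (rule Bochner_Integration.integrable_bound[OF loc[of "real m"]]) (auto simp: I_def indicator_def)
    have iP: "integrable lborel (\<lambda>t. I x t * max 0 (W t))" and iN: "integrable lborel (\<lambda>t. I x t * max 0 (- W t))" for x
      by (rule Bochner_Integration.integrable_bound[OF iW[of x]], auto simp: I_def indicator_def)+
    have zero': "(\<integral>t. I x t * W t \<partial>lborel) = 0" for x
    proof (cases "max x (- real m) < real m")
      case True then show ?thesis using zero[OF True] by (simp add: I_def)
    next
      case False then have "I x t = 0" for t by (auto simp: I_def indicator_def)
      then show ?thesis by simp
    qed
    have eqPN: "(\<integral>t. I x t * max 0 (W t) \<partial>lborel) = (\<integral>t. I x t * max 0 (- W t) \<partial>lborel)" for x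
    proof -
      have "(\<integral>t. I x t * max 0 (W t) \<partial>lborel) - (\<integral>t. I x t * max 0 (- W t) \<partial>lborel) = (\<integral>t. I x t * W t \<partial>lborel)"
        unfolding Bochner_Integration.integral_diff[OF iP iN, symmetric]
        by (intro Bochner_Integration.integral_cong) (auto simp: max_def)
      then show ?thesis using zero' by simp
    qed
    have eP: "emeasure (density lborel P) {x<..} = ennreal (\<integral>t. I x t * max 0 (W t) \<partial>lborel)" for x
    proof -
      have "emeasure (density lborel P) {x<..} = (\<integral>\<^sup>+t. ennreal (I x t * max 0 (W t)) \<partial>lborel)"
        by (subst emeasure_density) (auto simp: P_def I_def indicator_def intro!: nn_integral_cong)
      also have "\<dots> = ennreal (\<integral>t. I x t * max 0 (W t) \<partial>lborel)"
        by (rule nn_integral_eq_integral[OF iP]) (auto simp: I_def)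
      finally show ?thesis .
    qed
    have eN: "emeasure (density lborel N) {x<..} = ennreal (\<integral>t. I x t * max 0 (- W t) \<partial>lborel)" for x
    proof -
      have "emeasure (density lborel N) {x<..} = (\<integral>\<^sup>+t. ennreal (I x t * max 0 (- W t)) \<partial>lborel)"
        by (subst emeasure_density) (auto simp: N_def I_def indicator_def intro!: nn_integral_cong)
      also have "\<dots> = ennreal (\<integral>t. I x t * max 0 (- W t) \<partial>lborel)"
        by (rule nn_integral_eq_integral[OF iN]) (auto simp: I_def)
      finally show ?thesis .
    qed
    have "density lborel P = density lborel N"
      by (rule measure_eqI_lessThan) (auto simp: eP eN eqPN)
    then have "AE t in lborel. P t = N t"
      by (subst (asm) sigma_finite_measure.density_unique_iff[OF sigma_finite_lborel]) auto
    then show ?thesis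
      by eventually_elim (auto simp: P_def N_def max_def split: if_splits)
  qed
  have "AE t in lborel. \<forall>m. t \<in> {- real m<..real m} \<longrightarrow> W t = 0"
    unfolding AE_all_countable using R by blast
  then show ?thesis
  proof eventually_elim
    case (elim t)
    obtain m where "\<bar>t\<bar> < real m" using reals_Archimedean2 by blast
    then show ?case using elim[rule_format, of m] by (simp add: abs_less_iff)
  qed
qed

lemma bump_bounds: assumes "0 < n" "a \<le> b" shows "\<bar>bump n a b t\<bar> \<le> 1"
  using step_bounds(1,2)[of "n * t + (- n * a)"] step_bounds(1,2)[of "n * t + (- n * b)"] unfolding bump_def by linarith

lemma bump_tendsto: "(\<lambda>n. bump (real (Suc n)) a b t) \<longlonglongrightarrow> (indicator {a<..} t - indicator {b<..} t)"
proof -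
  have s: "(\<lambda>n. step (real (Suc n) * t + (- real (Suc n) * a))) \<longlonglongrightarrow> indicator {a<..} t" for a
  proof (cases "a < t")
    case True
    obtain m where m: "1 / (t - a) < real m" using reals_Archimedean2 by blast
    have "1 \<le> real (Suc n) * t + (- real (Suc n) * a)" if "n \<ge> m" for n
    proof -
      have "1 / (t - a) \<le> real (Suc n)" using m that by linarith
      then have "1 \<le> real (Suc n) * (t - a)" using True by (simp add: pos_divide_le_eq)
      then show ?thesis by (simp add: algebra_simps)
    qed
    then have "\<forall>\<^sub>F n in sequentially. step (real (Suc n) * t + (- real (Suc n) * a)) = indicator {a<..} t"
      using True step_bounds(4) by (auto simp: eventually_sequentially simp del: of_nat_Suc intro!: exI[of _ m])
    then show ?thesis by (rule tendsto_eventually)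
  next
    case False
    have "real (Suc n) * t + (- real (Suc n) * a) \<le> 0" for n
      using False mult_left_mono[of t a "real (Suc n)"] by (simp del: of_nat_Suc)
    then show ?thesis using False step_bounds(3) by (simp del: of_nat_Suc)
  qed
  show ?thesis unfolding bump_def using tendsto_diff[OF s[of a] s[of b]] by simp
qed

text \<open>Du Bois-Reymond's lemma for a countable set of test functions. The difference \<open>F\<close> of \<open>f\<close> and
  the primitive of \<open>h\<close> is orthogonal to the derivatives of the test functions, so its mean over every
  rational interval is the constant \<open>C\<close>. Dominated convergence extends this to real endpoints.\<close>

theorem weak_derivative_has_gauss_deriv:
  assumes f: "f \<in> L2 gauss" and h: "h \<in> L2 gauss"
    and weak: "\<And>n a b. a \<in> \<rat> \<Longrightarrow> b \<in> \<rat> \<Longrightarrow> a < b \<Longrightarrow>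
      - (\<integral>t. deriv (test n a b) t * f t \<partial>lborel) = (\<integral>t. test n a b t * h t \<partial>lborel)"
  shows "has_gauss_deriv f h"
proof -
  define F where "F t = f t - primitive h t" for t
  have F: "F \<in> L2 gauss" unfolding F_def by (intro L2_diff f primitive_L2 h)
  have [measurable]: "F \<in> borel_measurable borel" using F by (auto simp: L2_def)
  have mb: "(\<lambda>t. bump n a b t) \<in> borel_measurable borel" for n a b
    unfolding bump_def
    by (rule borel_measurable_continuous_onI, rule smooth_class_continuous, intro smooth_class.intros smooth_class_step)
  have deriv: "deriv (test n a b) = test' n a b" for n a b by (intro ext DERIV_imp_deriv test_DERIV)
  have test0: "(\<integral>t. test' n a b t * F t \<partial>lborel) = 0" if ab: "a \<in> \<rat>" "b \<in> \<rat>" "a < b" for n a b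
  proof -
    define R where "R = \<bar>a\<bar> + \<bar>b\<bar> + 2"
    have c: "continuous_on UNIV (test' n a b)" by (rule smooth_class_continuous[OF smooth_class_test'])
    have m: "test' n a b \<in> borel_measurable borel" by (rule borel_measurable_continuous_onI[OF c])
    have bd: "\<bar>test' n a b t\<bar> \<le> 1 + (b - a) * 1" for t
    proof -
      have "\<bar>test' n a b t\<bar> \<le> \<bar>bump (real (Suc n)) a b t\<bar> + (b - a) * \<bar>bump 1 0 1 t\<bar>"
        unfolding test'_def using ab by (intro order_trans[OF abs_triangle_ineq]) (simp add: abs_mult)
      also have "\<dots> \<le> 1 + (b - a) * 1" using ab by (intro add_mono mult_left_mono bump_bounds) auto
      finally show ?thesis .
    qed
    have i: "integrable lborel (\<lambda>t. test' n a b t * k t)" if "k \<in> L2 gauss" for k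
      by (rule gauss_L2_integrable_compact_support[OF that m bd test_support(2)[OF ab(3), of R]]) (simp add: R_def)
    have "(\<integral>t. test' n a b t * F t \<partial>lborel) = (\<integral>t. test' n a b t * f t \<partial>lborel) - (\<integral>t. test' n a b t * primitive h t \<partial>lborel)"
      unfolding F_def right_diff_distrib by (intro Bochner_Integration.integral_diff i f primitive_L2 h)
    also have "(\<integral>t. test' n a b t * primitive h t \<partial>lborel) = - (\<integral>t. test n a b t * h t \<partial>lborel)"
      by (rule integral_by_parts_primitive[OF h test_DERIV c test_support[OF ab(3), of R]]) (auto simp: R_def)
    finally show ?thesis using weak[OF ab, of n] by (simp add: deriv)
  qed
  define C where "C = (\<integral>t. bump 1 0 1 t * F t \<partial>lborel)"
  have ib: "integrable lborel (\<lambda>t. bump (real (Suc n)) a b t * F t)" if "a < b" for n a b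
  proof (rule gauss_L2_integrable_compact_support[OF F mb bump_bounds])
    show "bump (real (Suc n)) a b t = 0" if t: "\<bar>a\<bar> + \<bar>b\<bar> + 2 \<le> \<bar>t\<bar>" for t
    proof -
      consider "t \<le> a" | "b + 1 \<le> t" using \<open>a < b\<close> t by linarith
      then show ?thesis using \<open>a < b\<close> bump_int_left(2)[of "real (Suc n)" a b t] bump_int_right(2)[of "real (Suc n)" a b t] by cases auto
    qed
  qed (use that in auto)
  have bumpF: "(\<integral>t. bump (real (Suc n)) a b t * F t \<partial>lborel) = (b - a) * C" if ab: "a \<in> \<rat>" "b \<in> \<rat>" "a < b" for n a b
  proof -
    have "(\<integral>t. test' n a b t * F t \<partial>lborel) = (\<integral>t. bump (real (Suc n)) a b t * F t - (b - a) * (bump 1 0 1 t * F t) \<partial>lborel)"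
      by (intro Bochner_Integration.integral_cong) (auto simp: test'_def algebra_simps)
    also have "\<dots> = (\<integral>t. bump (real (Suc n)) a b t * F t \<partial>lborel) - (b - a) * C"
      unfolding C_def using ib[OF ab(3), of n] ib[of 0 1 0] by simp
    finally show ?thesis using test0[OF ab, of n] by simp
  qed
  have indF: "(\<integral>t. indicator {a<..b} t * F t \<partial>lborel) = (b - a) * C" if ab: "a \<in> \<rat>" "b \<in> \<rat>" "a < b" for a b
  proof -
    define R where "R = \<bar>a\<bar> + \<bar>b\<bar> + 2"
    have "(\<lambda>n. \<integral>t. bump (real (Suc n)) a b t * F t \<partial>lborel) \<longlonglongrightarrow> (\<integral>t. indicator {a<..b} t * F t \<partial>lborel)"
    proof (rule integral_dominated_convergence)
      show "integrable lborel (\<lambda>t. \<bar>indicator {-R..R} t * F t\<bar>)"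
        by (intro integrable_abs gauss_L2_locally_integrable F)
      show "(\<lambda>t. bump (real (Suc n)) a b t * F t) \<in> borel_measurable lborel" for n using ib[OF ab(3)] by blast
      show "AE t in lborel. (\<lambda>n. bump (real (Suc n)) a b t * F t) \<longlonglongrightarrow> indicator {a<..b} t * F t"
      proof (intro AE_I2 tendsto_mult tendsto_const)
        fix t
        have "(indicator {a<..b} t :: real) = indicator {a<..} t - indicator {b<..} t"
          using ab by (auto simp: indicator_def)
        then show "(\<lambda>n. bump (real (Suc n)) a b t) \<longlonglongrightarrow> indicator {a<..b} t" using bump_tendsto[of a b t] by simp
      qed
      show "AE t in lborel. norm (bump (real (Suc n)) a b t * F t) \<le> \<bar>indicator {-R..R} t * F t\<bar>" for n
      proof (rule AE_I2)
        fix t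
        show "norm (bump (real (Suc n)) a b t * F t) \<le> \<bar>indicator {-R..R} t * F t\<bar>"
        proof (cases "t \<le> a \<or> b + 1 \<le> t")
          case True
          then have "bump (real (Suc n)) a b t = 0"
            using ab bump_int_left(2)[of "real (Suc n)" a b t] bump_int_right(2)[of "real (Suc n)" a b t] by auto
          then show ?thesis by simp
        next
          case False
          then have "t \<in> {-R..R}" by (auto simp: R_def)
          then show ?thesis using mult_right_mono[OF bump_bounds[of "real (Suc n)" a b t], of "\<bar>F t\<bar>"] ab by (simp add: abs_mult)
        qed
      qed
    qed measurable
    moreover have "(\<lambda>n. \<integral>t. bump (real (Suc n)) a b t * F t \<partial>lborel) \<longlonglongrightarrow> (b - a) * C" using bumpF[OF ab] by simp
    ultimately show ?thesis by (rule LIMSEQ_unique)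
  qed
  have indF_real: "(\<integral>t. indicator {a<..b} t * F t \<partial>lborel) = (b - a) * C" if ab: "a < b" for a b
  proof -
    have "\<forall>n. \<exists>q\<in>\<rat>. a < q \<and> q < a + (b - a) / real (Suc n)"
      using ab by (intro allI Rats_dense_in_real) simp
    then obtain A where A: "\<And>n. A n \<in> \<rat>" "\<And>n. a < A n" "\<And>n. A n < a + (b - a) / real (Suc n)" by metis
    have "\<forall>n. \<exists>q\<in>\<rat>. b < q \<and> q < b + 1 / real (Suc n)"
      by (intro allI Rats_dense_in_real) simp
    then obtain B where B: "\<And>n. B n \<in> \<rat>" "\<And>n. b < B n" "\<And>n. B n < b + 1 / real (Suc n)" by metis
    have AB: "A n < B n" for n
    proof -
      have "(b - a) / real (Suc n) \<le> (b - a) / 1" using ab by (intro divide_left_mono) auto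
      then show ?thesis using A(3)[of n] B(2)[of n] by simp
    qed
    have limA: "A \<longlonglongrightarrow> a"
    proof (rule tendsto_sandwich[OF _ _ tendsto_const])
      show "(\<lambda>n. a + (b - a) / real (Suc n)) \<longlonglongrightarrow> a"
        using tendsto_add[OF tendsto_const lim_const_over_n[THEN LIMSEQ_Suc], of a "b - a"] by simp
    qed (use A in \<open>auto intro!: always_eventually less_imp_le simp del: of_nat_Suc\<close>)
    have limB: "B \<longlonglongrightarrow> b"
    proof (rule tendsto_sandwich[OF _ _ tendsto_const])
      show "(\<lambda>n. b + 1 / real (Suc n)) \<longlonglongrightarrow> b"
        using tendsto_add[OF tendsto_const lim_const_over_n[THEN LIMSEQ_Suc], of b "1"] by simp
    qed (use B in \<open>auto intro!: always_eventually less_imp_le simp del: of_nat_Suc\<close>)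
    define R where "R = \<bar>a\<bar> + \<bar>b\<bar> + 1"
    have "(\<lambda>n. \<integral>t. indicator {A n<..B n} t * F t \<partial>lborel) \<longlonglongrightarrow> (\<integral>t. indicator {a<..b} t * F t \<partial>lborel)"
    proof (rule integral_dominated_convergence)
      show "integrable lborel (\<lambda>t. \<bar>indicator {-R..R} t * F t\<bar>)"
        by (intro integrable_abs gauss_L2_locally_integrable F)
      show "AE t in lborel. (\<lambda>n. indicator {A n<..B n} t * F t) \<longlonglongrightarrow> indicator {a<..b} t * F t"
      proof (intro AE_I2 tendsto_mult tendsto_const)
        fix t
        show "(\<lambda>n. indicator {A n<..B n} t) \<longlonglongrightarrow> (indicator {a<..b} t :: real)"
        proof (rule tendsto_eventually)
          consider "t \<le> a" | "a < t" "t \<le> b" | "b < t" by linarith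
          then show "\<forall>\<^sub>F n in sequentially. indicator {A n<..B n} t = (indicator {a<..b} t :: real)"
          proof cases
            case 1
            then have "\<not> A n < t" for n using A(2)[of n] by simp
            then show ?thesis using 1 by simp
          next
            case 2
            have "\<forall>\<^sub>F n in sequentially. A n < t" using order_tendstoD(2)[OF limA 2(1)] .
            then show ?thesis
            proof eventually_elim
              case (elim n)
              then show ?case using 2 B(2)[of n] by simp
            qed
          next
            case 3
            have "\<forall>\<^sub>F n in sequentially. B n < t" using order_tendstoD(2)[OF limB 3] .
            then show ?thesis by eventually_elim (use 3 in simp)
          qed
        qed
      qed
      show "AE t in lborel. norm (indicator {A n<..B n} t * F t) \<le> \<bar>indicator {-R..R} t * F t\<bar>" for n
      proof -
        have "1 / real (Suc n) \<le> 1" by simp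
        then have "- R \<le> t \<and> t \<le> R" if "A n < t" "t \<le> B n" for t
          using A(2)[of n] B(3)[of n] that unfolding R_def by linarith
        then show ?thesis by (intro AE_I2) (auto simp: indicator_def)
      qed
    qed measurable
    moreover have "(\<lambda>n. \<integral>t. indicator {A n<..B n} t * F t \<partial>lborel) \<longlonglongrightarrow> (b - a) * C"
      using tendsto_mult[OF tendsto_diff[OF limB limA] tendsto_const[of C]] indF[OF A(1) B(1) AB] by simp
    ultimately show ?thesis by (rule LIMSEQ_unique)
  qed
  have "AE t in lborel. F t - C = 0"
  proof (rule AE_zero_of_interval_integrals)
    have ic: "integrable lborel (\<lambda>t. indicator A t * C)" if "emeasure lborel A < \<infinity>" "A \<in> sets borel" for A :: "real set"
      using that by (intro integrable_mult_left integrable_real_indicator) auto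
    show "integrable lborel (\<lambda>t. indicator {-R..R} t * (F t - C))" for R
      unfolding right_diff_distrib
      by (intro Bochner_Integration.integrable_diff gauss_L2_locally_integrable F ic) (auto simp: emeasure_lborel_Icc_eq)
    show "(\<integral>t. indicator {a<..b} t * (F t - C) \<partial>lborel) = 0" if "a < b" for a b
    proof -
      define R where "R = \<bar>a\<bar> + \<bar>b\<bar>"
      have "integrable lborel (\<lambda>t. indicator {a<..b} t * F t)"
        by (rule Bochner_Integration.integrable_bound[OF gauss_L2_locally_integrable[OF F, of R]])
          (auto simp: R_def indicator_def)
      then have "(\<integral>t. indicator {a<..b} t * (F t - C) \<partial>lborel) = (b - a) * C - (\<integral>t. indicator {a<..b} t * C \<partial>lborel)"
        unfolding right_diff_distrib using that
        by (subst Bochner_Integration.integral_diff[OF _ ic]) (auto simp: indF_real)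
      then show ?thesis using that by simp
    qed
  qed measurable
  then have "AE t in lborel. f t = C + primitive h t" by eventually_elim (simp add: F_def)
  then show ?thesis using f h by (auto simp: has_gauss_deriv_def)
qed

section \<open>Couplings that become diagonal\<close>

text \<open>The squared \<open>L\<^sup>2\<close> distance between the values of \<open>f\<close> at the two coupled points.\<close>

definition mismatch :: "('i \<Rightarrow> (real \<times> real) measure) \<Rightarrow> (('i \<Rightarrow> real) \<Rightarrow> real) \<Rightarrow> real" where
  "mismatch c f = (\<integral>w. (f (\<lambda>i. fst (w i)) - f (\<lambda>i. snd (w i)))\<^sup>2 \<partial>PiM UNIV c)"

lemma PiM_coupling_L2:
  assumes c: "\<And>i. coupling (M i) (c i)" and f: "f \<in> L2 (PiM UNIV M)"
  shows "(\<lambda>w. f (\<lambda>i. fst (w i))) \<in> L2 (PiM UNIV c)" "(\<lambda>w. f (\<lambda>i. snd (w i))) \<in> L2 (PiM UNIV c)"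
    "(\<integral>w. (f (\<lambda>i. fst (w i)))\<^sup>2 \<partial>PiM UNIV c) = (\<integral>x. (f x)\<^sup>2 \<partial>PiM UNIV M)"
    "(\<integral>w. (f (\<lambda>i. snd (w i)))\<^sup>2 \<partial>PiM UNIV c) = (\<integral>x. (f x)\<^sup>2 \<partial>PiM UNIV M)"
proof -
  have [measurable]: "f \<in> borel_measurable (PiM UNIV M)" and i: "integrable (PiM UNIV M) (\<lambda>x. (f x)\<^sup>2)"
    using f by (auto simp: L2_def)
  note X = measurable_PiM_fst[OF c] and Y = measurable_PiM_snd[OF c]
  have m: "(\<lambda>w. f (\<lambda>i. fst (w i))) \<in> borel_measurable (PiM UNIV c)" "(\<lambda>w. f (\<lambda>i. snd (w i))) \<in> borel_measurable (PiM UNIV c)"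
    by (rule measurable_compose[OF X] measurable_compose[OF Y], measurable)+
  have "integrable (PiM UNIV c) (\<lambda>w. (f (\<lambda>i. fst (w i)))\<^sup>2)"
    using integrable_distr_eq[OF X, of "\<lambda>x. (f x)\<^sup>2"] i unfolding distr_PiM_fst[OF c] by simp
  moreover have "integrable (PiM UNIV c) (\<lambda>w. (f (\<lambda>i. snd (w i)))\<^sup>2)"
    using integrable_distr_eq[OF Y, of "\<lambda>x. (f x)\<^sup>2"] i unfolding distr_PiM_snd[OF c] by simp
  ultimately show "(\<lambda>w. f (\<lambda>i. fst (w i))) \<in> L2 (PiM UNIV c)" "(\<lambda>w. f (\<lambda>i. snd (w i))) \<in> L2 (PiM UNIV c)"
    using m by (auto simp: L2_def)
  show "(\<integral>w. (f (\<lambda>i. fst (w i)))\<^sup>2 \<partial>PiM UNIV c) = (\<integral>x. (f x)\<^sup>2 \<partial>PiM UNIV M)"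
    using integral_distr[OF X, of "\<lambda>x. (f x)\<^sup>2"] unfolding distr_PiM_fst[OF c] by simp
  show "(\<integral>w. (f (\<lambda>i. snd (w i)))\<^sup>2 \<partial>PiM UNIV c) = (\<integral>x. (f x)\<^sup>2 \<partial>PiM UNIV M)"
    using integral_distr[OF Y, of "\<lambda>x. (f x)\<^sup>2"] unfolding distr_PiM_snd[OF c] by simp
qed

lemma coupled_form_le_L2:
  assumes c: "\<And>i. coupling (M i) (c i)" and f: "f \<in> L2 (PiM UNIV M)"
  shows "coupled_form c f f \<le> (\<integral>x. (f x)\<^sup>2 \<partial>PiM UNIV M)"
  using Cauchy_Schwarz_L2[OF PiM_coupling_L2(1,2)[OF c f]]
  unfolding PiM_coupling_L2(3,4)[OF c f] coupled_form_def
  by (simp add: Bochner_Integration.integral_nonneg)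

lemma mismatch_coupled_form:
  assumes c: "\<And>i. coupling (M i) (c i)" and f: "f \<in> L2 (PiM UNIV M)"
  shows "coupled_form c f f = (\<integral>x. (f x)\<^sup>2 \<partial>PiM UNIV M) - mismatch c f / 2"
proof -
  note P = PiM_coupling_L2[OF c f]
  have i: "integrable (PiM UNIV c) (\<lambda>w. (f (\<lambda>i. fst (w i)))\<^sup>2)" "integrable (PiM UNIV c) (\<lambda>w. (f (\<lambda>i. snd (w i)))\<^sup>2)"
    "integrable (PiM UNIV c) (\<lambda>w. f (\<lambda>i. fst (w i)) * f (\<lambda>i. snd (w i)))"
    using P(1,2) coupled_form_integrable[OF c f f] by (auto simp: L2_def)
  have "mismatch c f = (\<integral>w. (f (\<lambda>i. fst (w i)))\<^sup>2 + (f (\<lambda>i. snd (w i)))\<^sup>2 - 2 * (f (\<lambda>i. fst (w i)) * f (\<lambda>i. snd (w i))) \<partial>PiM UNIV c)"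
    unfolding mismatch_def by (intro Bochner_Integration.integral_cong) (auto simp: power2_eq_square algebra_simps)
  also have "\<dots> = (\<integral>x. (f x)\<^sup>2 \<partial>PiM UNIV M) + (\<integral>x. (f x)\<^sup>2 \<partial>PiM UNIV M) - 2 * coupled_form c f f"
    using i by (simp add: P coupled_form_def)
  finally show ?thesis by linarith
qed

lemma mismatch_nonneg: "0 \<le> mismatch c f"
  unfolding mismatch_def by (rule Bochner_Integration.integral_nonneg) auto

lemma mismatch_le:
  assumes c: "\<And>i. coupling (M i) (c i)" and f: "f \<in> L2 (PiM UNIV M)"
  shows "mismatch c f \<le> 4 * (\<integral>x. (f x)\<^sup>2 \<partial>PiM UNIV M)"
proof -
  have "coupled_form c (\<lambda>x. - f x) f \<le> (\<integral>x. (f x)\<^sup>2 \<partial>PiM UNIV M)"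
    using Cauchy_Schwarz_L2[OF PiM_coupling_L2(1,2)[OF c f]]
    unfolding PiM_coupling_L2(3,4)[OF c f] coupled_form_def
    by (simp add: Bochner_Integration.integral_nonneg)
  then have "- coupled_form c f f \<le> (\<integral>x. (f x)\<^sup>2 \<partial>PiM UNIV M)" by (simp add: coupled_form_def)
  then show ?thesis using mismatch_coupled_form[OF c f] by simp
qed

lemma mismatch_add:
  assumes c: "\<And>i. coupling (M i) (c i)" and f: "f \<in> L2 (PiM UNIV M)" and g: "g \<in> L2 (PiM UNIV M)"
  shows "mismatch c (\<lambda>x. f x + g x) \<le> 2 * mismatch c f + 2 * mismatch c g"
proof -
  have i: "integrable (PiM UNIV c) (\<lambda>w. (f (\<lambda>i. fst (w i)) - f (\<lambda>i. snd (w i)))\<^sup>2)" if "f \<in> L2 (PiM UNIV M)" for f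
    using L2_diff[OF PiM_coupling_L2(1,2)[OF c that]] by (simp add: L2_def)
  have "(a + b - (a' + b'))\<^sup>2 \<le> 2 * (a - a')\<^sup>2 + 2 * (b - b')\<^sup>2" for a b a' b' :: real
  proof -
    have "2 * (a - a')\<^sup>2 + 2 * (b - b')\<^sup>2 - (a + b - (a' + b'))\<^sup>2 = ((a - a') - (b - b'))\<^sup>2"
      by (simp add: power2_eq_square algebra_simps)
    then show ?thesis by (metis diff_ge_0_iff_ge zero_le_power2)
  qed
  then have "mismatch c (\<lambda>x. f x + g x) \<le> (\<integral>w. 2 * (f (\<lambda>i. fst (w i)) - f (\<lambda>i. snd (w i)))\<^sup>2 + 2 * (g (\<lambda>i. fst (w i)) - g (\<lambda>i. snd (w i)))\<^sup>2 \<partial>PiM UNIV c)"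
    unfolding mismatch_def
    by (intro integral_mono i[OF L2_add[OF f g]] Bochner_Integration.integrable_add integrable_mult_right i f g)
  also have "\<dots> = 2 * mismatch c f + 2 * mismatch c g"
    unfolding mismatch_def using i[OF f] i[OF g] by simp
  finally show ?thesis .
qed

context
  fixes M :: "nat \<Rightarrow> real measure" and c :: "nat \<Rightarrow> nat \<Rightarrow> (real \<times> real) measure"
  assumes c: "\<And>m i. coupling (M i) (c m i)" and diag: "\<And>m i. i < m \<Longrightarrow> AE z in c m i. fst z = snd z"
begin

text \<open>Here the first \<open>m\<close> coordinates of the two points agree almost surely under \<open>c m\<close>, and nothing
  is known about the others.\<close>

definition matched :: "((nat \<Rightarrow> real) \<Rightarrow> real) \<Rightarrow> bool" where
  "matched f \<longleftrightarrow> f \<in> L2 (PiM UNIV M) \<and> (\<lambda>m. mismatch (c m) f) \<longlonglongrightarrow> 0"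

lemma matched_add: assumes "matched f" "matched g" shows "matched (\<lambda>x. f x + g x)"
proof -
  have f: "f \<in> L2 (PiM UNIV M)" "(\<lambda>m. mismatch (c m) f) \<longlonglongrightarrow> 0" and g: "g \<in> L2 (PiM UNIV M)" "(\<lambda>m. mismatch (c m) g) \<longlonglongrightarrow> 0"
    using assms by (auto simp: matched_def)
  have lim: "(\<lambda>m. 2 * mismatch (c m) f + 2 * mismatch (c m) g) \<longlonglongrightarrow> 0"
    using tendsto_add[OF tendsto_mult[OF tendsto_const[of 2] f(2)] tendsto_mult[OF tendsto_const[of 2] g(2)]] by simp
  have "(\<lambda>m. mismatch (c m) (\<lambda>x. f x + g x)) \<longlonglongrightarrow> 0"
    by (rule tendsto_sandwich[OF _ _ tendsto_const lim])
      (auto intro!: always_eventually mismatch_nonneg mismatch_add[OF _ f(1) g(1)] c)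
  then show ?thesis using L2_add[OF f(1) g(1)] by (simp add: matched_def)
qed

lemma matched_cmult: assumes "matched f" shows "matched (\<lambda>x. a * f x)"
proof -
  have "mismatch (c m) (\<lambda>x. a * f x) = a\<^sup>2 * mismatch (c m) f" for m
    unfolding mismatch_def by (simp add: right_diff_distrib[symmetric] power_mult_distrib)
  then show ?thesis using assms tendsto_mult[OF tendsto_const[of "a\<^sup>2"], of "\<lambda>m. mismatch (c m) f" 0 sequentially]
    by (simp add: matched_def L2_cmult)
qed

lemma matched_limit:
  assumes f: "f \<in> L2 (PiM UNIV M)" and F: "\<And>k::nat. matched (F k)"
    and lim: "(\<lambda>k. \<integral>x. (F k x - f x)\<^sup>2 \<partial>PiM UNIV M) \<longlonglongrightarrow> 0"
  shows "matched f"
proof -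
  have "(\<lambda>m. mismatch (c m) f) \<longlonglongrightarrow> 0"
  proof (rule LIMSEQ_I)
    fix r :: real assume r: "0 < r"
    have "\<forall>\<^sub>F k in sequentially. (\<integral>x. (F k x - f x)\<^sup>2 \<partial>PiM UNIV M) < r / 16"
      using order_tendstoD(2)[OF lim, of "r / 16"] r by simp
    then obtain k where k: "(\<integral>x. (F k x - f x)\<^sup>2 \<partial>PiM UNIV M) < r / 16"
      using eventually_sequentially by auto
    have Fk: "F k \<in> L2 (PiM UNIV M)" "(\<lambda>m. mismatch (c m) (F k)) \<longlonglongrightarrow> 0" using F[of k] by (auto simp: matched_def)
    have d: "(\<lambda>x. f x - F k x) \<in> L2 (PiM UNIV M)" by (intro L2_diff f Fk)
    have le: "mismatch (c m) f \<le> 8 * (\<integral>x. (F k x - f x)\<^sup>2 \<partial>PiM UNIV M) + 2 * mismatch (c m) (F k)" for m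
    proof -
      have "mismatch (c m) (\<lambda>x. (f x - F k x) + F k x) \<le> 2 * mismatch (c m) (\<lambda>x. f x - F k x) + 2 * mismatch (c m) (F k)"
        by (rule mismatch_add[OF _ d Fk(1)]) (rule c)
      moreover have "mismatch (c m) (\<lambda>x. f x - F k x) \<le> 4 * (\<integral>x. (f x - F k x)\<^sup>2 \<partial>PiM UNIV M)"
        by (rule mismatch_le[OF _ d]) (rule c)
      ultimately show ?thesis by (simp add: power2_commute)
    qed
    have "\<forall>\<^sub>F m in sequentially. mismatch (c m) (F k) < r / 4"
      using order_tendstoD(2)[OF Fk(2), of "r / 4"] r by simp
    then obtain N where N: "\<And>m. m \<ge> N \<Longrightarrow> mismatch (c m) (F k) < r / 4"
      by (auto simp: eventually_sequentially)
    have "norm (mismatch (c m) f - 0) < r" if "m \<ge> N" for m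
      using le[of m] N[OF that] k mismatch_nonneg[of "c m" f] by simp
    then show "\<exists>N. \<forall>m\<ge>N. norm (mismatch (c m) f - 0) < r" by blast
  qed
  then show ?thesis using f by (simp add: matched_def)
qed

lemma prob_M: "prob_space (M i)" by (rule coupling_marginal_prob_space[OF c])

text \<open>The indicator of a cylinder has mismatch \<open>0\<close> as soon as \<open>m\<close> exceeds its coordinates. The sets
  with matched indicator form a Dynkin system.\<close>

lemma matched_indicator:
  assumes "A \<in> sets (PiM UNIV M)" shows "matched (indicator A)"
proof -
  interpret P: prob_space "PiM UNIV M" by (intro prob_space_PiM prob_M)
  have ind: "indicator A \<in> L2 (PiM UNIV M)" if "A \<in> sets (PiM UNIV M)" for A
    using that by (intro P.bounded_L2[where K = 1]) (auto simp: indicator_def)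
  have "A \<in> sigma_sets (\<Pi>\<^sub>E i\<in>UNIV. space (M i)) (prod_algebra UNIV M)" using assms by (simp add: sets_PiM)
  with Int_stable_prod_algebra[of UNIV M] prod_algebra_sets_into_space[of UNIV M] show ?thesis
  proof (induction rule: sigma_sets_induct_disjoint)
    case (basic A)
    then obtain J E where A: "A = prod_emb UNIV M J (\<Pi>\<^sub>E j\<in>J. E j)" and J: "finite J" "\<And>j. j \<in> J \<Longrightarrow> E j \<in> sets (M j)"
      by (force elim!: prod_algebraE)
    have As: "A \<in> sets (PiM UNIV M)" unfolding A using J by (intro sets_PiM_I) auto
    obtain N where N: "\<And>j. j \<in> J \<Longrightarrow> j < N" using J(1) by (metis finite_nat_set_iff_bounded)
    have "mismatch (c m) (indicator A) = 0" if m: "m \<ge> N" for m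
    proof -
      have "AE w in PiM UNIV (c m). \<forall>j\<in>J. fst (w j) = snd (w j)"
      proof (rule AE_finite_allI[OF J(1)])
        fix j assume "j \<in> J"
        then have "AE z in c m j. fst z = snd z" using N m by (intro diag) force
        then show "AE w in PiM UNIV (c m). fst (w j) = snd (w j)"
          by (intro AE_PiM_component coupling_prob_space[OF c]) auto
      qed
      then have "AE w in PiM UNIV (c m). (indicator A (\<lambda>i. fst (w i)) - indicator A (\<lambda>i. snd (w i)) :: real)\<^sup>2 = 0"
      proof eventually_elim
        case (elim w)
        have "(\<lambda>i. fst (w i)) \<in> A \<longleftrightarrow> (\<lambda>i. snd (w i)) \<in> A"
          using elim coupling_marginal_space[OF c] by (auto simp: A prod_emb_def PiE_iff space_PiM)
        then show ?case by (simp add: indicator_def)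
      qed
      then show ?thesis unfolding mismatch_def by (rule integral_eq_zero_AE)
    qed
    then have "\<forall>\<^sub>F m in sequentially. mismatch (c m) (indicator A) = 0" by (auto simp: eventually_sequentially)
    then show ?case using ind[OF As] by (simp add: matched_def tendsto_eventually)
  next
    case empty
    then show ?case by (simp add: matched_def mismatch_def L2_def)
  next
    case (compl A)
    have "matched (\<lambda>x. 1)" by (simp add: matched_def mismatch_def L2_def)
    from matched_add[OF this matched_cmult[OF compl.IH, of "- 1"]]
    have "matched (\<lambda>x. 1 - indicator A x)" by simp
    moreover have "(\<lambda>x. 1 - indicator A x) = (indicator ((\<Pi>\<^sub>E i\<in>UNIV. space (M i)) - A) :: (nat \<Rightarrow> real) \<Rightarrow> real)"
      using coupling_marginal_space[OF c] by (auto simp: indicator_def fun_eq_iff)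
    ultimately show ?case by simp
  next
    case (union A)
    have As: "A i \<in> sets (PiM UNIV M)" for i using union(2) by (auto simp: sets_PiM)
    have fin: "matched (indicator (\<Union>i<k. A i))" for k
    proof (induction k)
      case 0
      then show ?case by (simp add: matched_def mismatch_def L2_def)
    next
      case (Suc k)
      have "indicator (\<Union>i<Suc k. A i) x = (indicator (\<Union>i<k. A i) x + indicator (A k) x :: real)" for x
      proof -
        have "x \<notin> A i" if "x \<in> A k" "i < k" for i
          using union(1) that unfolding disjoint_family_on_def by (metis IntI UNIV_I empty_iff less_irrefl)
        then show ?thesis by (auto simp: indicator_def less_Suc_eq)
      qed
      then show ?case using matched_add[OF Suc.IH union.IH[of k]] by presburger
    qed
    show ?case
    proof (rule matched_limit[OF ind fin])
      show "(\<Union>i. A i) \<in> sets (PiM UNIV M)" using As by auto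
      have "(\<lambda>k. \<integral>x. (indicator (\<Union>i<k. A i) x - indicator (\<Union>i. A i) x)\<^sup>2 \<partial>PiM UNIV M) \<longlonglongrightarrow> (\<integral>x. (0 :: real) \<partial>PiM UNIV M)"
      proof (rule integral_dominated_convergence[where w = "\<lambda>_. 1"])
        show "AE x in PiM UNIV M. (\<lambda>k. (indicator (\<Union>i<k. A i) x - indicator (\<Union>i. A i) x)\<^sup>2) \<longlonglongrightarrow> (0 :: real)"
        proof (intro AE_I2 tendsto_eventually)
          fix x
          show "\<forall>\<^sub>F k in sequentially. (indicator (\<Union>i<k. A i) x - indicator (\<Union>i. A i) x)\<^sup>2 = (0 :: real)"
          proof (cases "\<exists>i. x \<in> A i")
            case True
            then obtain i where "x \<in> A i" by blast
            then show ?thesis by (auto simp: eventually_sequentially indicator_def intro!: exI[of _ "Suc i"])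
          qed auto
        qed
        show "AE x in PiM UNIV M. norm ((indicator (\<Union>i<k. A i) x - indicator (\<Union>i. A i) x)\<^sup>2 :: real) \<le> 1" for k
          by (auto simp: indicator_def)
        show "(\<lambda>x. (indicator (\<Union>i<k. A i) x - indicator (\<Union>i. A i) x)\<^sup>2 :: real) \<in> borel_measurable (PiM UNIV M)" for k
          using As by measurable
      qed auto
      then show "(\<lambda>k. \<integral>x. (indicator (\<Union>i<k. A i) x - indicator (\<Union>i. A i) x)\<^sup>2 \<partial>PiM UNIV M) \<longlonglongrightarrow> (0 :: real)" by simp
    qed
  qed
qed

lemma matched_nonneg:
  assumes "f \<in> borel_measurable (PiM UNIV M)" "\<And>x. 0 \<le> f x"
  shows "f \<in> L2 (PiM UNIV M) \<longrightarrow> matched f"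
  using assms
proof (induction rule: borel_measurable_induct_real)
  case (set A) then show ?case using matched_indicator by blast
next
  case (mult u a)
  show ?case
  proof
    assume L: "(\<lambda>x. a * u x) \<in> L2 (PiM UNIV M)"
    show "matched (\<lambda>x. a * u x)"
    proof (cases "a = 0")
      case True
      then show ?thesis by (simp add: matched_def mismatch_def L2_def)
    next
      case False
      then have "u \<in> L2 (PiM UNIV M)" using L2_cmult[OF L, of "1 / a"] by simp
      then show ?thesis using mult matched_cmult by blast
    qed
  qed
next
  case (add u v)
  show ?case
  proof
    assume L: "(\<lambda>x. v x + u x) \<in> L2 (PiM UNIV M)"
    have *: "w \<in> L2 (PiM UNIV M)" if [measurable]: "w \<in> borel_measurable (PiM UNIV M)" and w: "\<And>x. 0 \<le> w x" "\<And>x. w x \<le> v x + u x" for w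
      unfolding L2_def
    proof (intro CollectI conjI that(1))
      show "integrable (PiM UNIV M) (\<lambda>x. (w x)\<^sup>2)"
        by (rule Bochner_Integration.integrable_bound[of _ "\<lambda>x. (v x + u x)\<^sup>2"])
          (use L w in \<open>auto simp: L2_def intro!: power_mono AE_I2\<close>)
    qed
    have "u \<in> L2 (PiM UNIV M)" "v \<in> L2 (PiM UNIV M)" using add by (auto intro!: *)
    then show "matched (\<lambda>x. v x + u x)" using add matched_add by blast
  qed
next
  case (seq U)
  have "space (PiM UNIV M) = UNIV" using coupling_marginal_space[OF c] by (auto simp: space_PiM)
  then have Ulim: "(\<lambda>i. U i x) \<longlonglongrightarrow> f x" for x using seq(4) by simp
  have le: "U i x \<le> f x" for i x
    by (rule incseq_le[OF _ Ulim]) (use seq(3) in \<open>auto simp: incseq_def le_fun_def\<close>)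
  show ?case
  proof
    assume L: "f \<in> L2 (PiM UNIV M)"
    then have [measurable]: "f \<in> borel_measurable (PiM UNIV M)" and i: "integrable (PiM UNIV M) (\<lambda>x. (f x)\<^sup>2)" by (auto simp: L2_def)
    have [measurable]: "U i \<in> borel_measurable (PiM UNIV M)" for i by (rule seq(1))
    have "U k \<in> L2 (PiM UNIV M)" for k
      unfolding L2_def
    proof (intro CollectI conjI seq(1))
      show "integrable (PiM UNIV M) (\<lambda>x. (U k x)\<^sup>2)"
        by (rule Bochner_Integration.integrable_bound[OF i])
          (use le seq(2) in \<open>auto intro!: power_mono AE_I2\<close>)
    qed
    then have m: "matched (U k)" for k using seq by blast
    have "(\<lambda>k. \<integral>x. (U k x - f x)\<^sup>2 \<partial>PiM UNIV M) \<longlonglongrightarrow> (\<integral>x. 0 \<partial>PiM UNIV M)"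
    proof (rule integral_dominated_convergence[OF _ _ i])
      show "AE x in PiM UNIV M. (\<lambda>k. (U k x - f x)\<^sup>2) \<longlonglongrightarrow> 0"
      proof (rule AE_I2)
        fix x
        have "(\<lambda>k. (U k x - f x)\<^sup>2) \<longlonglongrightarrow> (f x - f x)\<^sup>2" by (intro tendsto_intros Ulim)
        then show "(\<lambda>k. (U k x - f x)\<^sup>2) \<longlonglongrightarrow> 0" by simp
      qed
      show "AE x in PiM UNIV M. norm ((U k x - f x)\<^sup>2) \<le> (f x)\<^sup>2" for k
      proof (rule AE_I2)
        fix x
        have "\<bar>U k x - f x\<bar> \<le> \<bar>f x\<bar>" using le[of k x] seq(2)[of k x] by simp
        then show "norm ((U k x - f x)\<^sup>2) \<le> (f x)\<^sup>2" by (simp add: abs_le_square_iff)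
      qed
    qed auto
    then show "matched f" by (intro matched_limit[OF L m]) simp
  qed
qed

text \<open>The form is the second moment minus half the mismatch, and all of \<open>L\<^sup>2\<close> is matched by
  monotone approximation with simple functions.\<close>

lemma coupled_form_diagonal_limit:
  assumes f: "f \<in> L2 (PiM UNIV M)"
  shows "(\<lambda>m. coupled_form (c m) f f) \<longlonglongrightarrow> (\<integral>x. (f x)\<^sup>2 \<partial>PiM UNIV M)"
proof -
  have [measurable]: "f \<in> borel_measurable (PiM UNIV M)" and i: "integrable (PiM UNIV M) (\<lambda>x. (f x)\<^sup>2)"
    using f by (auto simp: L2_def)
  have b: "integrable (PiM UNIV M) (\<lambda>x. (g x)\<^sup>2)" if [measurable]: "g \<in> borel_measurable (PiM UNIV M)" and "\<And>x. \<bar>g x\<bar> \<le> \<bar>f x\<bar>" for g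
    by (rule Bochner_Integration.integrable_bound[OF i]) (use that(2) in \<open>auto simp: abs_le_square_iff\<close>)
  have "matched (\<lambda>x. max 0 (f x))" "matched (\<lambda>x. max 0 (- f x))"
    by (rule matched_nonneg[rule_format]; (auto simp: L2_def intro!: b)?)+
  from matched_add[OF this(1) matched_cmult[OF this(2), of "- 1"]]
  have "matched (\<lambda>x. max 0 (f x) + - 1 * max 0 (- f x))" .
  moreover have "(\<lambda>x. max 0 (f x) + - 1 * max 0 (- f x)) = f" by (auto simp: max_def fun_eq_iff)
  ultimately have "(\<lambda>m. mismatch (c m) f) \<longlonglongrightarrow> 0" by (simp add: matched_def)
  from tendsto_diff[OF tendsto_const[of "\<integral>x. (f x)\<^sup>2 \<partial>PiM UNIV M"] tendsto_divide[OF this tendsto_const[of 2]]]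
  show ?thesis unfolding mismatch_coupled_form[OF c f] by simp
qed

end

section \<open>Telescoping along the correlation\<close>

text \<open>An increment formula in one coordinate for almost all sections gives the increment formula for
  the product. The set \<open>G\<close> collects the points with good sections; both coupled points lie in it
  almost surely because each has the product law.\<close>

lemma coupled_form_increment:
  fixes c :: "'i \<Rightarrow> (real \<times> real) measure"
  assumes c: "\<And>j. coupling (M j) (c j)" and d: "coupling (M i) d1" "coupling (M i) d2" "coupling (M i) e"
    and f: "f \<in> L2 (PiM UNIV M)" and h: "h \<in> L2 (PiM UNIV M)"
    and G: "AE x in PiM UNIV M. G x"
    and inc: "\<And>x y. G x \<Longrightarrow> G y \<Longrightarrow>
      (\<integral>z. f (x(i := fst z)) * f (y(i := snd z)) \<partial>d2) - (\<integral>z. f (x(i := fst z)) * f (y(i := snd z)) \<partial>d1)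
      = t * (\<integral>z. h (x(i := fst z)) * h (y(i := snd z)) \<partial>e)"
  shows "coupled_form (c(i := d2)) f f - coupled_form (c(i := d1)) f f = t * coupled_form (c(i := e)) h h"
proof -
  let ?F = "\<lambda>d f w. \<integral>z. f ((\<lambda>j. fst (w j))(i := fst z)) * f ((\<lambda>j. snd (w j))(i := snd z)) \<partial>d"
  note r1 = coupled_form_resample[OF c d(1) f f] and r2 = coupled_form_resample[OF c d(2) f f] and r3 = coupled_form_resample[OF c d(3) h h]
  have G1: "AE w in PiM UNIV c. G (\<lambda>j. fst (w j))"
  proof (rule AE_distrD[OF measurable_PiM_fst[OF c]])
    show "AE x in distr (PiM UNIV c) (PiM UNIV M) (\<lambda>w j. fst (w j)). G x"
      unfolding distr_PiM_fst[where M = M and c = c, OF c] by (rule G)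
  qed
  have G2: "AE w in PiM UNIV c. G (\<lambda>j. snd (w j))"
  proof (rule AE_distrD[OF measurable_PiM_snd[OF c]])
    show "AE x in distr (PiM UNIV c) (PiM UNIV M) (\<lambda>w j. snd (w j)). G x"
      unfolding distr_PiM_snd[where M = M and c = c, OF c] by (rule G)
  qed
  have "coupled_form (c(i := d2)) f f - coupled_form (c(i := d1)) f f = (\<integral>w. ?F d2 f w - ?F d1 f w \<partial>PiM UNIV c)"
    unfolding r1(1) r2(1) by (rule Bochner_Integration.integral_diff[OF r2(2) r1(2), symmetric])
  also have "\<dots> = (\<integral>w. t * ?F e h w \<partial>PiM UNIV c)"
  proof (rule integral_cong_AE)
    show "(\<lambda>w. ?F d2 f w - ?F d1 f w) \<in> borel_measurable (PiM UNIV c)"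
      by (intro borel_measurable_integrable Bochner_Integration.integrable_diff r1(2) r2(2))
    show "(\<lambda>w. t * ?F e h w) \<in> borel_measurable (PiM UNIV c)"
      by (intro borel_measurable_integrable integrable_mult_right r3(2))
    show "AE w in PiM UNIV c. ?F d2 f w - ?F d1 f w = t * ?F e h w"
      using G1 G2 by eventually_elim (rule inc)
  qed
  also have "\<dots> = t * coupled_form (c(i := e)) h h" unfolding r3(1) by simp
  finally show ?thesis .
qed

text \<open>The correlation of the first \<open>m\<close> coordinates is raised from \<open>0\<close> to \<open>1\<close> in \<open>N\<close> equal
  rounds, and in each round coordinate after coordinate. A round from \<open>s\<close> to \<open>s'\<close> passes through
  products whose factors are hypercontractive with exponent \<open>1 + s'\<close>, whence the bound \<open>B i s'\<close> for the rate in
  coordinate \<open>i\<close>. The Riemann sums of \<open>B i\<close> are at most \<open>R i N\<close>, which tends to \<open>I i\<close> as \<open>N\<close> grows; then \<open>m\<close> grows. The coupling \<open>e i s s'\<close>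
  represents the average rate between \<open>s\<close> and \<open>s'\<close>.\<close>

theorem variance_le_suminf:
  fixes M :: "nat \<Rightarrow> real measure" and c :: "nat \<Rightarrow> real \<Rightarrow> (real \<times> real) measure"
    and e :: "nat \<Rightarrow> real \<Rightarrow> real \<Rightarrow> (real \<times> real) measure"
  assumes c: "\<And>i s. 0 \<le> s \<Longrightarrow> s \<le> 1 \<Longrightarrow> coupling (M i) (c i s)"
    and c0: "\<And>i. c i 0 = M i \<Otimes>\<^sub>M M i" and c1: "\<And>i. AE z in c i 1. fst z = snd z"
    and hyp: "\<And>i s s'. 0 \<le> s \<Longrightarrow> s \<le> s' \<Longrightarrow> s' \<le> 1 \<Longrightarrow> hypercontractive (1 + s') (M i) (c i s)"
    and e: "\<And>i s s'. 0 \<le> s \<Longrightarrow> s \<le> s' \<Longrightarrow> s' \<le> 1 \<Longrightarrow> coupling (M i) (e i s s')"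
    and f: "f \<in> L2 (PiM UNIV M)" and h: "\<And>i. h i \<in> L2 (PiM UNIV M)"
    and G: "\<And>i. AE x in PiM UNIV M. G i x"
    and inc: "\<And>i x y s s'. 0 \<le> s \<Longrightarrow> s \<le> s' \<Longrightarrow> s' \<le> 1 \<Longrightarrow> G i x \<Longrightarrow> G i y \<Longrightarrow>
      (\<integral>z. f (x(i := fst z)) * f (y(i := snd z)) \<partial>c i s') - (\<integral>z. f (x(i := fst z)) * f (y(i := snd z)) \<partial>c i s)
      = (s' - s) * (\<integral>z. h i (x(i := fst z)) * h i (y(i := snd z)) \<partial>e i s s')"
    and bound: "\<And>i m s s' d. 0 \<le> s \<Longrightarrow> s \<le> s' \<Longrightarrow> s' \<le> 1 \<Longrightarrow> i < m \<Longrightarrow> (\<And>j. coupling (M j) (d j)) \<Longrightarrow>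
      (\<And>j. hypercontractive (1 + s') (M j) (d j)) \<Longrightarrow> (\<And>j. m \<le> j \<Longrightarrow> d j = M j \<Otimes>\<^sub>M M j) \<Longrightarrow>
      coupled_form (d(i := e i s s')) (h i) (h i) \<le> B i s'"
    and R: "\<And>i N. 0 < N \<Longrightarrow> (\<Sum>n<N. B i (real (Suc n) / real N)) / real N \<le> R i N" "\<And>i. R i \<longlonglongrightarrow> I i"
    and I: "summable I" "\<And>i. 0 \<le> I i"
  shows "(\<integral>x. (f x)\<^sup>2 \<partial>PiM UNIV M) - (\<integral>x. f x \<partial>PiM UNIV M)\<^sup>2 \<le> (\<Sum>i. I i)"
proof -
  have cM: "coupling (M i) (c i 0)" for i by (rule c) auto
  have M: "prob_space (M i)" for i by (rule coupling_marginal_prob_space[OF cM])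
  have Mp: "coupling (M i) (M i \<Otimes>\<^sub>M M i)" for i using cM[of i] unfolding c0 .
  define q where "q m s = coupled_form (\<lambda>j. if j < m then c j s else M j \<Otimes>\<^sub>M M j) f f" for m s
  have step: "q m s' - q m s \<le> (s' - s) * (\<Sum>k<m. B k s')" if s: "0 \<le> s" "s \<le> s'" "s' \<le> 1" for m s s'
  proof -
    (* In d k the first k coordinates have already been raised to s'. *)
    define d where "d k j = (if j < k then c j s' else if j < m then c j s else M j \<Otimes>\<^sub>M M j)" for k j
    have dc: "coupling (M j) (d k j)" for k j using s c[of s j] c[of s' j] Mp[of j] by (auto simp: d_def)
    have dh: "hypercontractive (1 + s') (M j) (d k j)" for k j
      using s hyp[of s s' j] hyp[of s' s' j] hyp[of 0 s' j] by (auto simp: d_def c0)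
    have one: "coupled_form (d (Suc k)) f f - coupled_form (d k) f f \<le> (s' - s) * B k s'" if k: "k < m" for k
    proof -
      have d1: "d (Suc k) = (d k)(k := c k s')" and d2: "d k = (d k)(k := c k s)"
        using k by (auto simp: d_def fun_eq_iff less_Suc_eq)
      have "coupled_form ((d k)(k := c k s')) f f - coupled_form ((d k)(k := c k s)) f f
        = (s' - s) * coupled_form ((d k)(k := e k s s')) (h k) (h k)"
        using s by (intro coupled_form_increment[OF dc _ _ _ f h G[of k]] c e inc) auto
      also have "\<dots> \<le> (s' - s) * B k s'"
      proof (intro mult_left_mono)
        show "coupled_form ((d k)(k := e k s s')) (h k) (h k) \<le> B k s'"
        proof (rule bound[OF s k dc dh])
          show "d k j = M j \<Otimes>\<^sub>M M j" if "m \<le> j" for j using k that by (simp add: d_def)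
        qed
      qed (use s in simp)
      finally show ?thesis using d1 d2 by simp
    qed
    have "coupled_form (d m) f f - coupled_form (d 0) f f = (\<Sum>k<m. coupled_form (d (Suc k)) f f - coupled_form (d k) f f)"
      by (rule sum_lessThan_telescope[symmetric])
    also have "\<dots> \<le> (\<Sum>k<m. (s' - s) * B k s')" by (intro sum_mono one) auto
    finally have "coupled_form (d m) f f - coupled_form (d 0) f f \<le> (\<Sum>k<m. (s' - s) * B k s')" .
    moreover have "d m = (\<lambda>j. if j < m then c j s' else M j \<Otimes>\<^sub>M M j)" "d 0 = (\<lambda>j. if j < m then c j s else M j \<Otimes>\<^sub>M M j)"
      by (auto simp: d_def fun_eq_iff)
    ultimately show ?thesis unfolding sum_distrib_left[symmetric] by (simp add: q_def)
  qed
  have finite: "q m 1 - q m 0 \<le> (\<Sum>k<m. I k)" for m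
  proof (rule LIMSEQ_le_const)
    show "(\<lambda>N. \<Sum>k<m. R k N) \<longlonglongrightarrow> (\<Sum>k<m. I k)" by (intro tendsto_sum R)
    have "q m 1 - q m 0 \<le> (\<Sum>k<m. R k N)" if N: "0 < N" for N
    proof -
      have "q m 1 - q m 0 = (\<Sum>n<N. q m (real (Suc n) / real N) - q m (real n / real N))"
        using sum_lessThan_telescope[of "\<lambda>n. q m (real n / real N)" N] N by simp
      also have "\<dots> \<le> (\<Sum>n<N. (real (Suc n) / real N - real n / real N) * (\<Sum>k<m. B k (real (Suc n) / real N)))"
        by (intro sum_mono step) (auto simp: divide_right_mono)
      also have "\<dots> = (\<Sum>n<N. \<Sum>k<m. B k (real (Suc n) / real N) / real N)"
        by (intro sum.cong refl) (simp add: diff_divide_distrib[symmetric] sum_divide_distrib)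
      also have "\<dots> = (\<Sum>k<m. \<Sum>n<N. B k (real (Suc n) / real N) / real N)" by (rule sum.swap)
      also have "\<dots> = (\<Sum>k<m. (\<Sum>n<N. B k (real (Suc n) / real N)) / real N)" by (simp add: sum_divide_distrib)
      also have "\<dots> \<le> (\<Sum>k<m. R k N)" by (intro sum_mono R N)
      finally show ?thesis .
    qed
    then show "\<exists>N0. \<forall>N\<ge>N0. q m 1 - q m 0 \<le> (\<Sum>k<m. R k N)" by (intro exI[of _ 1]) auto
  qed
  have q0: "q m 0 = (\<integral>x. f x \<partial>PiM UNIV M)\<^sup>2" for m
    unfolding q_def c0 by (simp add: coupled_form_product[OF M f f] power2_eq_square)
  have lim: "(\<lambda>m. q m 1) \<longlonglongrightarrow> (\<integral>x. (f x)\<^sup>2 \<partial>PiM UNIV M)"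
    unfolding q_def
    by (rule coupled_form_diagonal_limit[where c = "\<lambda>m j. if j < m then c j 1 else M j \<Otimes>\<^sub>M M j", OF _ _ f])
      (auto intro: c Mp c1)
  have "(\<lambda>m. q m 1 - q m 0) \<longlonglongrightarrow> (\<integral>x. (f x)\<^sup>2 \<partial>PiM UNIV M) - (\<integral>x. f x \<partial>PiM UNIV M)\<^sup>2"
    unfolding q0 by (intro tendsto_diff lim tendsto_const)
  then show ?thesis
  proof (rule LIMSEQ_le_const2)
    have "(\<Sum>k<m. I k) \<le> (\<Sum>i. I i)" for m by (rule sum_le_suminf[OF I(1)]) (use I in auto)
    then show "\<exists>N. \<forall>m\<ge>N. q m 1 - q m 0 \<le> (\<Sum>i. I i)" using finite order_trans by blast
  qed
qed

section \<open>Interpolation of norms and the function phi\<close>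

text \<open>The integrand of \<open>phi\<close> in the variable \<open>s = (1 - t) / (1 + t)\<close>, where \<open>1 + s\<close> is the
  exponent of the norm.\<close>

definition phi_int :: "real \<Rightarrow> real \<Rightarrow> real" where
  "phi_int u s = u powr (2 * ((1 - s) / (1 + s)))"

lemma phi_int_mono:
  assumes u: "0 < u" "u \<le> 1" and s: "0 \<le> s" "s \<le> s'"
  shows "phi_int u s \<le> phi_int u s'"
proof -
  have "(1 - s') / (1 + s') \<le> (1 - s) / (1 + s)" using s by (simp add: field_simps)
  then show ?thesis unfolding phi_int_def using u by (intro powr_mono' mult_left_mono) auto
qed

lemma phi_int_bounds:
  assumes u: "0 < u" "u \<le> 1" and s: "0 \<le> s" "s \<le> 1"
  shows "0 \<le> phi_int u s" "phi_int u s \<le> 1"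
  using u s by (auto simp: phi_int_def intro!: powr_le1)

text \<open>The substitution \<open>t \<mapsto> (1 - t) / (1 + t)\<close> has derivative \<open>- 2 / (1 + t)\<^sup>2\<close>, which produces the
  weight in the definition of \<open>phi\<close>. It is carried out through a primitive, which also
  compares with Riemann sums.\<close>

lemma phi_primitive:
  assumes u: "0 < u" "u \<le> 1"
  obtains P where "\<And>x. x \<in> {0..1} \<Longrightarrow> (P has_real_derivative phi_int u x) (at x within {0..1})" "phi u = P 1 - P 0"
proof -
  have cont: "continuous_on {0..1} (phi_int u)"
    unfolding phi_int_def using u by (intro continuous_intros) auto
  define P where "P x = integral {0..x} (phi_int u)" for x
  have P: "(P has_real_derivative phi_int u x) (at x within {0..1})" if "x \<in> {0..1}" for x
    unfolding P_def using that by (intro integral_has_real_derivative[OF cont]) auto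
  define r where "r t = (1 - t) / (1 + t)" for t :: real
  define q where "q t = 2 * (u powr (2 * t) / (1 + t)\<^sup>2)" for t
  have r01: "r t \<in> {0..1}" if "t \<in> {0..1}" for t using that by (auto simp: r_def field_simps)
  have g: "phi_int u (r t) * (- 2 / (1 + t)\<^sup>2) = - q t" if "t \<in> {0..1}" for t
  proof -
    have "1 + t \<noteq> 0" using that by auto
    then have "1 - r t = 2 * t / (1 + t)" "1 + r t = 2 / (1 + t)" by (simp_all add: r_def field_simps)
    then have "(1 - r t) / (1 + r t) = t" using \<open>1 + t \<noteq> 0\<close> by simp
    then show ?thesis by (simp add: phi_int_def q_def)
  qed
  have "(\<integral>t. indicator {0..1} t *\<^sub>R q t \<partial>lborel) = (- P (r 1)) - (- P (r 0))"
  proof (rule integral_FTC_atLeastAtMost)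
    show "continuous_on {0..1} q" unfolding q_def using u by (intro continuous_intros) auto
    fix t :: real assume "0 \<le> t" "t \<le> 1"
    then have t: "t \<in> {0..1}" by auto
    have "(r has_real_derivative - 2 / (1 + t)\<^sup>2) (at t within {0..1})"
      unfolding r_def using t by (auto intro!: derivative_eq_intros simp: field_simps power2_eq_square)
    moreover have "(P has_real_derivative phi_int u (r t)) (at (r t) within r ` {0..1})"
      by (rule DERIV_subset[OF P[OF r01[OF t]]]) (use r01 in blast)
    ultimately have "((\<lambda>t. P (r t)) has_real_derivative phi_int u (r t) * (- 2 / (1 + t)\<^sup>2)) (at t within {0..1})"
      by (intro DERIV_image_chain[unfolded o_def])
    then have "((\<lambda>t. P (r t)) has_real_derivative - q t) (at t within {0..1})" unfolding g[OF t] .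
    from DERIV_minus[OF this]
    show "((\<lambda>t. - P (r t)) has_vector_derivative q t) (at t within {0..1})"
      by (simp add: has_real_derivative_iff_has_vector_derivative)
  qed simp
  moreover have "phi u = (\<integral>t. indicator {0..1} t *\<^sub>R q t \<partial>lborel)"
    unfolding phi_def set_lebesgue_integral_def Bochner_Integration.integral_mult_right_zero[symmetric]
    by (intro Bochner_Integration.integral_cong) (auto simp: q_def)
  ultimately have "phi u = P 1 - P 0" by (simp add: r_def)
  then show ?thesis using that P by blast
qed

lemma phi_primitive_increment:
  assumes u: "0 < u" "u \<le> 1"
    and P: "\<And>x. x \<in> {0..1} \<Longrightarrow> (P has_real_derivative phi_int u x) (at x within {0..1})"
    and ab: "0 \<le> a" "a < b" "b \<le> 1"
  shows "(b - a) * phi_int u a \<le> P b - P a" "P b - P a \<le> b - a"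
proof -
  have "\<exists>z. a < z \<and> z < b \<and> P b - P a = (b - a) * phi_int u z"
  proof -
    have "(P has_derivative (\<lambda>h. phi_int u x * h)) (at x within {a..b})" if "a \<le> x" "x \<le> b" for x
      using DERIV_subset[OF P, of x "{a..b}"] that ab by (auto simp: has_field_derivative_def)
    from mvt_simple[OF ab(2) this] show ?thesis by (auto simp: mult.commute)
  qed
  then obtain z where z: "a < z" "z < b" "P b - P a = (b - a) * phi_int u z" by blast
  show "(b - a) * phi_int u a \<le> P b - P a" unfolding z(3) using ab z u by (intro mult_left_mono phi_int_mono) auto
  have "(b - a) * phi_int u z \<le> (b - a) * 1" using ab z u by (intro mult_left_mono phi_int_bounds) auto
  then show "P b - P a \<le> b - a" using z(3) by simp
qed

lemma phi_bounds:
  assumes u: "0 < u" "u \<le> 1" shows "0 \<le> phi u" "phi u \<le> 1"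
proof -
  obtain P where P: "\<And>x. x \<in> {0..1} \<Longrightarrow> (P has_real_derivative phi_int u x) (at x within {0..1})" "phi u = P 1 - P 0"
    using phi_primitive[OF u] by blast
  show "0 \<le> phi u" using phi_primitive_increment(1)[OF u P(1), of 0 1] phi_int_bounds(1)[OF u, of 0] P(2) by simp
  show "phi u \<le> 1" using phi_primitive_increment(2)[OF u P(1), of 0 1] P(2) by simp
qed

text \<open>The integrand is increasing with values in \<open>[0, 1]\<close>, so the upper Riemann sum exceeds the lower
  one by at most \<open>1 / N\<close>.\<close>

lemma phi_Riemann:
  assumes u: "0 < u" "u \<le> 1" and N: "0 < N"
  shows "(\<Sum>n<N. phi_int u (real (Suc n) / real N)) / real N \<le> phi u + 1 / real N"
proof -
  obtain P where P: "\<And>x. x \<in> {0..1} \<Longrightarrow> (P has_real_derivative phi_int u x) (at x within {0..1})" "phi u = P 1 - P 0"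
    using phi_primitive[OF u] by blast
  define g where "g n = phi_int u (real n / real N)" for n
  have "(\<Sum>n<N. g n / real N) \<le> (\<Sum>n<N. P (real (Suc n) / real N) - P (real n / real N))"
  proof (rule sum_mono)
    fix n assume "n \<in> {..<N}"
    then have "real (Suc n) / real N \<le> 1" "real n / real N < real (Suc n) / real N" using N by (auto simp: divide_strict_right_mono)
    then have "(real (Suc n) / real N - real n / real N) * phi_int u (real n / real N) \<le> P (real (Suc n) / real N) - P (real n / real N)"
      by (intro phi_primitive_increment(1)[OF u P(1)]) auto
    then show "g n / real N \<le> P (real (Suc n) / real N) - P (real n / real N)"
      by (simp add: g_def diff_divide_distrib[symmetric])
  qed
  also have "\<dots> = phi u" using sum_lessThan_telescope[of "\<lambda>n. P (real n / real N)" N] N P(2) by simp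
  finally have le: "(\<Sum>n<N. g n) / real N \<le> phi u" by (simp add: sum_divide_distrib)
  have "(\<Sum>n<N. g (Suc n)) = (\<Sum>n<N. g n) + (g N - g 0)"
    using sum_lessThan_telescope[of g N] by (simp add: sum_subtractf)
  moreover have "g N \<le> 1" "0 \<le> g 0" using N phi_int_bounds[OF u] by (auto simp: g_def)
  ultimately have "(\<Sum>n<N. g (Suc n)) / real N \<le> ((\<Sum>n<N. g n) + 1) / real N"
    by (intro divide_right_mono) auto
  then show ?thesis using le by (simp add: g_def add_divide_distrib)
qed

text \<open>Young's inequality for \<open>(\<bar>h\<bar> / A) powr (1 - s) * (h\<^sup>2 / B') powr s\<close>, where \<open>A\<close> and \<open>B'\<close> are the
  integrals of \<open>\<bar>h\<bar>\<close> and \<open>h\<^sup>2\<close>.\<close>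

lemma Lp_interpolation:
  assumes "prob_space N" and h: "h \<in> L2 N" and s: "0 \<le> s" "s \<le> 1" and B: "0 < (\<integral>x. (h x)\<^sup>2 \<partial>N)"
  defines "u \<equiv> (\<integral>x. \<bar>h x\<bar> \<partial>N) / sqrt (\<integral>x. (h x)\<^sup>2 \<partial>N)"
  shows "0 < u" "u \<le> 1" "(\<integral>x. \<bar>h x\<bar> powr (1 + s) \<partial>N) powr (2 / (1 + s)) \<le> (\<integral>x. (h x)\<^sup>2 \<partial>N) * phi_int u s"
proof -
  interpret N: prob_space N by fact
  have [measurable]: "h \<in> borel_measurable N" and i2: "integrable N (\<lambda>x. (h x)\<^sup>2)" using h by (auto simp: L2_def)
  have i1: "integrable N h" by (rule N.integrable_L2[OF _ i2]) measurable
  then have ia: "integrable N (\<lambda>x. \<bar>h x\<bar>)" by (rule integrable_abs)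
  define A where "A = (\<integral>x. \<bar>h x\<bar> \<partial>N)"
  define B' where "B' = (\<integral>x. (h x)\<^sup>2 \<partial>N)"
  have B'0: "0 < B'" using B by (simp add: B'_def)
  have A0: "0 < A"
  proof (rule ccontr)
    assume "\<not> 0 < A"
    moreover have "0 \<le> A" unfolding A_def by (rule Bochner_Integration.integral_nonneg) auto
    ultimately have "A = 0" by simp
    then have "AE x in N. \<bar>h x\<bar> = 0" unfolding A_def using integral_nonneg_eq_0_iff_AE[OF ia] by auto
    then have "AE x in N. (h x)\<^sup>2 = 0" by eventually_elim simp
    then have "B' = 0" unfolding B'_def by (rule integral_eq_zero_AE)
    then show False using B'0 by simp
  qed
  have u: "u = A / sqrt B'" by (simp add: u_def A_def B'_def)
  show "0 < u" using A0 B'0 u by simp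
  have "(\<lambda>x. \<bar>h x\<bar>) \<in> L2 N" "(\<lambda>_. 1) \<in> L2 N" using h by (auto simp: L2_def)
  from Cauchy_Schwarz_L2[OF this] have "A \<le> sqrt B'" using A0 by (simp add: A_def B'_def N.prob_space)
  then show "u \<le> 1" using B'0 u by (simp add: divide_le_eq)
  have young: "\<bar>y\<bar> powr (1 + s) \<le> A powr (1 - s) * B' powr s * ((1 - s) * (\<bar>y\<bar> / A) + s * (y\<^sup>2 / B'))" for y
  proof (cases "y = 0")
    case True then show ?thesis by simp
  next
    case False
    then have y: "0 < \<bar>y\<bar>" by simp
    have "\<bar>y\<bar> powr (1 + s) = \<bar>y\<bar> powr (1 - s) * (y\<^sup>2) powr s"
    proof -
      have "(y\<^sup>2) powr s = \<bar>y\<bar> powr (2 * s)" using y by (simp add: powr_powr[symmetric] powr_numeral)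
      then show ?thesis by (simp add: powr_add[symmetric] add.commute)
    qed
    also have "\<dots> = A powr (1 - s) * B' powr s * ((\<bar>y\<bar> / A) powr (1 - s) * (y\<^sup>2 / B') powr s)"
      using A0 B'0 y by (simp add: powr_divide)
    also have "\<dots> \<le> A powr (1 - s) * B' powr s * ((1 - s) * (\<bar>y\<bar> / A) + s * (y\<^sup>2 / B'))"
      using s A0 B'0 y by (intro mult_left_mono Youngs_inequality_0) auto
    finally show ?thesis .
  qed
  have iy: "integrable N (\<lambda>x. A powr (1 - s) * B' powr s * ((1 - s) * (\<bar>h x\<bar> / A) + s * ((h x)\<^sup>2 / B')))"
    using ia i2 by auto
  have "(\<integral>x. \<bar>h x\<bar> powr (1 + s) \<partial>N) \<le> (\<integral>x. A powr (1 - s) * B' powr s * ((1 - s) * (\<bar>h x\<bar> / A) + s * ((h x)\<^sup>2 / B')) \<partial>N)"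
  proof (rule integral_mono[OF _ iy young])
    show "integrable N (\<lambda>x. \<bar>h x\<bar> powr (1 + s))"
      by (rule Bochner_Integration.integrable_bound[OF iy]) (use young in \<open>auto intro!: AE_I2 order_trans[OF _ abs_ge_self]\<close>)
  qed
  also have "\<dots> = A powr (1 - s) * B' powr s"
    using ia i2 A0 B'0 by (simp add: A_def[symmetric] B'_def[symmetric])
  finally have "(\<integral>x. \<bar>h x\<bar> powr (1 + s) \<partial>N) powr (2 / (1 + s)) \<le> (A powr (1 - s) * B' powr s) powr (2 / (1 + s))"
    using s by (intro powr_mono2 Bochner_Integration.integral_nonneg) auto
  also have "\<dots> = B' * phi_int u s"
  proof -
    define e where "e = 2 * ((1 - s) / (1 + s))"
    have e: "(1 - s) * (2 / (1 + s)) = e" "s * (2 / (1 + s)) = 1 - e / 2"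
      using s by (simp_all add: e_def field_simps)
    have "(A powr (1 - s) * B' powr s) powr (2 / (1 + s)) = A powr e * B' powr (1 - e / 2)"
      by (subst powr_mult) (simp_all only: powr_powr e powr_ge_zero)
    also have "B' powr (1 - e / 2) = B' / B' powr (e / 2)" using B'0 by (simp add: powr_diff)
    also have "B' powr (e / 2) = sqrt B' powr e" using B'0 by (simp add: powr_half_sqrt[symmetric] powr_powr)
    also have "A powr e * (B' / sqrt B' powr e) = B' * (A / sqrt B') powr e"
      using A0 B'0 by (simp add: powr_divide)
    finally show ?thesis by (simp add: phi_int_def e_def u)
  qed
  finally show "(\<integral>x. \<bar>h x\<bar> powr (1 + s) \<partial>N) powr (2 / (1 + s)) \<le> (\<integral>x. (h x)\<^sup>2 \<partial>N) * phi_int u s"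
    by (simp add: B'_def)
qed

lemma
  fixes h :: "'a \<Rightarrow> real"
  shows Lp_norm_2_sq: "(Lp_norm N 2 h)\<^sup>2 = (\<integral>x. (h x)\<^sup>2 \<partial>N)"
    and Lp_norm_2: "Lp_norm N 2 h = sqrt (\<integral>x. (h x)\<^sup>2 \<partial>N)"
    and Lp_norm_1: "Lp_norm N 1 h = (\<integral>x. \<bar>h x\<bar> \<partial>N)"
proof -
  have nn: "0 \<le> (\<integral>x. (h x)\<^sup>2 \<partial>N)" "0 \<le> (\<integral>x. \<bar>h x\<bar> \<partial>N)" by (auto intro: Bochner_Integration.integral_nonneg)
  have "\<bar>y\<bar> powr 2 = y\<^sup>2" "\<bar>y\<bar> powr 1 = \<bar>y\<bar>" for y :: real by (cases "y = 0"; simp add: powr_numeral)+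
  then show 2: "Lp_norm N 2 h = sqrt (\<integral>x. (h x)\<^sup>2 \<partial>N)" and "Lp_norm N 1 h = (\<integral>x. \<bar>h x\<bar> \<partial>N)"
    using nn by (simp_all add: Lp_norm_def powr_half_sqrt)
  show "(Lp_norm N 2 h)\<^sup>2 = (\<integral>x. (h x)\<^sup>2 \<partial>N)" unfolding 2 using nn by simp
qed

lemma
  assumes N: "prob_space N" and h: "h \<in> L2 N"
  defines "v \<equiv> (Lp_norm N 2 h)\<^sup>2" and "u \<equiv> Lp_norm N 1 h / Lp_norm N 2 h"
  shows Lp_Riemann_le_phi: "\<And>k. 0 < k \<Longrightarrow>
      (\<Sum>n<k. (\<integral>x. \<bar>h x\<bar> powr (1 + real (Suc n) / real k) \<partial>N) powr (2 / (1 + real (Suc n) / real k))) / real k \<le> v * (phi u + 1 / real k)"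
    and phi_term_bounds: "0 \<le> v * phi u" "v * phi u \<le> v"
proof -
  note L = Lp_norm_2_sq[of N h] Lp_norm_2[of N h] Lp_norm_1[of N h]
  have [measurable]: "h \<in> borel_measurable N" and i2: "integrable N (\<lambda>x. (h x)\<^sup>2)" using h by (auto simp: L2_def)
  have "0 \<le> v" by (simp add: v_def)
  then consider "v = 0" | "0 < v" by linarith
  then have "(\<forall>k>0. (\<Sum>n<k. (\<integral>x. \<bar>h x\<bar> powr (1 + real (Suc n) / real k) \<partial>N) powr (2 / (1 + real (Suc n) / real k))) / real k \<le> v * (phi u + 1 / real k))
    \<and> 0 \<le> v * phi u \<and> v * phi u \<le> v"
  proof cases
    case 1
    then have "AE x in N. (h x)\<^sup>2 = 0" unfolding v_def L(1) using integral_nonneg_eq_0_iff_AE[OF i2] by auto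
    then have "AE x in N. \<bar>h x\<bar> powr p = 0" for p by eventually_elim simp
    then have "(\<integral>x. \<bar>h x\<bar> powr p \<partial>N) = 0" for p by (rule integral_eq_zero_AE)
    then show ?thesis using 1 by simp
  next
    case 2
    then have B: "0 < (\<integral>x. (h x)\<^sup>2 \<partial>N)" unfolding v_def L(1) .
    note int = Lp_interpolation[OF N h _ _ B, folded L(2) L(3), folded u_def, folded L(1), folded v_def]
    have u: "0 < u" "u \<le> 1" using int(1,2)[of 0] by auto
    have "(\<Sum>n<k. (\<integral>x. \<bar>h x\<bar> powr (1 + real (Suc n) / real k) \<partial>N) powr (2 / (1 + real (Suc n) / real k))) / real k \<le> v * (phi u + 1 / real k)"
      if k: "0 < k" for k
    proof -
      have "(\<Sum>n<k. (\<integral>x. \<bar>h x\<bar> powr (1 + real (Suc n) / real k) \<partial>N) powr (2 / (1 + real (Suc n) / real k)))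
        \<le> (\<Sum>n<k. v * phi_int u (real (Suc n) / real k))"
        by (intro sum_mono int(3)) auto
      then have "(\<Sum>n<k. (\<integral>x. \<bar>h x\<bar> powr (1 + real (Suc n) / real k) \<partial>N) powr (2 / (1 + real (Suc n) / real k))) / real k
        \<le> (\<Sum>n<k. v * phi_int u (real (Suc n) / real k)) / real k" by (rule divide_right_mono) simp
      also have "\<dots> = v * ((\<Sum>n<k. phi_int u (real (Suc n) / real k)) / real k)"
        by (simp add: sum_distrib_left)
      also have "\<dots> \<le> v * (phi u + 1 / real k)" using 2 by (intro mult_left_mono phi_Riemann u k) auto
      finally show ?thesis .
    qed
    moreover have "v * phi u \<le> v * 1" using phi_bounds[OF u] 2 by (intro mult_left_mono) auto
    ultimately show ?thesis using phi_bounds(1)[OF u] 2 by simp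
  qed
  then show "\<And>k. 0 < k \<Longrightarrow>
      (\<Sum>n<k. (\<integral>x. \<bar>h x\<bar> powr (1 + real (Suc n) / real k) \<partial>N) powr (2 / (1 + real (Suc n) / real k))) / real k \<le> v * (phi u + 1 / real k)"
    "0 \<le> v * phi u" "v * phi u \<le> v" by auto
qed

section \<open>Fair coins and the coordinate measures\<close>

definition fair :: "real measure" where
  "fair = distr coin borel real"

text \<open>Two fair coins with correlation \<open>s\<close>, as a measure on pairs of reals so that coins and Gaussians
  can be factors of the same product.\<close>

definition coin_coupling :: "real \<Rightarrow> (real \<times> real) measure" where
  "coin_coupling s = distr (point_measure ({0, 1} \<times> {0, 1}) (\<lambda>z. ennreal (if fst z = snd z then (1 + s) / 4 else (1 - s) / 4)))
     (borel \<Otimes>\<^sub>M borel) (\<lambda>z. z)"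

lemma prob_space_coin: "prob_space coin"
  unfolding coin_def by (rule prob_space_uniform_count_measure) auto

lemma prob_space_fair: "prob_space fair"
  unfolding fair_def by (rule prob_space.prob_space_distr[OF prob_space_coin]) (simp add: coin_def)

lemma sets_fair [simp, measurable_cong]: "sets fair = sets borel" by (simp add: fair_def)

lemma space_fair [simp]: "space fair = UNIV" by (simp add: fair_def)

lemma integral_coin: "(\<integral>b. f b \<partial>coin) = (f 0 + f 1) / (2 :: real)"
  unfolding coin_def by (subst integral_uniform_count_measure) auto

lemma integral_fair: "f \<in> borel_measurable borel \<Longrightarrow> (\<integral>x. f x \<partial>fair) = (f 0 + f 1) / (2 :: real)"
  unfolding fair_def by (subst integral_distr) (auto simp: integral_coin, auto simp: coin_def)

lemma sets_coin_coupling [simp, measurable_cong]: "sets (coin_coupling s) = sets (borel \<Otimes>\<^sub>M borel)"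
  by (simp add: coin_coupling_def)

lemma space_coin_coupling [simp]: "space (coin_coupling s) = UNIV"
  by (simp add: coin_coupling_def space_pair_measure)

lemma measurable_point_measure_borel: "(\<lambda>z. z) \<in> point_measure A p \<rightarrow>\<^sub>M N" if "A \<subseteq> space N"
  using that by (auto simp: measurable_def sets_point_measure space_point_measure)

lemma integral_coin_coupling:
  assumes s: "0 \<le> s" "s \<le> 1" and F: "F \<in> borel_measurable (borel \<Otimes>\<^sub>M borel)"
  shows "(\<integral>z. F z \<partial>coin_coupling s)
    = (1 + s) / 4 * (F (0, 0) + F (1, 1)) + (1 - s) / 4 * (F (0, 1) + F (1, 0 :: real) :: real)"
proof -
  have "(\<integral>z. F z \<partial>coin_coupling s) = (\<integral>z. F z \<partial>point_measure ({0, 1} \<times> {0, 1}) (\<lambda>z. ennreal (if fst z = snd z then (1 + s) / 4 else (1 - s) / 4)))"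
    unfolding coin_coupling_def
    by (rule integral_distr[OF measurable_point_measure_borel F]) (simp add: space_pair_measure)
  also have "\<dots> = (\<Sum>z\<in>{0, 1} \<times> {0, 1}. (if fst z = snd z then (1 + s) / 4 else (1 - s) / 4) *\<^sub>R F z)"
    by (rule lebesgue_integral_point_measure_finite) (use s in auto)
  also have "{0, 1} \<times> {0, 1} = {(0, 0), (0, 1), (1, 0), (1, 1 :: real)}" by auto
  also have "(\<Sum>z\<in>{(0, 0), (0, 1), (1, 0), (1, 1 :: real)}. (if fst z = snd z then (1 + s) / 4 else (1 - s) / 4) *\<^sub>R F z)
    = (1 + s) / 4 * (F (0, 0) + F (1, 1)) + (1 - s) / 4 * (F (0, 1) + F (1, 0))"
    by (simp add: algebra_simps)
  finally show ?thesis .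
qed

lemma prob_space_coin_coupling:
  assumes s: "0 \<le> s" "s \<le> 1" shows "prob_space (coin_coupling s)"
proof -
  have "emeasure (point_measure ({0, 1} \<times> {0, 1 :: real}) (\<lambda>z. ennreal (if fst z = snd z then (1 + s) / 4 else (1 - s) / 4))) ({0, 1} \<times> {0, 1})
    = (\<Sum>z\<in>{0, 1} \<times> {0, 1 :: real}. ennreal (if fst z = snd z then (1 + s) / 4 else (1 - s) / 4))"
    by (rule emeasure_point_measure_finite) auto
  also have "\<dots> = ennreal (\<Sum>z\<in>{0, 1} \<times> {0, 1 :: real}. (if fst z = snd z then (1 + s) / 4 else (1 - s) / 4))"
    using s by (intro sum_ennreal) auto
  also have "{0, 1} \<times> {0, 1} = {(0, 0), (0, 1), (1, 0), (1, 1 :: real)}" by auto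
  also have "(\<Sum>z\<in>{(0, 0), (0, 1), (1, 0), (1, 1 :: real)}. (if fst z = snd z then (1 + s) / 4 else (1 - s) / 4)) = 1"
    by (simp add: field_simps)
  finally have "prob_space (point_measure ({0, 1} \<times> {0, 1 :: real}) (\<lambda>z. ennreal (if fst z = snd z then (1 + s) / 4 else (1 - s) / 4)))"
    by (intro prob_spaceI) (simp add: space_point_measure)
  then show ?thesis unfolding coin_coupling_def
    by (rule prob_space.prob_space_distr) (rule measurable_point_measure_borel, simp add: space_pair_measure)
qed

lemma prob_space_eqI_indicator:
  assumes "prob_space P" "prob_space Q" and sets: "sets P = sets Q"
    and eq: "\<And>A. A \<in> sets Q \<Longrightarrow> (\<integral>x. indicator A x \<partial>P) = (\<integral>x. indicator A x \<partial>Q :: real)"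
  shows "P = Q"
proof (rule measure_eqI[OF sets])
  interpret P: prob_space P by fact
  interpret Q: prob_space Q by fact
  fix A assume "A \<in> sets P"
  then have A: "A \<in> sets P" "A \<in> sets Q" using sets by auto
  then show "emeasure P A = emeasure Q A"
    using eq[OF A(2)] by (simp add: P.emeasure_eq_measure Q.emeasure_eq_measure sets_eq_imp_space_eq[OF sets])
qed

lemma coupling_coin:
  assumes s: "0 \<le> s" "s \<le> 1" shows "coupling fair (coin_coupling s)"
proof -
  interpret prob_space "coin_coupling s" by (rule prob_space_coin_coupling[OF s])
  have "distr (coin_coupling s) borel fst = fair"
  proof (rule prob_space_eqI_indicator[OF prob_space_distr prob_space_fair])
    fix A assume "A \<in> sets fair"
    then have [measurable]: "A \<in> sets borel" by simp
    have "(\<integral>x. indicator A x \<partial>distr (coin_coupling s) borel fst) = (\<integral>z. indicator A (fst z) \<partial>coin_coupling s :: real)"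
      by (rule integral_distr) simp_all
    also have "\<dots> = (indicator A 0 + indicator A 1) / 2"
      by (subst integral_coin_coupling[OF s]) (simp_all add: field_simps)
    also have "\<dots> = (\<integral>x. indicator A x \<partial>fair)" by (rule integral_fair[symmetric]) simp
    finally show "(\<integral>x. indicator A x \<partial>distr (coin_coupling s) borel fst) = (\<integral>x. indicator A x \<partial>fair :: real)" .
  qed simp_all
  moreover have "distr (coin_coupling s) borel snd = fair"
  proof (rule prob_space_eqI_indicator[OF prob_space_distr prob_space_fair])
    fix A assume "A \<in> sets fair"
    then have [measurable]: "A \<in> sets borel" by simp
    have "(\<integral>x. indicator A x \<partial>distr (coin_coupling s) borel snd) = (\<integral>z. indicator A (snd z) \<partial>coin_coupling s :: real)"
      by (rule integral_distr) simp_all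
    also have "\<dots> = (indicator A 0 + indicator A 1) / 2"
      by (subst integral_coin_coupling[OF s]) (simp_all add: field_simps)
    also have "\<dots> = (\<integral>x. indicator A x \<partial>fair)" by (rule integral_fair[symmetric]) simp
    finally show "(\<integral>x. indicator A x \<partial>distr (coin_coupling s) borel snd) = (\<integral>x. indicator A x \<partial>fair :: real)" .
  qed simp_all
  ultimately show ?thesis using prob_space_axioms by (simp add: coupling_def)
qed

lemma coin_coupling_0: "coin_coupling 0 = fair \<Otimes>\<^sub>M fair"
proof -
  interpret fair: prob_space fair by (rule prob_space_fair)
  interpret ff: pair_prob_space fair fair ..
  have sets: "sets (fair \<Otimes>\<^sub>M fair) = sets (borel \<Otimes>\<^sub>M borel)" by (intro sets_pair_measure_cong) auto
  show ?thesis
  proof (rule prob_space_eqI_indicator)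
    show "prob_space (coin_coupling 0)" by (rule prob_space_coin_coupling) auto
    show "prob_space (fair \<Otimes>\<^sub>M fair)" by (rule ff.prob_space_axioms)
    show "sets (coin_coupling 0) = sets (fair \<Otimes>\<^sub>M fair)" using sets by simp
    fix A assume "A \<in> sets (fair \<Otimes>\<^sub>M fair)"
    then have [measurable]: "A \<in> sets (borel \<Otimes>\<^sub>M borel)" and A: "A \<in> sets (fair \<Otimes>\<^sub>M fair)" using sets by auto
    have int: "integrable (fair \<Otimes>\<^sub>M fair) (indicator A :: _ \<Rightarrow> real)"
      using A by (intro integrable_real_indicator) (auto simp: ff.emeasure_eq_measure)
    have m: "(\<lambda>y. indicator A (x, y) :: real) \<in> borel_measurable borel" for x by measurable
    have "(\<integral>z. indicator A z \<partial>(fair \<Otimes>\<^sub>M fair)) = (\<integral>x. (\<integral>y. indicator A (x, y) \<partial>fair) \<partial>fair :: real)"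
      using ff.integral_fst'[OF int] by simp
    also have "\<dots> = (\<integral>x. (indicator A (x, 0) + indicator A (x, 1)) / 2 \<partial>fair :: real)"
      by (simp add: integral_fair[OF m])
    also have "\<dots> = (1 + 0) / 4 * (indicator A (0, 0) + indicator A (1, 1)) + (1 - 0) / 4 * (indicator A (0, 1) + indicator A (1, 0))"
      by (subst integral_fair) (simp_all add: field_simps)
    also have "\<dots> = (\<integral>z. indicator A z \<partial>coin_coupling 0 :: real)"
      by (rule integral_coin_coupling[symmetric]) simp_all
    finally show "(\<integral>z. indicator A z \<partial>coin_coupling 0) = (\<integral>z. indicator A z \<partial>(fair \<Otimes>\<^sub>M fair) :: real)" ..
  qed
qed

lemma coin_coupling_1: "AE z in coin_coupling 1. fst z = snd z"
proof -
  have "AE z in point_measure ({0, 1} \<times> {0, 1 :: real}) (\<lambda>z. ennreal (if fst z = snd z then (1 + 1) / 4 else (1 - 1) / 4)). fst z = snd z"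
    by (subst AE_point_measure) auto
  moreover have "{z \<in> space (borel \<Otimes>\<^sub>M borel). fst z = snd z} \<in> sets (borel \<Otimes>\<^sub>M (borel :: real measure))"
    by measurable
  ultimately show ?thesis unfolding coin_coupling_def
    by (subst AE_distr_iff) (simp_all add: measurable_point_measure_borel space_pair_measure)
qed

lemma hypercontractive_coin:
  assumes s: "0 \<le> s" "s \<le> s'" "s' \<le> 1" shows "hypercontractive (1 + s') fair (coin_coupling s)"
  unfolding hypercontractive_def
proof (intro allI impI)
  fix f g :: "real \<Rightarrow> real" and K
  assume [measurable]: "f \<in> borel_measurable borel" "g \<in> borel_measurable borel"
    and fb: "\<forall>x. 0 \<le> f x \<and> f x \<le> K" and gb: "\<forall>x. 0 \<le> g x \<and> g x \<le> K"
  have s1: "s \<le> 1" using s by simp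
  have "(\<integral>z. f (fst z) * g (snd z) \<partial>coin_coupling s) = (1 + s) / 4 * (f 0 * g 0 + f 1 * g 1) + (1 - s) / 4 * (f 0 * g 1 + f 1 * g 0)"
    by (simp add: integral_coin_coupling[OF s(1) s1])
  also have "\<dots> \<le> ((f 0 powr (1 + s') + f 1 powr (1 + s')) / 2) powr (1 / (1 + s')) * ((g 0 powr (1 + s') + g 1 powr (1 + s')) / 2) powr (1 / (1 + s'))"
    by (rule two_point_bilinear) (use s fb gb in auto)
  also have "\<dots> = (\<integral>x. f x powr (1 + s') \<partial>fair) powr (1 / (1 + s')) * (\<integral>x. g x powr (1 + s') \<partial>fair) powr (1 / (1 + s'))"
    by (simp add: integral_fair)
  finally show "(\<integral>z. f (fst z) * g (snd z) \<partial>coin_coupling s)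
    \<le> (\<integral>x. f x powr (1 + s') \<partial>fair) powr (1 / (1 + s')) * (\<integral>x. g x powr (1 + s') \<partial>fair) powr (1 / (1 + s'))" .
qed

text \<open>Both sides are \<open>(s' - s) * (f 0 - f 1) * (g 0 - g 1) / 4\<close>.\<close>

lemma coin_increment:
  assumes [measurable]: "f \<in> borel_measurable borel" "g \<in> borel_measurable borel" and s: "0 \<le> s" "s \<le> s'" "s' \<le> 1"
  shows "(\<integral>z. f (fst z) * g (snd z) \<partial>coin_coupling s') - (\<integral>z. f (fst z) * g (snd z) \<partial>coin_coupling s)
    = (s' - s) * (\<integral>z. (f (fst z) - (f 0 + f 1) / 2) * (g (snd z) - (g 0 + g 1) / 2) \<partial>coin_coupling 1)"
proof -
  have s': "0 \<le> s'" "s \<le> 1" using s by auto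
  show ?thesis
    by (simp add: integral_coin_coupling[OF s(1) s'(2)] integral_coin_coupling[OF s'(1) s(3)] integral_coin_coupling[of 1] field_simps)
qed

lemma mehler_0: "mehler 0 = gauss \<Otimes>\<^sub>M gauss"
proof -
  have "mehler 0 = distr (gauss \<Otimes>\<^sub>M gauss) (gauss \<Otimes>\<^sub>M gauss) (\<lambda>z. z)"
    unfolding mehler_def by (intro distr_cong sets_pair_measure_cong) auto
  then show ?thesis by (simp add: distr_id)
qed

lemma mehler_1: "AE z in mehler 1. fst z = snd z"
  unfolding mehler_def by (subst AE_distr_iff) auto

definition coord :: "nat \<Rightarrow> nat \<Rightarrow> real measure" where
  "coord n i = (if i < n then fair else gauss)"

text \<open>The theorem for \<open>n\<close> coins followed by Gaussians, all as coordinates of one sequence. For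
  a coin the rate is realized by the diagonal coupling of the discrete derivative, so its bound is the second
  moment for every correlation.\<close>

theorem variance_bound_coord:
  assumes f: "f \<in> L2 (PiM UNIV (coord n))" and h: "\<And>k. h k \<in> L2 (PiM UNIV (coord n))"
    and deriv: "\<And>k. AE x in PiM UNIV (coord n). has_gauss_deriv (\<lambda>t. f (x(n + k := t))) (\<lambda>t. h k (x(n + k := t)))"
    and summ: "summable (\<lambda>k. (Lp_norm (PiM UNIV (coord n)) 2 (h k))\<^sup>2)"
  shows "(\<integral>x. (f x)\<^sup>2 \<partial>PiM UNIV (coord n)) - (\<integral>x. f x \<partial>PiM UNIV (coord n))\<^sup>2
    \<le> (\<Sum>i<n. \<integral>x. (f x - (f (x(i := 0)) + f (x(i := 1))) / 2)\<^sup>2 \<partial>PiM UNIV (coord n)) +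
      (\<Sum>k. (Lp_norm (PiM UNIV (coord n)) 2 (h k))\<^sup>2 *
        phi (Lp_norm (PiM UNIV (coord n)) 1 (h k) / Lp_norm (PiM UNIV (coord n)) 2 (h k)))"
proof -
  let ?P = "PiM UNIV (coord n)"
  have M: "prob_space (coord n i)" for i by (simp add: coord_def prob_space_fair prob_space_gauss)
  have setsM: "sets (coord n i) = sets borel" for i by (simp add: coord_def)
  have spaceP: "space ?P = UNIV" using sets_eq_imp_space_eq[OF setsM] by (auto simp: space_PiM)
  interpret P: prob_space ?P by (intro prob_space_PiM M)
  have [measurable]: "f \<in> borel_measurable ?P" using f by (auto simp: L2_def)
  have slice: "(\<lambda>t. f (x(i := t))) \<in> borel_measurable borel" for x i
    using measurable_upd_section[of f "coord n" x i] spaceP unfolding measurable_cong_sets[OF setsM refl] by simp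
  define D where "D i x = (if i < n then f x - (f (x(i := 0)) + f (x(i := 1))) / 2 else h (i - n) x)" for i x
  define T where "T k = (Lp_norm ?P 2 (h k))\<^sup>2 * phi (Lp_norm ?P 1 (h k) / Lp_norm ?P 2 (h k))" for k
  define v where "v k = (Lp_norm ?P 2 (h k))\<^sup>2" for k
  define I where "I i = (if i < n then (\<integral>x. (D i x)\<^sup>2 \<partial>?P) else T (i - n))" for i
  define R where "R i N = (if i < n then (\<integral>x. (D i x)\<^sup>2 \<partial>?P) else v (i - n) * (phi (Lp_norm ?P 1 (h (i - n)) / Lp_norm ?P 2 (h (i - n))) + 1 / real N))" for i N
  define B where "B i s = (if i < n then (\<integral>x. (D i x)\<^sup>2 \<partial>?P) else (\<integral>x. \<bar>h (i - n) x\<bar> powr (1 + s) \<partial>?P) powr (2 / (1 + s)))" for i s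
  define c where "c i s = (if i < n then coin_coupling s else mehler s)" for i s
  (* At correlation 1 the two coins coincide: the diagonal coupling. *)
  define e where "e i s s' = (if i < n then coin_coupling 1 else mehler_avg s s')" for i s s'
  define G where "G i x = (i < n \<or> has_gauss_deriv (\<lambda>t. f (x(i := t))) (\<lambda>t. h (i - n) (x(i := t))))" for i x
  have T: "0 \<le> T k" "T k \<le> v k" for k
    using phi_term_bounds[OF P.prob_space_axioms h[of k]] by (auto simp: T_def v_def)
  have sT: "summable T"
    by (rule summable_comparison_test'[of v 0]) (use summ T in \<open>auto simp: v_def[abs_def]\<close>)
  have IT: "I (k + n) = T k" for k by (simp add: I_def)
  have sI: "summable I" using sT summable_iff_shift[of I n] by (simp add: IT)
  have "(\<integral>x. (f x)\<^sup>2 \<partial>?P) - (\<integral>x. f x \<partial>?P)\<^sup>2 \<le> (\<Sum>i. I i)"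
  proof (rule variance_le_suminf[where c = c and e = e and G = G and h = D and B = B and R = R])
    show "coupling (coord n i) (c i s)" if "0 \<le> s" "s \<le> 1" for i s
      using that by (auto simp: coord_def c_def intro: coupling_coin coupling_mehler)
    show "c i 0 = coord n i \<Otimes>\<^sub>M coord n i" for i by (simp add: c_def coord_def coin_coupling_0 mehler_0)
    show "AE z in c i 1. fst z = snd z" for i
      by (cases "i < n") (simp_all only: c_def if_True if_False coin_coupling_1 mehler_1)
    show "hypercontractive (1 + s') (coord n i) (c i s)" if "0 \<le> s" "s \<le> s'" "s' \<le> 1" for i s s'
      using that by (auto simp: coord_def c_def intro: hypercontractive_coin hypercontractive_mehler)
    show ce: "coupling (coord n i) (e i s s')" if "0 \<le> s" "s \<le> s'" "s' \<le> 1" for i s s'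
      using that by (auto simp: coord_def e_def intro: coupling_coin coupling_mehler_avg)
    show "f \<in> L2 ?P" by fact
    show D: "D i \<in> L2 ?P" for i
    proof (cases "i < n")
      case True
      have int: "integrable ?P (\<lambda>x. (f x)\<^sup>2)" using f by (simp add: L2_def)
      have m: "(\<lambda>x. f (x(i := a))) \<in> borel_measurable ?P" for a
      proof -
        have "(\<lambda>x. (x, a)) \<in> ?P \<rightarrow>\<^sub>M ?P \<Otimes>\<^sub>M coord n i"
          using sets_eq_imp_space_eq[OF setsM] by (intro measurable_Pair measurable_ident measurable_const) auto
        from measurable_compose[OF this measurable_upd_pair[of f "coord n" i]] show ?thesis by simp
      qed
      have e2: "(\<integral>a. (f (x(i := a)))\<^sup>2 \<partial>coord n i) = ((f (x(i := 0)))\<^sup>2 + (f (x(i := 1)))\<^sup>2) / 2" for x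
      proof -
        have [measurable]: "(\<lambda>a. f (x(i := a))) \<in> borel_measurable borel" by (rule slice)
        show ?thesis using True by (simp add: coord_def integral_fair)
      qed
      have i2: "integrable ?P (\<lambda>x. ((f (x(i := 0)))\<^sup>2 + (f (x(i := 1)))\<^sup>2) / 2)"
        using integrable_resample[of "coord n" "coord n" i, OF M M refl refl int] unfolding e2 .
      have "(\<lambda>x. f (x(i := a))) \<in> L2 ?P" if "a = 0 \<or> a = 1" for a
        unfolding L2_def
      proof (intro CollectI conjI m)
        show "integrable ?P (\<lambda>x. (f (x(i := a)))\<^sup>2)"
        proof (rule Bochner_Integration.integrable_bound[OF integrable_mult_right[OF i2, of 2]])
          show "(\<lambda>x. (f (x(i := a)))\<^sup>2) \<in> borel_measurable ?P" using m[of a] by measurable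
        qed (use that in auto)
      qed
      then have "(\<lambda>x. f x - (1 / 2) * (f (x(i := 0)) + f (x(i := 1)))) \<in> L2 ?P"
        by (intro L2_diff f L2_cmult L2_add) auto
      then show ?thesis using True by (simp add: D_def[abs_def])
    next
      case False
      then show ?thesis using h by (simp add: D_def[abs_def])
    qed
    show "AE x in ?P. G i x" for i
      using deriv[of "i - n"] by (cases "i < n") (auto simp: G_def)
    show "(\<integral>z. f (x(i := fst z)) * f (y(i := snd z)) \<partial>c i s') - (\<integral>z. f (x(i := fst z)) * f (y(i := snd z)) \<partial>c i s)
      = (s' - s) * (\<integral>z. D i (x(i := fst z)) * D i (y(i := snd z)) \<partial>e i s s')"
      if s: "0 \<le> s" "s \<le> s'" "s' \<le> 1" and G: "G i x" "G i y" for i x y s s'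
    proof (cases "i < n")
      case True
      then show ?thesis using coin_increment[OF slice[of x i] slice[of y i] s] by (simp add: c_def e_def D_def)
    next
      case False
      then show ?thesis using mehler_increment[OF _ _ s] G by (simp add: c_def e_def D_def G_def)
    qed
    show "coupled_form (d(i := e i s s')) (D i) (D i) \<le> B i s'"
      if s: "0 \<le> s" "s \<le> s'" "s' \<le> 1" and im: "i < m" and d: "\<And>j. coupling (coord n j) (d j)"
        "\<And>j. hypercontractive (1 + s') (coord n j) (d j)" "\<And>j. m \<le> j \<Longrightarrow> d j = coord n j \<Otimes>\<^sub>M coord n j" for i m s s' d
    proof (cases "i < n")
      case True
      have "coupling (coord n j) ((d(i := e i s s')) j)" for j using d(1) ce[OF s] by simp
      from coupled_form_le_L2[where c = "d(i := e i s s')", OF this D[of i]] True show ?thesis by (simp add: B_def)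
    next
      case False
      have "coupled_form (d(i := e i s s')) (D i) (D i) \<le> (\<integral>x. \<bar>D i x\<bar> powr (1 + s') \<partial>?P) powr (2 / (1 + s'))"
      proof (rule coupled_form_le_Lp[where m = m])
        show "coupling (coord n j) ((d(i := e i s s')) j)" for j using d(1) ce[OF s] by simp
        show "hypercontractive (1 + s') (coord n j) ((d(i := e i s s')) j)" for j
          using d(2) False hypercontractive_mehler_avg[OF s] by (simp add: e_def coord_def)
        show "(d(i := e i s s')) j = coord n j \<Otimes>\<^sub>M coord n j" if "m \<le> j" for j using d(3)[OF that] that im by simp
      qed (use s D in auto)
      then show ?thesis using False by (simp add: B_def D_def)
    qed
    show "(\<Sum>k<N. B i (real (Suc k) / real N)) / real N \<le> R i N" if "0 < N" for i N
      using Lp_Riemann_le_phi[OF P.prob_space_axioms h[of "i - n"] that] that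
      by (cases "i < n") (simp_all add: B_def R_def v_def del: of_nat_Suc)
    show "R i \<longlonglongrightarrow> I i" for i
    proof (cases "i < n")
      case False
      have "(\<lambda>N. v (i - n) * (phi (Lp_norm ?P 1 (h (i - n)) / Lp_norm ?P 2 (h (i - n))) + 1 / real N))
        \<longlonglongrightarrow> v (i - n) * (phi (Lp_norm ?P 1 (h (i - n)) / Lp_norm ?P 2 (h (i - n))) + 0)"
        by (intro tendsto_intros lim_const_over_n)
      then show ?thesis using False by (simp add: R_def[abs_def] I_def T_def v_def)
    qed (simp add: R_def[abs_def] I_def)
    show "summable I" by fact
    show "0 \<le> I i" for i using T by (auto simp: I_def intro: Bochner_Integration.integral_nonneg)
  qed
  also have "(\<Sum>i. I i) = (\<Sum>k. T k) + (\<Sum>i<n. I i)"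
    using suminf_split_initial_segment[OF sI, of n] by (simp add: IT)
  also have "(\<Sum>i<n. I i) = (\<Sum>i<n. \<integral>x. (f x - (f (x(i := 0)) + f (x(i := 1))) / 2)\<^sup>2 \<partial>?P)"
    by (intro sum.cong) (auto simp: I_def D_def)
  finally show ?thesis by (simp add: T_def)
qed

section \<open>Coordinates on the cube and the Gaussian sequence space\<close>

lemma prob_space_cube: "finite S \<Longrightarrow> prob_space (cube S)"
  unfolding cube_def by (rule prob_space_uniform_count_measure) (auto simp: PiE_eq_empty_iff intro: finite_PiE)

lemma space_cube: "space (cube S) = PiE S (\<lambda>_. {0, 1})"
  by (simp add: cube_def space_uniform_count_measure)

lemma sets_cube: "sets (cube S) = Pow (PiE S (\<lambda>_. {0, 1}))"
  by (simp add: cube_def sets_uniform_count_measure)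

lemma prob_space_gauss_seq: "prob_space gauss_seq"
  unfolding gauss_seq_def by (intro prob_space_PiM prob_space_gauss)

lemma space_gauss_seq: "space gauss_seq = UNIV"
  by (simp add: gauss_seq_def space_PiM)

context
  fixes S :: "'s set" and n :: nat and h :: "'s \<Rightarrow> nat"
  assumes S: "finite S" and h: "bij_betw h S {..<n}"
begin

definition encode :: "('s \<Rightarrow> nat) \<times> (nat \<Rightarrow> real) \<Rightarrow> nat \<Rightarrow> real" where
  "encode z i = (if i < n then real (fst z (the_inv_into S h i)) else snd z (i - n))"

definition decode :: "(nat \<Rightarrow> real) \<Rightarrow> ('s \<Rightarrow> nat) \<times> (nat \<Rightarrow> real)" where
  "decode w = (\<lambda>q\<in>S. if w (h q) = 0 then 0 else 1, \<lambda>k. w (n + k))"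

lemma h_inv: "i < n \<Longrightarrow> the_inv_into S h i \<in> S" "q \<in> S \<Longrightarrow> the_inv_into S h (h q) = q" "q \<in> S \<Longrightarrow> h q < n"
    "i < n \<Longrightarrow> h (the_inv_into S h i) = i"
  using h the_inv_into_into[of h S] the_inv_into_f_f[of h S] f_the_inv_into_f[of h S] by (auto simp: bij_betw_def)

lemma decode_encode: "z \<in> space (cube_gauss S) \<Longrightarrow> decode (encode z) = z"
  by (cases z) (auto simp: decode_def encode_def cube_gauss_def space_pair_measure space_cube h_inv fun_eq_iff
      PiE_iff extensional_def restrict_def)

lemma sets_coord: "sets (coord n i) = sets borel" by (simp add: coord_def)

lemma space_coord: "space (coord n i) = UNIV" by (simp add: coord_def)

lemma prob_space_coord: "prob_space (coord n i)" by (simp add: coord_def prob_space_fair prob_space_gauss)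

lemma space_PiM_coord: "space (PiM UNIV (coord n)) = UNIV" by (simp add: space_PiM space_coord)

lemma measurable_encode: "encode \<in> cube_gauss S \<rightarrow>\<^sub>M PiM UNIV (coord n)"
proof (rule measurable_PiM_single')
  fix i
  have "(\<lambda>z. encode z i) \<in> borel_measurable (cube_gauss S)"
  proof (cases "i < n")
    case True
    have "(\<lambda>x. real (x (the_inv_into S h i))) \<in> borel_measurable (cube S)"
      unfolding measurable_def by (auto simp: sets_cube space_cube)
    then show ?thesis using True unfolding encode_def cube_gauss_def by (simp add: measurable_compose[OF measurable_fst])
  next
    case False
    have "(\<lambda>y. y (i - n)) \<in> borel_measurable gauss_seq"
      unfolding gauss_seq_def using measurable_component_singleton[of "i - n" UNIV "\<lambda>_. gauss"]
      by (simp cong: measurable_cong_sets)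
    then show ?thesis using False unfolding encode_def cube_gauss_def by (simp add: measurable_compose[OF measurable_snd])
  qed
  then show "(\<lambda>z. encode z i) \<in> cube_gauss S \<rightarrow>\<^sub>M coord n i"
    unfolding measurable_cong_sets[OF refl sets_coord] .
qed (simp add: space_coord)

lemma measurable_decode: "decode \<in> PiM UNIV (coord n) \<rightarrow>\<^sub>M cube_gauss S"
  unfolding decode_def[abs_def] cube_gauss_def
proof (rule measurable_Pair)
  have comp: "(\<lambda>w. w i) \<in> borel_measurable (PiM UNIV (coord n))" for i
    using measurable_component_singleton[of i UNIV "coord n"] unfolding measurable_cong_sets[OF refl sets_coord] by simp
  show "(\<lambda>w. \<lambda>k. w (n + k)) \<in> PiM UNIV (coord n) \<rightarrow>\<^sub>M gauss_seq"
    unfolding gauss_seq_def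
    by (rule measurable_PiM_single') (use comp in \<open>auto cong: measurable_cong_sets\<close>)
  have sets: "sets (cube S) = sets (count_space (PiE S (\<lambda>_. {0, 1})))" by (simp add: sets_cube)
  show "(\<lambda>w. \<lambda>q\<in>S. if w (h q) = 0 then 0 else 1) \<in> PiM UNIV (coord n) \<rightarrow>\<^sub>M cube S"
    unfolding measurable_cong_sets[OF refl sets]
  proof (subst measurable_count_space_eq2)
    show "finite (PiE S (\<lambda>_. {0, 1 :: nat}))" using S by (intro finite_PiE) auto
    have pre: "(\<lambda>w. \<lambda>q\<in>S. if w (h q) = 0 then 0 else 1) -` {a} \<inter> space (PiM UNIV (coord n)) \<in> sets (PiM UNIV (coord n))"
      if a: "a \<in> PiE S (\<lambda>_. {0, 1})" for a :: "'s \<Rightarrow> nat"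
    proof -
      have "(\<lambda>w. \<lambda>q\<in>S. if w (h q) = 0 then 0 else 1) -` {a} \<inter> space (PiM UNIV (coord n))
        = {w \<in> space (PiM UNIV (coord n)). \<forall>q\<in>S. (w (h q) = 0) = (a q = 0)}"
        using a by (auto simp: fun_eq_iff PiE_iff extensional_def split: if_splits) (metis less_numeral_extra(1) neq0_conv)+
      also have "\<dots> \<in> sets (PiM UNIV (coord n))"
      proof (rule sets.sets_Collect_finite_All[OF _ S])
        fix q
        have [measurable]: "(\<lambda>w. w (h q)) \<in> borel_measurable (PiM UNIV (coord n))" by (rule comp)
        show "{w \<in> space (PiM UNIV (coord n)). (w (h q) = 0) = (a q = 0)} \<in> sets (PiM UNIV (coord n))" by measurable
      qed
      finally show ?thesis .
    qed
    have "(\<lambda>w. \<lambda>q\<in>S. if w (h q) = 0 then 0 else 1) \<in> space (PiM UNIV (coord n)) \<rightarrow> PiE S (\<lambda>_. {0, 1 :: nat})"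
      by auto
    with pre show "(\<lambda>w. \<lambda>q\<in>S. if w (h q) = 0 then 0 else 1) \<in> space (PiM UNIV (coord n)) \<rightarrow> PiE S (\<lambda>_. {0, 1 :: nat}) \<and>
      (\<forall>a\<in>PiE S (\<lambda>_. {0, 1 :: nat}). (\<lambda>w. \<lambda>q\<in>S. if w (h q) = 0 then 0 else 1) -` {a} \<inter> space (PiM UNIV (coord n)) \<in> sets (PiM UNIV (coord n)))"
      by blast
  qed
qed

text \<open>Compared on cylinders: the preimage is the product of a box in the cube, which is counted, and
  of a Gaussian cylinder.\<close>

lemma distr_encode: "distr (cube_gauss S) (PiM UNIV (coord n)) encode = PiM UNIV (coord n)"
proof (rule measure_eqI_PiM_infinite[symmetric, OF refl])
  interpret P: prob_space "PiM UNIV (coord n)" by (intro prob_space_PiM prob_space_coord)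
  interpret C: prob_space "cube S" by (rule prob_space_cube[OF S])
  interpret Y: prob_space gauss_seq by (rule prob_space_gauss_seq)
  interpret fair: prob_space fair by (rule prob_space_fair)
  show "finite_measure (PiM UNIV (coord n))" by unfold_locales
  fix J A assume J: "finite J" "J \<subseteq> UNIV" and A: "\<And>i. i \<in> J \<Longrightarrow> A i \<in> sets (coord n i)"
  define A' where "A' i = (if i \<in> J then A i else UNIV)" for i
  have A': "A' i \<in> sets borel" for i using A[of i] by (auto simp: A'_def sets_coord)
  define K where "K = {k. n + k \<in> J}"
  have K: "finite K" unfolding K_def by (rule finite_imageD[of "\<lambda>k. n + k"]) (use J in \<open>auto intro: finite_subset simp: inj_on_def\<close>)
  define X where "X = {x \<in> PiE S (\<lambda>_. {0, 1}). \<forall>q\<in>S. real (x q) \<in> A' (h q)}"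
  have X: "X = PiE S (\<lambda>q. {b \<in> {0, 1}. real b \<in> A' (h q)})" by (auto simp: X_def PiE_iff extensional_def)
  define Z where "Z = prod_emb UNIV (\<lambda>_. gauss) K (PiE K (\<lambda>k. A' (n + k)))"
  have Zs: "Z \<in> sets gauss_seq" unfolding Z_def gauss_seq_def using K A' by (intro sets_PiM_I) auto
  have Xs: "X \<in> sets (cube S)" by (auto simp: X_def sets_cube)
  have fairA: "emeasure fair (A' i) = ennreal (real (card {b \<in> {0, 1 :: nat}. real b \<in> A' i}) / 2)" for i
  proof -
    have "measure fair (A' i) = (\<integral>x. indicator (A' i) x \<partial>fair)" using A' by simp
    also have "\<dots> = (indicator (A' i) 0 + indicator (A' i) 1) / 2" by (rule integral_fair) (use A' in simp)
    also have "\<dots> = real (card {b \<in> {0, 1 :: nat}. real b \<in> A' i}) / 2"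
    proof -
      have "{b \<in> {0, 1 :: nat}. real b \<in> A' i} = (if 0 \<in> A' i then {0} else {}) \<union> (if 1 \<in> A' i then {1} else {})"
        by (auto intro: gr0I)
      then show ?thesis by (auto simp: indicator_def)
    qed
    finally show ?thesis by (simp add: fair.emeasure_eq_measure)
  qed
  have eX: "emeasure (cube S) X = (\<Prod>i<n. emeasure fair (A' i))"
  proof -
    have "emeasure (cube S) X = ennreal (real (card X) / real (card (PiE S (\<lambda>_. {0, 1 :: nat}))))"
      unfolding cube_def using S Xs by (subst emeasure_uniform_count_measure) (auto simp: sets_cube intro: finite_PiE)
    also have "real (card X) / real (card (PiE S (\<lambda>_. {0, 1 :: nat}))) = (\<Prod>q\<in>S. real (card {b \<in> {0, 1 :: nat}. real b \<in> A' (h q)}) / 2)"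
      unfolding X using S by (simp add: card_PiE prod_dividef)
    also have "ennreal \<dots> = (\<Prod>q\<in>S. ennreal (real (card {b \<in> {0, 1 :: nat}. real b \<in> A' (h q)}) / 2))"
      by (rule prod_ennreal[symmetric]) simp
    also have "\<dots> = (\<Prod>q\<in>S. emeasure fair (A' (h q)))" by (simp add: fairA)
    also have "\<dots> = (\<Prod>i<n. emeasure fair (A' i))" using h by (rule prod.reindex_bij_betw)
    finally show ?thesis .
  qed
  have eZ: "emeasure gauss_seq Z = (\<Prod>i\<in>{i\<in>J. n \<le> i}. emeasure gauss (A' i))"
  proof -
    have "emeasure gauss_seq Z = (\<Prod>k\<in>K. emeasure gauss (A' (n + k)))"
      unfolding Z_def gauss_seq_def using K A' by (intro emeasure_PiM_emb prob_space_gauss) auto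
    also have "\<dots> = (\<Prod>i\<in>{i\<in>J. n \<le> i}. emeasure gauss (A' i))"
      by (rule prod.reindex_bij_witness[where i = "\<lambda>i. i - n" and j = "\<lambda>k. n + k"]) (auto simp: K_def)
    finally show ?thesis .
  qed
  have pre: "encode -` prod_emb UNIV (coord n) J (Pi\<^sub>E J A) \<inter> space (cube_gauss S) = X \<times> Z"
  proof -
    have "encode z \<in> prod_emb UNIV (coord n) J (Pi\<^sub>E J A) \<longleftrightarrow> (\<forall>i. encode z i \<in> A' i)" for z
      by (auto simp: prod_emb_def PiE_iff A'_def space_coord)
    moreover have "(\<forall>i. encode z i \<in> A' i) \<longleftrightarrow> (\<forall>q\<in>S. real (fst z q) \<in> A' (h q)) \<and> (\<forall>k. snd z k \<in> A' (n + k))" for z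
    proof
      assume *: "\<forall>i. encode z i \<in> A' i"
      have "real (fst z q) \<in> A' (h q)" if "q \<in> S" for q using *[rule_format, of "h q"] that by (simp add: encode_def h_inv)
      moreover have "snd z k \<in> A' (n + k)" for k using *[rule_format, of "n + k"] by (simp add: encode_def)
      ultimately show "(\<forall>q\<in>S. real (fst z q) \<in> A' (h q)) \<and> (\<forall>k. snd z k \<in> A' (n + k))" by blast
    next
      assume *: "(\<forall>q\<in>S. real (fst z q) \<in> A' (h q)) \<and> (\<forall>k. snd z k \<in> A' (n + k))"
      show "\<forall>i. encode z i \<in> A' i"
      proof
        fix i show "encode z i \<in> A' i"
        proof (cases "i < n")
          case True
          then show ?thesis using *[THEN conjunct1, rule_format, OF h_inv(1)[OF True]] by (simp add: encode_def h_inv)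
        next
          case False
          then show ?thesis using *[THEN conjunct2, rule_format, of "i - n"] by (simp add: encode_def)
        qed
      qed
    qed
    moreover have "Z = {y. \<forall>k. y k \<in> A' (n + k)}"
      by (auto simp: Z_def prod_emb_def PiE_iff K_def A'_def)
    ultimately show ?thesis by (auto simp: X_def cube_gauss_def space_pair_measure space_cube space_gauss_seq)
  qed
  have "emeasure (PiM UNIV (coord n)) (prod_emb UNIV (coord n) J (Pi\<^sub>E J A)) = (\<Prod>i\<in>J. emeasure (coord n i) (A i))"
    using J A by (intro emeasure_PiM_emb prob_space_coord) auto
  also have "\<dots> = (\<Prod>i\<in>{i\<in>J. i < n}. emeasure (coord n i) (A i)) * (\<Prod>i\<in>{i\<in>J. n \<le> i}. emeasure (coord n i) (A i))"
    using J by (subst prod.union_disjoint[symmetric]) (auto intro!: prod.cong)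
  also have "(\<Prod>i\<in>{i\<in>J. i < n}. emeasure (coord n i) (A i)) = (\<Prod>i<n. emeasure fair (A' i))"
    using J fair.emeasure_space_1 by (intro prod.mono_neutral_cong_left) (auto simp: A'_def coord_def)
  also have "(\<Prod>i\<in>{i\<in>J. n \<le> i}. emeasure (coord n i) (A i)) = (\<Prod>i\<in>{i\<in>J. n \<le> i}. emeasure gauss (A' i))"
    by (intro prod.cong) (auto simp: A'_def coord_def)
  also have "(\<Prod>i<n. emeasure fair (A' i)) * (\<Prod>i\<in>{i\<in>J. n \<le> i}. emeasure gauss (A' i)) = emeasure (cube_gauss S) (X \<times> Z)"
    unfolding cube_gauss_def eX[symmetric] eZ[symmetric] by (rule Y.emeasure_pair_measure_Times[OF Xs Zs, symmetric])
  also have "\<dots> = emeasure (distr (cube_gauss S) (PiM UNIV (coord n)) encode) (prod_emb UNIV (coord n) J (Pi\<^sub>E J A))"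
    using J A by (subst emeasure_distr[OF measurable_encode]) (auto simp: pre intro: sets_PiM_I)
  finally show "emeasure (PiM UNIV (coord n)) (prod_emb UNIV (coord n) J (Pi\<^sub>E J A))
    = emeasure (distr (cube_gauss S) (PiM UNIV (coord n)) encode) (prod_emb UNIV (coord n) J (Pi\<^sub>E J A))" .
qed simp

lemma distr_decode: "distr (PiM UNIV (coord n)) (cube_gauss S) decode = cube_gauss S"
proof -
  have "distr (PiM UNIV (coord n)) (cube_gauss S) decode = distr (distr (cube_gauss S) (PiM UNIV (coord n)) encode) (cube_gauss S) decode"
    by (simp only: distr_encode)
  also have "\<dots> = distr (cube_gauss S) (cube_gauss S) (decode \<circ> encode)"
    by (rule distr_distr[OF measurable_decode measurable_encode])
  also have "\<dots> = distr (cube_gauss S) (cube_gauss S) (\<lambda>z. z)"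
    by (rule distr_cong) (simp_all add: decode_encode)
  finally show ?thesis by (simp add: distr_id)
qed

lemma decode_coin: "q \<in> S \<Longrightarrow> b \<in> {0, 1} \<Longrightarrow> decode (w(h q := real b)) = ((fst (decode w))(q := b), snd (decode w))"
  using bij_betw_imp_inj_on[OF h] h_inv(3)[of q]
  by (auto simp: decode_def fun_eq_iff restrict_def inj_on_eq_iff)

lemma decode_gauss: "decode (w(n + k := t)) = (fst (decode w), (snd (decode w))(k := t))"
proof -
  have "h q \<noteq> n + k" if "q \<in> S" for q using h_inv(3)[OF that] by simp
  then show ?thesis by (auto simp: decode_def fun_eq_iff restrict_def)
qed

lemma integral_decode:
  assumes "f \<in> borel_measurable (cube_gauss S)"
  shows "(\<integral>w. f (decode w) \<partial>PiM UNIV (coord n)) = (\<integral>z. f z \<partial>cube_gauss S :: real)"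
  using integral_distr[OF measurable_decode assms] by (simp add: distr_decode)

lemma L2_decode:
  assumes f: "f \<in> L2 (cube_gauss S)" shows "(\<lambda>w. f (decode w)) \<in> L2 (PiM UNIV (coord n))"
proof -
  have [measurable]: "f \<in> borel_measurable (cube_gauss S)" and i: "integrable (cube_gauss S) (\<lambda>z. (f z)\<^sup>2)"
    using f by (auto simp: L2_def)
  have "integrable (PiM UNIV (coord n)) (\<lambda>w. (f (decode w))\<^sup>2)"
    using integrable_distr[OF measurable_decode, of "\<lambda>z. (f z)\<^sup>2"] i by (simp add: distr_decode)
  then show ?thesis using measurable_compose[OF measurable_decode, of f borel] by (simp add: L2_def)
qed

lemma Lp_norm_decode:
  assumes "f \<in> borel_measurable (cube_gauss S)"
  shows "Lp_norm (PiM UNIV (coord n)) p (\<lambda>w. f (decode w)) = Lp_norm (cube_gauss S) p f"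
  unfolding Lp_norm_def using integral_decode[of "\<lambda>z. \<bar>f z\<bar> powr p"] assms by simp

lemma AE_decode:
  assumes "AE z in cube_gauss S. P z" shows "AE w in PiM UNIV (coord n). P (decode w)"
proof (rule AE_distrD[OF measurable_decode])
  show "AE z in distr (PiM UNIV (coord n)) (cube_gauss S) decode. P z" unfolding distr_decode by (rule assms)
qed

lemma L2_section_gauss:
  assumes f: "f \<in> L2 (PiM UNIV (coord n))"
  shows "AE w in PiM UNIV (coord n). (\<lambda>t. f (w(n + k := t))) \<in> L2 gauss"
proof -
  have fm: "f \<in> borel_measurable (PiM UNIV (coord n))" and i: "integrable (PiM UNIV (coord n)) (\<lambda>z. (f z)\<^sup>2)"
    using f by (auto simp: L2_def)
  have m: "(\<lambda>t. f (w(n + k := t))) \<in> borel_measurable gauss" for w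
    using measurable_upd_section[OF fm, of w "n + k"] by (simp add: space_PiM_coord coord_def)
  have "AE w in PiM UNIV (coord n). integrable (coord n (n + k)) (\<lambda>t. (f (w(n + k := t)))\<^sup>2)"
    by (rule AE_integrable_resample[of "coord n" "coord n" "n + k", OF prob_space_coord prob_space_coord refl refl i])
  then show ?thesis by eventually_elim (use m in \<open>simp add: L2_def coord_def\<close>)
qed

text \<open>The weak derivative identity holds almost everywhere for each test function, hence almost
  everywhere for all test functions with rational endpoints at once.\<close>

lemma partial_deriv_section:
  assumes f: "f \<in> L2 (cube_gauss S)" and g: "is_partial_deriv S k f g"
  shows "AE w in PiM UNIV (coord n). has_gauss_deriv (\<lambda>t. f (decode (w(n + k := t)))) (\<lambda>t. g (decode (w(n + k := t))))"
proof -
  have gL: "g \<in> L2 (cube_gauss S)" using g by (simp add: is_partial_deriv_def)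
  have "AE w in PiM UNIV (coord n). \<forall>m. \<forall>a b :: rat. a < b \<longrightarrow>
      - (\<integral>t. deriv (test m (of_rat a) (of_rat b)) t * f (decode (w(n + k := t))) \<partial>lborel)
      = (\<integral>t. test m (of_rat a) (of_rat b) t * g (decode (w(n + k := t))) \<partial>lborel)"
    unfolding AE_all_countable
  proof (intro allI)
    fix m and a b :: rat
    show "AE w in PiM UNIV (coord n). a < b \<longrightarrow>
      - (\<integral>t. deriv (test m (of_rat a) (of_rat b)) t * f (decode (w(n + k := t))) \<partial>lborel)
      = (\<integral>t. test m (of_rat a) (of_rat b) t * g (decode (w(n + k := t))) \<partial>lborel)"
    proof (cases "a < b")
      case True
      then have "smooth_compact_support (test m (of_rat a) (of_rat b))"
        by (intro smooth_compact_support_test) (simp add: of_rat_less)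
      then have "AE z in cube_gauss S. - (\<integral>t. deriv (test m (of_rat a) (of_rat b)) t * f (fst z, (snd z)(k := t)) \<partial>lborel)
        = (\<integral>t. test m (of_rat a) (of_rat b) t * g (fst z, (snd z)(k := t)) \<partial>lborel)"
        using g unfolding is_partial_deriv_def by (simp add: case_prod_beta')
      from AE_decode[OF this] show ?thesis by (simp add: decode_gauss)
    qed simp
  qed
  then show ?thesis
    using L2_section_gauss[OF L2_decode[OF f], of k] L2_section_gauss[OF L2_decode[OF gL], of k]
  proof eventually_elim
    case (elim w)
    show ?case
    proof (rule weak_derivative_has_gauss_deriv[OF elim(2,3)])
      fix m and a b :: real assume "a \<in> \<rat>" "b \<in> \<rat>" "a < b"
      then obtain a' b' where "a = of_rat a'" "b = of_rat b'" "a' < b'" by (auto elim!: Rats_cases simp: of_rat_less)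
      then show "- (\<integral>t. deriv (test m a b) t * f (decode (w(n + k := t))) \<partial>lborel)
        = (\<integral>t. test m a b t * g (decode (w(n + k := t))) \<partial>lborel)" using elim(1) by simp
    qed
  qed
qed

lemma nabla_decode:
  assumes q: "q \<in> S"
  shows "nabla q f (decode w) = f (decode w) - (f (decode (w(h q := 0))) + f (decode (w(h q := 1)))) / 2"
  using decode_coin[OF q, of 0 w] decode_coin[OF q, of 1 w]
  by (cases "decode w") (simp add: nabla_def integral_coin)

lemma nabla_measurable:
  assumes q: "q \<in> S" and f: "f \<in> borel_measurable (cube_gauss S)"
  shows "nabla q f \<in> borel_measurable (cube_gauss S)"
proof -
  have upd: "(\<lambda>(x, y). (x(q := b), y)) \<in> cube_gauss S \<rightarrow>\<^sub>M cube_gauss S" if "b \<in> {0, 1}" for b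
  proof -
    have "(\<lambda>x. x(q := b)) \<in> cube S \<rightarrow>\<^sub>M cube S"
      using that q by (auto simp: measurable_def sets_cube space_cube PiE_iff extensional_def)
    then show ?thesis unfolding cube_gauss_def by measurable
  qed
  have "nabla q f = (\<lambda>z. f z - (f (case z of (x, y) \<Rightarrow> (x(q := 0), y)) + f (case z of (x, y) \<Rightarrow> (x(q := 1), y))) / 2)"
    by (auto simp: nabla_def integral_coin fun_eq_iff)
  moreover have "(\<lambda>z. f (case z of (x, y) \<Rightarrow> (x(q := b), y))) \<in> borel_measurable (cube_gauss S)" if "b \<in> {0, 1}" for b
    by (rule measurable_compose[OF upd[OF that] f])
  ultimately show ?thesis using f by simp
qed

lemma variance_bound:
  assumes f: "f \<in> H12 S"
  shows "prob_space.variance (cube_gauss S) f \<le>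
    (\<Sum>q\<in>S. (Lp_norm (cube_gauss S) 2 (nabla q f))\<^sup>2) +
    (\<Sum>i. (Lp_norm (cube_gauss S) 2 (partial_deriv S i f))\<^sup>2 *
       phi (Lp_norm (cube_gauss S) 1 (partial_deriv S i f) /
            Lp_norm (cube_gauss S) 2 (partial_deriv S i f)))"
proof -
  interpret C: prob_space "cube S" by (rule prob_space_cube[OF S])
  interpret Y: prob_space gauss_seq by (rule prob_space_gauss_seq)
  interpret CY: pair_prob_space "cube S" gauss_seq ..
  interpret Q: prob_space "cube_gauss S" unfolding cube_gauss_def by (rule CY.prob_space_axioms)
  have fL: "f \<in> L2 (cube_gauss S)" and summ: "summable (\<lambda>i. (Lp_norm (cube_gauss S) 2 (partial_deriv S i f))\<^sup>2)"
    using f by (auto simp: H12_def)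
  have pd: "is_partial_deriv S i f (partial_deriv S i f)" for i
  proof -
    have "\<exists>g. is_partial_deriv S i f g" using f by (simp add: H12_def)
    then show ?thesis unfolding partial_deriv_def by (rule someI_ex)
  qed
  have pL: "partial_deriv S i f \<in> L2 (cube_gauss S)" for i using pd[of i] by (simp add: is_partial_deriv_def)
  have fm[measurable]: "f \<in> borel_measurable (cube_gauss S)" and fi: "integrable (cube_gauss S) (\<lambda>z. (f z)\<^sup>2)"
    using fL by (auto simp: L2_def)
  have pm: "partial_deriv S i f \<in> borel_measurable (cube_gauss S)" for i using pL[of i] by (simp add: L2_def)
  note N = Lp_norm_decode[OF pm]
  let ?P = "PiM UNIV (coord n)"
  have "(\<integral>w. (f (decode w))\<^sup>2 \<partial>?P) - (\<integral>w. f (decode w) \<partial>?P)\<^sup>2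
    \<le> (\<Sum>i<n. \<integral>w. (f (decode w) - (f (decode (w(i := 0))) + f (decode (w(i := 1)))) / 2)\<^sup>2 \<partial>?P) +
      (\<Sum>k. (Lp_norm ?P 2 (\<lambda>w. partial_deriv S k f (decode w)))\<^sup>2 *
        phi (Lp_norm ?P 1 (\<lambda>w. partial_deriv S k f (decode w)) / Lp_norm ?P 2 (\<lambda>w. partial_deriv S k f (decode w))))"
    by (rule variance_bound_coord[OF L2_decode[OF fL] L2_decode[OF pL] partial_deriv_section[OF fL pd]])
      (simp add: N summ)
  also have "(\<integral>w. (f (decode w))\<^sup>2 \<partial>?P) - (\<integral>w. f (decode w) \<partial>?P)\<^sup>2 = Q.variance f"
    using Q.variance_eq[OF Q.integrable_L2[OF fm fi] fi] integral_decode[of "\<lambda>z. (f z)\<^sup>2"] integral_decode[OF fm] by simp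
  also have "(\<Sum>i<n. \<integral>w. (f (decode w) - (f (decode (w(i := 0))) + f (decode (w(i := 1)))) / 2)\<^sup>2 \<partial>?P)
    = (\<Sum>q\<in>S. \<integral>w. (nabla q f (decode w))\<^sup>2 \<partial>?P)"
    by (subst sum.reindex_bij_betw[OF h, symmetric]) (simp add: nabla_decode)
  also have "\<dots> = (\<Sum>q\<in>S. (Lp_norm (cube_gauss S) 2 (nabla q f))\<^sup>2)"
  proof (rule sum.cong[OF refl])
    fix q assume "q \<in> S"
    then have "(\<integral>w. (nabla q f (decode w))\<^sup>2 \<partial>?P) = (\<integral>z. (nabla q f z)\<^sup>2 \<partial>cube_gauss S)"
      using integral_decode[of "\<lambda>z. (nabla q f z)\<^sup>2"] nabla_measurable[OF _ fm] by simp
    then show "(\<integral>w. (nabla q f (decode w))\<^sup>2 \<partial>?P) = (Lp_norm (cube_gauss S) 2 (nabla q f))\<^sup>2"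
      by (simp add: Lp_norm_2_sq)
  qed
  finally show ?thesis unfolding N .
qed

end

theorem proposition2p2:
  fixes S :: "'s set"
    and f :: "('s \<Rightarrow> nat) \<times> (nat \<Rightarrow> real) \<Rightarrow> real"
  assumes "finite S"
    and "f \<in> H12 S"
  shows "prob_space.variance (cube_gauss S) f \<le>
    (\<Sum>q\<in>S. (Lp_norm (cube_gauss S) 2 (nabla q f))\<^sup>2) +
    (\<Sum>i. (Lp_norm (cube_gauss S) 2 (partial_deriv S i f))\<^sup>2 *
       phi (Lp_norm (cube_gauss S) 1 (partial_deriv S i f) /
            Lp_norm (cube_gauss S) 2 (partial_deriv S i f)))"
proof -
  obtain h where "bij_betw h S {0..<card S}" using ex_bij_betw_finite_nat[OF assms(1)] by blast
  then have "bij_betw h S {..<card S}" by (simp add: atLeast0LessThan)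
  from variance_bound[OF assms(1) this assms(2)] show ?thesis .
qed

end
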